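(* Let $f$ satisfy the structure conditions (i)–(vi) below and $\sigma\in(0,1)$. Let $\Sigma$ be a smooth strictly locally convex graph in $\mathbb{H}^{n+1}$ (over a bounded domain, smooth up to its boundary $\partial\Sigma$) satisfying $f(\kappa)=\sigma$ and \[ \nu^{n+1}\ge2a>0\quad\text{on }\Sigma \] for a constant $a$. For $\mathbf{x}\in\Sigma$ let $\kappa_{\max}(\mathbf{x})$ be the largest principal curvature of $\Sigma$ at $\mathbf{x}$. Then \[ \max_\Sigma\frac{\kappa_{\max}}{\nu^{n+1}-a}\le\max\Big\{\frac{4n}{a^3},\ \max_{\partial\Sigma}\frac{\kappa_{\max}}{\nu^{n+1}-a}\Big\}. \]
   Context: Half-space model $\mathbb{H}^{n+1}=\{(x,x_{n+1}):x_{n+1}>0\}$, metric $\sum dx_i^2/x_{n+1}^2$. The graph is oriented upward; $\kappa=(\kappa_1,\dots,\kappa_n)$ are its hyperbolic principal curvatures, strictly locally convex meaning all positive. $\nu^{n+1}$ is the last component of the upward Euclidean unit normal. $K_n^+=\{\lambda:\lambda_i>0\}$. Structure conditions on smooth symmetric $f$ on $K_n^+$: (i) $f_i>0$; (ii) concave; (iii) $f>0$ in $K_n^+$, $f=0$ on $\partial K_n^+$; (iv) $f(1,\dots,1)=1$; (v) homogeneous of degree one; (vi) there are $\varepsilon_0,\delta_0>0$ with $\lim_{R\to\infty}f(\lambda_1,\dots,\lambda_{n-1},\lambda_n+R)\ge1+\varepsilon_0$ uniformly on $B_{\delta_0}(1,\dots,1)$. *)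

theory Defs
  imports "HOL-Analysis.Analysis"
begin

definition has_partial ::
  "(real^'n \<Rightarrow> real) \<Rightarrow> 'n \<Rightarrow> real \<Rightarrow> real^'n \<Rightarrow> bool" where
  "has_partial g i d x \<longleftrightarrow>
     ((\<lambda>t. g (x + t *\<^sub>R axis i 1)) has_real_derivative d) (at 0)"

text \<open>D is a family of all iterated partial derivatives on the open set S:
  D [] is the function, D (i # ks) is the i-th partial derivative of D ks,
  and all of them are continuous on T (T = S for C^infinity(S),
  T = closure S for C^infinity up to the boundary).\<close>
definition smooth_family ::
  "(real^'n) set \<Rightarrow> (real^'n) set \<Rightarrow> ('n list \<Rightarrow> real^'n \<Rightarrow> real) \<Rightarrow> bool" where
  "smooth_family S T D \<longleftrightarrow> open S \<and> S \<subseteq> T \<and> T \<subseteq> closure S \<and>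
     (\<forall>ks i. \<forall>x\<in>S. has_partial (D ks) i (D (i # ks) x) x) \<and>
     (\<forall>ks. continuous_on T (D ks))"

definition smooth_on :: "(real^'n) set \<Rightarrow> (real^'n \<Rightarrow> real) \<Rightarrow> bool" where
  "smooth_on S g \<longleftrightarrow> (\<exists>D. smooth_family S S D \<and> (\<forall>x\<in>S. D [] x = g x))"

definition Kplus :: "(real^'n) set" where
  "Kplus = {lam. \<forall>i. lam $ i > 0}"

definition symmetric_fun :: "(real^'n \<Rightarrow> real) \<Rightarrow> bool" where
  "symmetric_fun f \<longleftrightarrow>
     (\<forall>p lam. p permutes (UNIV :: 'n set) \<longrightarrow> lam \<in> Kplus \<longrightarrow>
        f (\<chi> i. lam $ p i) = f lam)"

definition structure_conditions :: "(real^'n \<Rightarrow> real) \<Rightarrow> bool" where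
  "structure_conditions f \<longleftrightarrow>
     smooth_on Kplus f \<and> symmetric_fun f \<and>
     \<comment> \<open>(i)\<close>
     (\<forall>lam\<in>Kplus. \<forall>i. \<exists>d. d > 0 \<and> has_partial f i d lam) \<and>
     \<comment> \<open>(ii)\<close>
     concave_on Kplus f \<and>
     \<comment> \<open>(iii)\<close>
     (\<forall>lam\<in>Kplus. f lam > 0) \<and> continuous_on (closure Kplus) f \<and>
     (\<forall>lam\<in>frontier Kplus. f lam = 0) \<and>
     \<comment> \<open>(iv)\<close>
     f (\<chi> i. 1) = 1 \<and>
     \<comment> \<open>(v)\<close>
     (\<forall>lam\<in>Kplus. \<forall>t>0. f (t *\<^sub>R lam) = t * f lam) \<and>
     \<comment> \<open>(vi), last coordinate taken as some index k (immaterial by symmetry)\<close>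
     (\<exists>k \<epsilon>0 \<delta>0. \<epsilon>0 > 0 \<and> \<delta>0 > 0 \<and>
        (\<exists>R0. \<forall>R\<ge>R0. \<forall>lam\<in>ball (\<chi> i. 1) \<delta>0 \<inter> Kplus.
            f (lam + R *\<^sub>R axis k 1) \<ge> 1 + \<epsilon>0))"

text \<open>D is the family of derivatives of u (u = D []).
  Du_i = D [i], u_ij = D [i,j].\<close>

definition gradsq :: "('n list \<Rightarrow> real^'n \<Rightarrow> real) \<Rightarrow> real^'n \<Rightarrow> real" where
  "gradsq D x = (\<Sum>i\<in>UNIV. (D [i] x)\<^sup>2)"

definition wfun :: "('n list \<Rightarrow> real^'n \<Rightarrow> real) \<Rightarrow> real^'n \<Rightarrow> real" where
  "wfun D x = sqrt (1 + gradsq D x)"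

text \<open>Last component of the upward Euclidean unit normal (-Du, 1)/w.\<close>
definition nu_last :: "('n list \<Rightarrow> real^'n \<Rightarrow> real) \<Rightarrow> real^'n \<Rightarrow> real" where
  "nu_last D x = 1 / wfun D x"

text \<open>gamma = g^{-1/2}, where g_ij = delta_ij + u_i u_j is the induced Euclidean metric.\<close>
definition gammaM :: "('n list \<Rightarrow> real^'n \<Rightarrow> real) \<Rightarrow> real^'n \<Rightarrow> real^'n^'n" where
  "gammaM D x = (\<chi> i j. (if i = j then 1 else 0)
      - D [i] x * D [j] x / (wfun D x * (1 + wfun D x)))"

definition hessM :: "('n list \<Rightarrow> real^'n \<Rightarrow> real) \<Rightarrow> real^'n \<Rightarrow> real^'n^'n" where
  "hessM D x = (\<chi> i j. D [i, j] x)"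

text \<open>Euclidean shape operator (w.r.t. the upward normal) in the orthonormal
  frame given by gamma: its eigenvalues are the Euclidean principal curvatures.\<close>
definition eucl_shape :: "('n list \<Rightarrow> real^'n \<Rightarrow> real) \<Rightarrow> real^'n \<Rightarrow> real^'n^'n" where
  "eucl_shape D x = (1 / wfun D x) *\<^sub>R (gammaM D x ** hessM D x ** gammaM D x)"

text \<open>Hyperbolic shape operator: kappa_i = x_{n+1} kappa^e_i + nu^{n+1}.\<close>
definition hyp_shape :: "('n list \<Rightarrow> real^'n \<Rightarrow> real) \<Rightarrow> real^'n \<Rightarrow> real^'n^'n" where
  "hyp_shape D x = D [] x *\<^sub>R eucl_shape D x + nu_last D x *\<^sub>R mat 1"

definition principal_curvatures ::
  "('n list \<Rightarrow> real^'n \<Rightarrow> real) \<Rightarrow> real^'n \<Rightarrow> real^'n \<Rightarrow> bool" where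
  "principal_curvatures D x \<kappa> \<longleftrightarrow>
     (\<exists>P::real^'n^'n. orthogonal_matrix P \<and>
        hyp_shape D x = P ** (\<chi> i j. if i = j then \<kappa> $ i else 0) ** transpose P)"

definition kappa_max :: "('n list \<Rightarrow> real^'n \<Rightarrow> real) \<Rightarrow> real^'n \<Rightarrow> real" where
  "kappa_max D x = Max {l. \<exists>v. v \<noteq> 0 \<and> hyp_shape D x *v v = l *\<^sub>R v}"

end

theory Submission
  imports Defs "HOL-Library.Landau_Symbols" "HOL-Combinatorics.Permutations"
begin

text \<open>
  The idea is to work with $\phi = (u^2 + |x|^2)/2$: the hyperbolic principal curvatures are the
  eigenvalues of $D^2\phi / w$ relative to $G = I + Du \otimes Du$, where $w = 1/\nu^{n+1}$, so the Codazzi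
  equations become the symmetry of the derivatives of $\phi$. Let $M$ be the maximum of
  $\kappa_{max}/(\nu^{n+1} - a)$, attained at an interior point $x_0$ with principal frame $E_i$ and top
  direction $E_m$. Two families of inequalities touch zero at $x_0$ and may be tested to second order there:
  $D^2\phi(v,v) \le M (1 - a w) G(v,v)$ for all $(x, v)$, and $\sum_i g_i D^2\phi(F_i,F_i) \ge \sigma w$
  for all $x$ and all $G$-orthonormal frames $F$, where $g = Df(\kappa(x_0))$. The second one encodes
  the concavity of $f$ as a function of the shape operator without differentiating eigenvalues.
  Testing the first along $E_i$ with weight $g_i$ and the second along $E_m$, and letting the frame turn in
  the planes of $E_m$ and $E_i$, the fourth derivatives of $u$ cancel, and what remains is
  an algebraic inequality that bounds $\kappa_{max}(x_0)$ by $12 w$.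
\<close>

subsection \<open>Functions with continuous partial derivatives\<close>

text \<open>The obstacle is that \<open>kappa_max\<close>, like every ordered eigenvalue, may fail
  to be smooth where principal curvatures coincide. Leaving the tangent vector, respectively the
  whole frame, as a free variable replaces eigenvalues by quadratic forms with smooth coefficients.
  Second order expansions along straight lines then suffice, and the freedom to turn the vectors
  supplies what the second derivative of an eigenvalue would give. The estimate closes because the
  decisive term of the final inequality is quadratic in the largest curvature with negative
  coefficient of size \<open>1 / w^2\<close>. All other terms are bounded above by multiples of that
  curvature times \<open>\<Sum> g i * k i = \<sigma> * w\<close>, where \<open>k i\<close> is
  \<open>w\<close> times the \<open>i\<close>-th principal curvature. The constant:
  \<open>kappa_max \<le> 12 * w\<close> and \<open>w \<le> 1 / (2 * a)\<close> give a quotient of at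
  most \<open>6 / a^2 = 6 * a / a^3\<close>. Since \<open>\<nu> \<le> 1\<close> forces
  \<open>a \<le> 1 / 2\<close>, this is at most \<open>3 / a^3\<close>, below
  \<open>4 * n / a^3\<close>.\<close>

lemma has_partial_line:
  assumes "has_partial g i d (x + s *\<^sub>R axis i 1)"
  shows "((\<lambda>t. g (x + t *\<^sub>R axis i 1)) has_real_derivative d) (at s)"
proof -
  have "((\<lambda>t. g (x + (t + s) *\<^sub>R axis i 1)) has_real_derivative d) (at 0)"
    using assms by (simp add: has_partial_def scaleR_add_left add_ac)
  then show ?thesis
    using DERIV_shift[of "\<lambda>t. g (x + t *\<^sub>R axis i 1)" d 0 s] by simp
qed

lemma MVT_partial:
  fixes g :: "real^'n \<Rightarrow> real"
  assumes "\<And>s. \<bar>s\<bar> \<le> \<bar>h\<bar> \<Longrightarrow> has_partial g i (d (x + s *\<^sub>R axis i 1)) (x + s *\<^sub>R axis i 1)"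
  shows "\<exists>s. \<bar>s\<bar> \<le> \<bar>h\<bar> \<and> g (x + h *\<^sub>R axis i 1) - g x = h * d (x + s *\<^sub>R axis i 1)"
proof -
  define F where "F = (\<lambda>t. g (x + t *\<^sub>R axis i 1))"
  have F: "(F has_real_derivative d (x + s *\<^sub>R axis i 1)) (at s)" if "\<bar>s\<bar> \<le> \<bar>h\<bar>" for s
    unfolding F_def by (rule has_partial_line) (rule assms[OF that])
  consider "h = 0" | "h > 0" | "h < 0" by linarith
  then show ?thesis
  proof cases
    case 1 then show ?thesis by (intro exI[of _ 0]) simp
  next
    case 2
    then obtain z where "0 < z" "z < h" "F h - F 0 = (h - 0) * d (x + z *\<^sub>R axis i 1)"
      using MVT2[of 0 h F "\<lambda>s. d (x + s *\<^sub>R axis i 1)"] F by force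
    then show ?thesis by (intro exI[of _ z]) (auto simp: F_def)
  next
    case 3
    then obtain z where "h < z" "z < 0" "F 0 - F h = (0 - h) * d (x + z *\<^sub>R axis i 1)"
      using MVT2[of h 0 F "\<lambda>s. d (x + s *\<^sub>R axis i 1)"] F by force
    then show ?thesis by (intro exI[of _ z]) (auto simp: F_def algebra_simps)
  qed
qed

text \<open>Induction on the set of coordinates in which the increment may be nonzero. Each new
  coordinate costs one mean value step, and continuity of that partial derivative at
  \<open>x\<close> replaces the intermediate point by \<open>x\<close>.\<close>

lemma has_derivative_partials:
  fixes g :: "real^'n \<Rightarrow> real" and d :: "'n \<Rightarrow> real^'n \<Rightarrow> real"
  assumes S: "open S" "x \<in> S"
    and part: "\<And>i y. y \<in> S \<Longrightarrow> has_partial g i (d i y) y"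
    and cont: "\<And>i. continuous_on S (d i)"
  shows "(g has_derivative (\<lambda>h. \<Sum>i\<in>UNIV. h $ i * d i x)) (at x)"
proof -
  have claim: "\<forall>\<epsilon>>0. \<exists>\<delta>>0. \<forall>h. norm h < \<delta> \<longrightarrow> (\<forall>i. i \<notin> I \<longrightarrow> h $ i = 0) \<longrightarrow>
      \<bar>g (x + h) - g x - (\<Sum>i\<in>I. h $ i * d i x)\<bar> \<le> \<epsilon> * norm h" for I
  proof (induction I rule: finite_induct[OF finite])
    case 1
    then show ?case by (auto intro!: exI[of _ 1] simp: vec_eq_iff[symmetric] zero_vec_def[symmetric])
      (metis abs_zero add.right_neutral cancel_comm_monoid_add_class.diff_cancel norm_zero mult_zero_right order_refl vec_eq_iff zero_index)
  next
    case (2 k I)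
    show ?case
    proof (intro allI impI)
      fix \<epsilon> :: real assume "\<epsilon> > 0"
      then obtain \<delta>1 where \<delta>1: "\<delta>1 > 0" "\<And>h. norm h < \<delta>1 \<Longrightarrow> (\<And>i. i \<notin> I \<Longrightarrow> h $ i = 0) \<Longrightarrow>
          \<bar>g (x + h) - g x - (\<Sum>i\<in>I. h $ i * d i x)\<bar> \<le> \<epsilon>/2 * norm h"
        using 2(3) by (metis half_gt_zero)
      obtain \<delta>2 where \<delta>2: "\<delta>2 > 0" "ball x \<delta>2 \<subseteq> S"
        using S open_contains_ball by blast
      have "continuous (at x) (d k)"
        using cont S continuous_on_eq_continuous_at by blast
      then obtain \<delta>3 where \<delta>3: "\<delta>3 > 0" "\<And>y. dist y x < \<delta>3 \<Longrightarrow> dist (d k y) (d k x) < \<epsilon>/2"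
        using \<open>\<epsilon> > 0\<close> unfolding continuous_at_eps_delta by (metis half_gt_zero)
      define \<delta> where "\<delta> = min \<delta>1 (min \<delta>2 \<delta>3)"
      show "\<exists>\<delta>>0. \<forall>h. norm h < \<delta> \<longrightarrow> (\<forall>i. i \<notin> insert k I \<longrightarrow> h $ i = 0) \<longrightarrow>
          \<bar>g (x + h) - g x - (\<Sum>i\<in>insert k I. h $ i * d i x)\<bar> \<le> \<epsilon> * norm h"
      proof (intro exI[of _ \<delta>] conjI allI impI)
        show "\<delta> > 0" using \<delta>1 \<delta>2 \<delta>3 by (simp add: \<delta>_def)
        fix h :: "real^'n" assume h: "norm h < \<delta>" "\<forall>i. i \<notin> insert k I \<longrightarrow> h $ i = 0"
        define h' where "h' = h - h $ k *\<^sub>R axis k 1"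
        have hk: "h = h' + h $ k *\<^sub>R axis k 1" by (simp add: h'_def)
        have small: "norm (h' + s *\<^sub>R axis k 1) \<le> norm h" if "\<bar>s\<bar> \<le> \<bar>h $ k\<bar>" for s
          by (rule norm_le_componentwise_cart) (use that in \<open>auto simp: h'_def axis_def\<close>)
        have h'le: "norm h' \<le> norm h" using small[of 0] by simp
        have a: "\<bar>g (x + h') - g x - (\<Sum>i\<in>I. h $ i * d i x)\<bar> \<le> \<epsilon>/2 * norm h"
        proof -
          have "\<bar>g (x + h') - g x - (\<Sum>i\<in>I. h' $ i * d i x)\<bar> \<le> \<epsilon>/2 * norm h'"
            by (rule \<delta>1(2)) (use h h'le in \<open>auto simp: \<delta>_def h'_def axis_def\<close>)
          moreover have "(\<Sum>i\<in>I. h' $ i * d i x) = (\<Sum>i\<in>I. h $ i * d i x)"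
            by (rule sum.cong) (use 2(2) in \<open>auto simp: h'_def axis_def\<close>)
          ultimately show ?thesis using mult_left_mono[OF h'le, of "\<epsilon>/2"] \<open>\<epsilon> > 0\<close> by linarith
        qed
        have inS: "x + h' + s *\<^sub>R axis k 1 \<in> S" if "\<bar>s\<bar> \<le> \<bar>h $ k\<bar>" for s
          using small[OF that] h \<delta>2(2) by (auto simp: \<delta>_def dist_norm subset_iff norm_minus_commute add.assoc)
        obtain s where s: "\<bar>s\<bar> \<le> \<bar>h $ k\<bar>"
          "g (x + h' + h $ k *\<^sub>R axis k 1) - g (x + h') = h $ k * d k (x + h' + s *\<^sub>R axis k 1)"
          using MVT_partial[of "h $ k" g k "d k" "x + h'"] part inS by blast
        have "dist (d k (x + h' + s *\<^sub>R axis k 1)) (d k x) < \<epsilon>/2"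
          by (rule \<delta>3(2)) (use small[OF s(1)] h in \<open>auto simp: \<delta>_def dist_norm add.assoc\<close>)
        then have "\<bar>h $ k * (d k (x + h' + s *\<^sub>R axis k 1) - d k x)\<bar> \<le> norm h * (\<epsilon>/2)"
          unfolding abs_mult by (intro mult_mono) (auto simp: dist_real_def component_le_norm_cart)
        then have "\<bar>g (x + h) - g (x + h') - h $ k * d k x\<bar> \<le> \<epsilon>/2 * norm h"
          using s(2) unfolding add.assoc hk[symmetric] by (simp add: right_diff_distrib mult.commute)
        then show "\<bar>g (x + h) - g x - (\<Sum>i\<in>insert k I. h $ i * d i x)\<bar> \<le> \<epsilon> * norm h"
          unfolding sum.insert[OF 2(1,2)] using a by argo
      qed
    qed
  qed
  show ?thesis
    unfolding has_derivative_at_alt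
  proof (intro conjI allI impI)
    show "bounded_linear (\<lambda>h::real^'n. \<Sum>i\<in>UNIV. h $ i * d i x)"
      by (auto intro!: bounded_linear_intros)
    fix e :: real assume "e > 0"
    then obtain \<delta> where "\<delta> > 0" "\<forall>h. norm h < \<delta> \<longrightarrow> \<bar>g (x + h) - g x - (\<Sum>i\<in>UNIV. h $ i * d i x)\<bar> \<le> e * norm h"
      using claim[of UNIV] by auto
    then show "\<exists>da>0. \<forall>y. norm (y - x) < da \<longrightarrow>
        norm (g y - g x - (\<Sum>i\<in>UNIV. (y - x) $ i * d i x)) \<le> e * norm (y - x)"
      by (intro exI[of _ \<delta>] conjI allI impI) (auto dest: spec[of _ "_ - x"])
  qed
qed

text \<open>The second difference over a square of side \<open>r\<close> does not depend on the
  order of the two directions, and two mean value steps express it through either mixed derivative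
  at a point near \<open>x\<close>.\<close>

lemma mixed_partials_commute:
  fixes g :: "real^'n \<Rightarrow> real"
  assumes S: "open S" "x \<in> S"
    and gi: "\<And>y. y \<in> S \<Longrightarrow> has_partial g i (gi y) y" and gj: "\<And>y. y \<in> S \<Longrightarrow> has_partial g j (gj y) y"
    and gji: "\<And>y. y \<in> S \<Longrightarrow> has_partial gi j (gji y) y" and gij: "\<And>y. y \<in> S \<Longrightarrow> has_partial gj i (gij y) y"
    and cont: "continuous_on S gji" "continuous_on S gij"
  shows "gji x = gij x"
proof (rule ccontr)
  have key: "\<exists>s t. \<bar>s\<bar> \<le> \<bar>r\<bar> \<and> \<bar>t\<bar> \<le> \<bar>r\<bar> \<and>
      g (x + r *\<^sub>R axis i 1 + r *\<^sub>R axis j 1) - g (x + r *\<^sub>R axis i 1) - g (x + r *\<^sub>R axis j 1) + g x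
        = r * (r * gji (x + s *\<^sub>R axis i 1 + t *\<^sub>R axis j 1))"
    if g: "\<And>y. y \<in> S \<Longrightarrow> has_partial g i (gi y) y" "\<And>y. y \<in> S \<Longrightarrow> has_partial gi j (gji y) y"
      and sub: "\<And>s t. \<bar>s\<bar> \<le> \<bar>r\<bar> \<Longrightarrow> \<bar>t\<bar> \<le> \<bar>r\<bar> \<Longrightarrow> x + s *\<^sub>R axis i 1 + t *\<^sub>R axis j 1 \<in> S"
    for r i j gi gji
  proof -
    have sub0: "x + s *\<^sub>R axis i 1 \<in> S" if "\<bar>s\<bar> \<le> \<bar>r\<bar>" for s
      using sub[OF that, of 0] by simp
    have "\<exists>s. \<bar>s\<bar> \<le> \<bar>r\<bar> \<and> (\<lambda>y. g (y + r *\<^sub>R axis j 1) - g y) (x + r *\<^sub>R axis i 1) - (\<lambda>y. g (y + r *\<^sub>R axis j 1) - g y) x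
        = r * (\<lambda>y. gi (y + r *\<^sub>R axis j 1) - gi y) (x + s *\<^sub>R axis i 1)"
    proof (rule MVT_partial)
      fix s assume s: "\<bar>s\<bar> \<le> \<bar>r\<bar>"
      have "has_partial g i (gi (x + s *\<^sub>R axis i 1 + r *\<^sub>R axis j 1)) (x + s *\<^sub>R axis i 1 + r *\<^sub>R axis j 1)"
        "has_partial g i (gi (x + s *\<^sub>R axis i 1)) (x + s *\<^sub>R axis i 1)"
        using g sub[OF s, of r] sub0[OF s] by auto
      then show "has_partial (\<lambda>y. g (y + r *\<^sub>R axis j 1) - g y) i
          (gi (x + s *\<^sub>R axis i 1 + r *\<^sub>R axis j 1) - gi (x + s *\<^sub>R axis i 1)) (x + s *\<^sub>R axis i 1)"
        unfolding has_partial_def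
        using DERIV_diff by (fastforce simp: add_ac)
    qed
    then obtain s where s: "\<bar>s\<bar> \<le> \<bar>r\<bar>" "g (x + r *\<^sub>R axis i 1 + r *\<^sub>R axis j 1) - g (x + r *\<^sub>R axis i 1)
        - (g (x + r *\<^sub>R axis j 1) - g x) = r * (gi (x + s *\<^sub>R axis i 1 + r *\<^sub>R axis j 1) - gi (x + s *\<^sub>R axis i 1))"
      by auto
    moreover obtain t where "\<bar>t\<bar> \<le> \<bar>r\<bar>" "gi (x + s *\<^sub>R axis i 1 + r *\<^sub>R axis j 1) - gi (x + s *\<^sub>R axis i 1)
        = r * gji (x + s *\<^sub>R axis i 1 + t *\<^sub>R axis j 1)"
      using MVT_partial[of r gi j gji "x + s *\<^sub>R axis i 1"] g(2) sub[OF s(1)] by blast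
    ultimately show ?thesis by (intro exI[of _ s] exI[of _ t]) auto
  qed
  assume ne: "gji x \<noteq> gij x"
  \<comment> \<open>Half the gap: values within \<open>e\<close> of \<open>gji x\<close> and of
    \<open>gij x\<close> cannot coincide.\<close>
  define e where "e = \<bar>gji x - gij x\<bar> / 2"
  have e: "e > 0" using ne by (simp add: e_def)
  obtain \<delta>1 where \<delta>1: "\<delta>1 > 0" "ball x \<delta>1 \<subseteq> S" using S open_contains_ball by blast
  have "continuous (at x) gji" "continuous (at x) gij"
    using cont S continuous_on_eq_continuous_at by blast+
  then obtain \<delta>2 \<delta>3 where d: "\<delta>2 > 0" "\<And>y. dist y x < \<delta>2 \<Longrightarrow> dist (gji y) (gji x) < e"
     "\<delta>3 > 0" "\<And>y. dist y x < \<delta>3 \<Longrightarrow> dist (gij y) (gij x) < e"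
    using e unfolding continuous_at_eps_delta by metis
  define r where "r = min \<delta>1 (min \<delta>2 \<delta>3) / 3"
  have r: "r > 0" "2 * r < \<delta>1" "2 * r < \<delta>2" "2 * r < \<delta>3" using \<delta>1 d by (auto simp: r_def min_def)
  have near: "dist (x + s *\<^sub>R axis i 1 + t *\<^sub>R axis j 1) x \<le> 2 * r" if "\<bar>s\<bar> \<le> \<bar>r\<bar>" "\<bar>t\<bar> \<le> \<bar>r\<bar>" for s t and i j :: 'n
  proof -
    have "norm (s *\<^sub>R axis i 1 + t *\<^sub>R axis j (1::real)) \<le> \<bar>s\<bar> + \<bar>t\<bar>"
      by (rule norm_triangle_le) simp
    then show ?thesis using that r by (simp add: dist_norm add.assoc)
  qed
  have sub: "x + s *\<^sub>R axis i 1 + t *\<^sub>R axis j 1 \<in> S" if "\<bar>s\<bar> \<le> \<bar>r\<bar>" "\<bar>t\<bar> \<le> \<bar>r\<bar>" for s t and i j :: 'n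
    using near[OF that, of i j] \<delta>1(2) r(2) by (auto simp: dist_commute subset_iff)
  obtain s t where st: "\<bar>s\<bar> \<le> \<bar>r\<bar>" "\<bar>t\<bar> \<le> \<bar>r\<bar>" "g (x + r *\<^sub>R axis i 1 + r *\<^sub>R axis j 1) - g (x + r *\<^sub>R axis i 1) - g (x + r *\<^sub>R axis j 1) + g x
        = r * (r * gji (x + s *\<^sub>R axis i 1 + t *\<^sub>R axis j 1))"
    using key[OF gi gji sub] by metis
  obtain s' t' where st': "\<bar>s'\<bar> \<le> \<bar>r\<bar>" "\<bar>t'\<bar> \<le> \<bar>r\<bar>" "g (x + r *\<^sub>R axis j 1 + r *\<^sub>R axis i 1) - g (x + r *\<^sub>R axis j 1) - g (x + r *\<^sub>R axis i 1) + g x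
        = r * (r * gij (x + s' *\<^sub>R axis j 1 + t' *\<^sub>R axis i 1))"
    using key[OF gj gij sub] by metis
  have "r * (r * gji (x + s *\<^sub>R axis i 1 + t *\<^sub>R axis j 1)) = r * (r * gij (x + s' *\<^sub>R axis j 1 + t' *\<^sub>R axis i 1))"
    unfolding st(3)[symmetric] st'(3)[symmetric] by (simp add: add_ac)
  then have eq: "gji (x + s *\<^sub>R axis i 1 + t *\<^sub>R axis j 1) = gij (x + s' *\<^sub>R axis j 1 + t' *\<^sub>R axis i 1)"
    using r by simp
  have "dist (gji (x + s *\<^sub>R axis i 1 + t *\<^sub>R axis j 1)) (gji x) < e"
    "dist (gij (x + s' *\<^sub>R axis j 1 + t' *\<^sub>R axis i 1)) (gij x) < e"
    using d(2) near[OF st(1,2), of i j] d(4) near[OF st'(1,2), of j i] r by force+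
  then show False using eq unfolding e_def dist_real_def by argo
qed

subsection \<open>Second order expansions along lines\<close>

definition jet2 :: "(real \<Rightarrow> real) \<Rightarrow> real \<Rightarrow> real \<Rightarrow> real \<Rightarrow> bool" where
  "jet2 f a b c \<longleftrightarrow> (\<lambda>t. f t - (a + b * t + c * t^2)) \<in> o[at 0](\<lambda>t. t^2)"

lemma powers_smallo:
  "(\<lambda>t::real. t^3) \<in> o[at 0](\<lambda>t. t^2)" "(\<lambda>t::real. t^4) \<in> o[at 0](\<lambda>t. t^2)"
proof -
  have t: "(\<lambda>t::real. t) \<in> o[at 0](\<lambda>t. 1)"
    by (rule smalloI_tendsto) (auto intro!: tendsto_eq_intros)
  show 3: "(\<lambda>t::real. t^3) \<in> o[at 0](\<lambda>t. t^2)"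
    using landau_o.small_big_mult[OF t, of "\<lambda>t. t^2" "\<lambda>t. t^2"] by (simp add: eval_nat_numeral mult_ac)
  show "(\<lambda>t::real. t^4) \<in> o[at 0](\<lambda>t. t^2)"
    using landau_o.small_mult[OF t 3] landau_o.small_big_mult[OF t landau_o.small_imp_big[OF 3]]
    by (simp add: eval_nat_numeral mult_ac)
qed

lemma powers_bigo:
  "(\<lambda>t::real. t^2) \<in> O[at 0](\<lambda>t. t)" "(\<lambda>t::real. t^2) \<in> O[at 0](\<lambda>t. 1)" "(\<lambda>t::real. t) \<in> O[at 0](\<lambda>t. 1)"
proof -
  have le1: "eventually (\<lambda>t::real. \<bar>t\<bar> \<le> 1) (at 0)"
    by (auto simp: eventually_at intro!: exI[of _ 1])
  show "(\<lambda>t::real. t^2) \<in> O[at 0](\<lambda>t. t)"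
  proof (rule bigoI[of _ 1], rule eventually_mono[OF le1])
    fix t :: real assume "\<bar>t\<bar> \<le> 1"
    then show "norm (t^2) \<le> 1 * norm t"
      using mult_left_le[of "\<bar>t\<bar>" "\<bar>t\<bar>"] by (simp add: power2_eq_square abs_mult)
  qed
  show "(\<lambda>t::real. t^2) \<in> O[at 0](\<lambda>t. 1)"
    by (rule bigoI[of _ 1], rule eventually_mono[OF le1]) (auto simp: abs_square_le_1)
  show "(\<lambda>t::real. t) \<in> O[at 0](\<lambda>t. 1)"
    by (rule bigoI[of _ 1], rule eventually_mono[OF le1]) auto
qed

lemma jet2_cong:
  assumes "jet2 f a b c" "a = a'" "b = b'" "c = c'"
  shows "jet2 f a' b' c'"
  using assms by simp

lemma jet2_const: "jet2 (\<lambda>t. k) k 0 0"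
  by (simp add: jet2_def)

lemma jet2_ident: "jet2 (\<lambda>t. t) 0 1 0"
  by (simp add: jet2_def)

lemma jet2_add:
  assumes "jet2 f a b c" "jet2 g a' b' c'"
  shows "jet2 (\<lambda>t. f t + g t) (a + a') (b + b') (c + c')"
  using sum_in_smallo(1)[OF assms[unfolded jet2_def]] unfolding jet2_def by (simp add: algebra_simps)

lemma jet2_diff:
  assumes "jet2 f a b c" "jet2 g a' b' c'"
  shows "jet2 (\<lambda>t. f t - g t) (a - a') (b - b') (c - c')"
  using sum_in_smallo(2)[OF assms[unfolded jet2_def]] unfolding jet2_def by (simp add: algebra_simps)

lemma jet2_bigo:
  assumes "jet2 f a b c"
  shows "f \<in> O[at 0](\<lambda>t. 1)"
    and "a = 0 \<Longrightarrow> f \<in> O[at 0](\<lambda>t. t)"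
    and "a = 0 \<Longrightarrow> b = 0 \<Longrightarrow> f \<in> O[at 0](\<lambda>t. t^2)"
proof -
  have o: "(\<lambda>t. f t - (a + b * t + c * t^2)) \<in> O[at 0](\<lambda>t. t^2)"
    using assms unfolding jet2_def by (rule landau_o.small_imp_big)
  have p: "(\<lambda>t. a + b * t + c * t^2) \<in> O[at 0](\<lambda>t. 1)"
    by (intro sum_in_bigo) (auto simp: powers_bigo)
  show "f \<in> O[at 0](\<lambda>t. 1)"
    using sum_in_bigo(1)[OF landau_o.big_trans[OF o powers_bigo(2)] p] by simp
  show "f \<in> O[at 0](\<lambda>t. t)" if "a = 0"
  proof -
    have "(\<lambda>t. b * t + c * t^2) \<in> O[at 0](\<lambda>t. t)"
      by (intro sum_in_bigo) (auto simp: powers_bigo)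
    from sum_in_bigo(1)[OF landau_o.big_trans[OF o powers_bigo(1)] this] show ?thesis using that by simp
  qed
  show "f \<in> O[at 0](\<lambda>t. t^2)" if "a = 0" "b = 0"
  proof -
    have "(\<lambda>t. c * t^2) \<in> O[at 0](\<lambda>t. t^2)" by simp
    from sum_in_bigo(1)[OF o this] show ?thesis using that by simp
  qed
qed

lemma jet2_mult:
  assumes f: "jet2 f a b c" and g: "jet2 g a' b' c'"
  shows "jet2 (\<lambda>t. f t * g t) (a * a') (a * b' + b * a') (a * c' + b * b' + c * a')"
proof -
  let ?p = "\<lambda>t. a + b * t + c * t^2" and ?q = "\<lambda>t. a' + b' * t + c' * t^2"
  have "jet2 ?p a b c" by (simp add: jet2_def)
  then have p: "?p \<in> O[at 0](\<lambda>t. 1)" by (rule jet2_bigo)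
  have 1: "(\<lambda>t. (f t - ?p t) * g t) \<in> o[at 0](\<lambda>t. t^2)"
    using landau_o.small_big_mult[OF f[unfolded jet2_def] jet2_bigo(1)[OF g]] by simp
  have 2: "(\<lambda>t. ?p t * (g t - ?q t)) \<in> o[at 0](\<lambda>t. t^2)"
    using landau_o.big_small_mult[OF p g[unfolded jet2_def]] by simp
  have 3: "(\<lambda>t. (b * c' + c * b') * t^3) \<in> o[at 0](\<lambda>t. t^2)" "(\<lambda>t. (c * c') * t^4) \<in> o[at 0](\<lambda>t. t^2)"
    using powers_smallo by auto
  have "(\<lambda>t. ((f t - ?p t) * g t + ?p t * (g t - ?q t)) + ((b * c' + c * b') * t^3 + (c * c') * t^4)) \<in> o[at 0](\<lambda>t. t^2)"
    by (intro sum_in_smallo 1 2 3)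
  moreover have "(\<lambda>t. ((f t - ?p t) * g t + ?p t * (g t - ?q t)) + ((b * c' + c * b') * t^3 + (c * c') * t^4))
    = (\<lambda>t. f t * g t - (a * a' + (a * b' + b * a') * t + (a * c' + b * b' + c * a') * t^2))"
    by (rule ext) (simp add: algebra_simps eval_nat_numeral)
  ultimately show ?thesis by (simp add: jet2_def)
qed

lemma jet2_cmult: "jet2 f a b c \<Longrightarrow> jet2 (\<lambda>t. k * f t) (k * a) (k * b) (k * c)"
  using jet2_mult[OF jet2_const[of k], of f a b c] by simp

lemma jet2_power2: "jet2 f a b c \<Longrightarrow> jet2 (\<lambda>t. (f t)^2) (a^2) (2 * a * b) (2 * a * c + b^2)"
  using jet2_mult[of f a b c f a b c] by (simp add: power2_eq_square algebra_simps)

lemma jet2_sum: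
  assumes "\<And>i. i \<in> I \<Longrightarrow> jet2 (f i) (a i) (b i) (c i)"
  shows "jet2 (\<lambda>t. \<Sum>i\<in>I. f i t) (\<Sum>i\<in>I. a i) (\<Sum>i\<in>I. b i) (\<Sum>i\<in>I. c i)"
  using assms
proof (induction I rule: infinite_finite_induct)
  case (insert x F)
  then show ?case using jet2_add[of "f x"] by simp
qed (auto intro: jet2_const)

text \<open>The first and second order conditions at a minimum, tolerating an error \<open>g\<close>
  of order \<open>o(t^2)\<close>; this admits frames that are orthonormal only up to a correction.
  Since \<open>t\<close> takes both signs, a one-sided inequality still yields the equation
  \<open>b = 0\<close>.\<close>

lemma jet2_nonneg:
  assumes f: "jet2 f 0 b c" and g: "g \<in> o[at 0](\<lambda>t. t^2)"
    and ge: "eventually (\<lambda>t. f t \<ge> g t) (at 0)"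
  shows "b = 0 \<and> c \<ge> 0"
proof -
  have ev: "eventually (\<lambda>t. b * t + (c + \<epsilon>) * t^2 \<ge> 0) (at 0)" if "\<epsilon> > 0" for \<epsilon>
  proof -
    have "(\<lambda>t. g t - (f t - (0 + b * t + c * t^2))) \<in> o[at 0](\<lambda>t. t^2)"
      using sum_in_smallo(2)[OF g f[unfolded jet2_def]] .
    from landau_o.smallD[OF this that] ge show ?thesis
      by eventually_elim (auto simp: algebra_simps abs_le_iff)
  qed
  have pt: "\<exists>d>0. \<forall>t. t \<noteq> 0 \<and> \<bar>t\<bar> < d \<longrightarrow> b * t + (c + \<epsilon>) * t^2 \<ge> 0" if "\<epsilon> > 0" for \<epsilon>
    using ev[OF that] by (auto simp: eventually_at dist_real_def)
  have b: "b = 0"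
  proof (rule ccontr)
    assume "b \<noteq> 0"
    obtain d where d: "d > 0" "\<And>t. t \<noteq> 0 \<Longrightarrow> \<bar>t\<bar> < d \<Longrightarrow> b * t + (c + 1) * t^2 \<ge> 0"
      using pt[of 1] by auto
    \<comment> \<open>Chosen so that \<open>r * \<bar>c + 1\<bar> < \<bar>b\<bar>\<close>: at
      distance \<open>r\<close>, on the side where \<open>b * t\<close> is negative, the linear term
      beats the quadratic one.\<close>
    define r where "r = min (d / 2) (\<bar>b\<bar> / (2 * (\<bar>c + 1\<bar> + 1)))"
    have "r > 0" unfolding r_def using d \<open>b \<noteq> 0\<close> by (simp only: min_less_iff_conj) (simp add: add_nonneg_pos)
    moreover have "r < d" unfolding r_def using d by (simp only: min_less_iff_disj) simp
    ultimately have r: "r > 0" "r < d" .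
    have "r * (\<bar>c + 1\<bar> + 1) \<le> \<bar>b\<bar> / (2 * (\<bar>c + 1\<bar> + 1)) * (\<bar>c + 1\<bar> + 1)"
      by (intro mult_right_mono) (auto simp: r_def)
    also have "\<dots> = \<bar>b\<bar> / 2"
    proof -
      have "\<beta> / (2 * z) * z = \<beta> / 2" if "z > 0" for \<beta> z :: real
        using that by simp
      then show ?thesis by (metis abs_ge_zero add_nonneg_pos zero_less_one)
    qed
    finally have "r * \<bar>c + 1\<bar> + r \<le> \<bar>b\<bar> / 2" by (simp add: distrib_left)
    then have "r * \<bar>c + 1\<bar> < \<bar>b\<bar>" using r(1) \<open>b \<noteq> 0\<close> by linarith
    then have small: "r * (r * \<bar>c + 1\<bar>) < r * \<bar>b\<bar>" using r by simp
    define t where "t = (if b > 0 then - r else r)"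
    have t: "t \<noteq> 0" "\<bar>t\<bar> < d" "b * t = - (r * \<bar>b\<bar>)" "t^2 = r * r"
      using r \<open>b \<noteq> 0\<close> by (auto simp: t_def power2_eq_square)
    have "(c + 1) * t^2 \<le> \<bar>c + 1\<bar> * (r * r)"
      unfolding t(4) by (rule mult_right_mono) auto
    then have "b * t + (c + 1) * t^2 < 0"
      using small t(3) by (simp add: mult_ac)
    then show False using d(2)[OF t(1,2)] by simp
  qed
  moreover have c\<epsilon>: "c + \<epsilon> \<ge> 0" if "\<epsilon> > 0" for \<epsilon>
  proof -
    obtain d where d: "d > 0" "\<And>t. t \<noteq> 0 \<Longrightarrow> \<bar>t\<bar> < d \<Longrightarrow> b * t + (c + \<epsilon>) * t^2 \<ge> 0"
      using pt[OF \<open>\<epsilon> > 0\<close>] by auto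
    have "b * (d/2) + (c + \<epsilon>) * (d/2)^2 \<ge> 0" by (rule d(2)) (use d(1) in auto)
    then have "(c + \<epsilon>) * (d/2)^2 \<ge> 0" using b by simp
    moreover have "(d/2)^2 > 0" using d(1) by simp
    ultimately show ?thesis by (metis mult_neg_pos not_less)
  qed
  then have "c \<ge> 0" by (rule field_le_epsilon) simp
  ultimately show ?thesis by simp
qed

text \<open>The claimed polynomial is the formal square root, so its square agrees with
  \<open>f\<close> up to \<open>o(t^2)\<close>. Dividing that error by
  \<open>sqrt (f t) + ?p t\<close>, which stays above \<open>s / 2\<close>, preserves its
  order.\<close>

lemma jet2_sqrt:
  assumes f: "jet2 f (s^2) b c" and s: "s > 0"
  shows "jet2 (\<lambda>t. sqrt (f t)) s (b / (2 * s)) (c / (2 * s) - b^2 / (8 * s^3))"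
proof -
  define b' c' where "b' = b / (2 * s)" and "c' = c / (2 * s) - b^2 / (8 * s^3)"
  let ?p = "\<lambda>t. s + b' * t + c' * t^2"
  have p: "jet2 ?p s b' c'" by (simp add: jet2_def)
  have p2: "jet2 (\<lambda>t. f t - (?p t)^2) 0 0 0"
    by (rule jet2_cong[OF jet2_diff[OF f jet2_power2[OF p]]])
      (use s in \<open>simp_all add: b'_def c'_def power_divide field_simps\<close>, simp_all add: eval_nat_numeral)
  have "((\<lambda>t. f t - (s^2 + b * t + c * t^2)) \<longlongrightarrow> 0) (at 0)"
    using landau_o.small_big_trans[OF f[unfolded jet2_def] powers_bigo(2)] smalloD_tendsto by fastforce
  then have "((\<lambda>t. (f t - (s^2 + b * t + c * t^2)) + (s^2 + b * t + c * t^2)) \<longlongrightarrow> 0 + (s^2 + b * 0 + c * 0^2)) (at 0)"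
    by (intro tendsto_intros)
  then have "(f \<longlongrightarrow> s^2) (at 0)" by simp
  then have pos: "eventually (\<lambda>t. f t > 0) (at 0)"
    using s by (intro order_tendstoD(1)[of _ "s^2"]) auto
  have "(?p \<longlongrightarrow> s + b' * 0 + c' * 0^2) (at 0)" by (intro tendsto_intros)
  then have ppos: "eventually (\<lambda>t. ?p t > s / 2) (at 0)"
    using s by (intro order_tendstoD(1)[of _ "s"]) auto
  have "(\<lambda>t. sqrt (f t) - ?p t) \<in> O[at 0](\<lambda>t. f t - (?p t)^2)"
  proof (rule bigoI[of _ "2 / s"])
    show "eventually (\<lambda>t. norm (sqrt (f t) - ?p t) \<le> 2 / s * norm (f t - (?p t)^2)) (at 0)"
      using pos ppos
    proof eventually_elim
      case (elim t)
      have "f t - (?p t)^2 = (sqrt (f t) - ?p t) * (sqrt (f t) + ?p t)"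
        using elim by (simp add: power2_eq_square algebra_simps)
      then have "\<bar>f t - (?p t)^2\<bar> = \<bar>sqrt (f t) - ?p t\<bar> * \<bar>sqrt (f t) + ?p t\<bar>" by (simp add: abs_mult)
      moreover have "\<bar>sqrt (f t) + ?p t\<bar> \<ge> s / 2"
      proof -
        have "sqrt (f t) \<ge> 0" using elim by simp
        then show ?thesis using elim by linarith
      qed
      ultimately have "\<bar>sqrt (f t) - ?p t\<bar> * (s / 2) \<le> \<bar>f t - (?p t)^2\<bar>" by (metis abs_ge_zero mult_left_mono)
      then show ?case using s by (simp add: field_simps)
    qed
  qed
  moreover have "(\<lambda>t. f t - (?p t)^2) \<in> o[at 0](\<lambda>t. t^2)" using p2 by (simp add: jet2_def)
  ultimately show ?thesis unfolding jet2_def b'_def[symmetric] c'_def[symmetric]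
    by (rule landau_o.big_small_trans)
qed

text \<open>A second derivative is required at 0 only: the remainder has derivative
  \<open>o(t)\<close>, and the mean value inequality integrates this to
  \<open>o(t^2)\<close>.\<close>

lemma jet2_Taylor:
  assumes f: "eventually (\<lambda>t. (f has_real_derivative f1 t) (at t)) (nhds 0)"
    and f1: "(f1 has_real_derivative c) (at 0)"
  shows "jet2 f (f 0) (f1 0) (c / 2)"
  unfolding jet2_def
proof (rule landau_o.smallI)
  fix e :: real assume "e > 0"
  have "((\<lambda>h. (f1 (0 + h) - f1 0) / h) \<longlongrightarrow> c) (at 0)"
    using f1 by (simp add: DERIV_def)
  then have "eventually (\<lambda>h. dist ((f1 (0 + h) - f1 0) / h) c < e) (at 0)"
    using \<open>e > 0\<close> by (rule tendstoD)
  then obtain d1 where d1: "d1 > 0" "\<And>h. h \<noteq> 0 \<Longrightarrow> \<bar>h\<bar> < d1 \<Longrightarrow> \<bar>(f1 h - f1 0) / h - c\<bar> < e"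
    by (auto simp: eventually_at dist_real_def)
  have f1e: "\<bar>f1 h - f1 0 - c * h\<bar> \<le> e * \<bar>h\<bar>" if "\<bar>h\<bar> < d1" for h
  proof (cases "h = 0")
    case False
    have "f1 h - f1 0 - c * h = ((f1 h - f1 0) / h - c) * h"
      using False by (simp only: left_diff_distrib) simp
    then have "\<bar>f1 h - f1 0 - c * h\<bar> = \<bar>(f1 h - f1 0) / h - c\<bar> * \<bar>h\<bar>"
      by (simp only: abs_mult)
    also have "\<dots> \<le> e * \<bar>h\<bar>" by (intro mult_right_mono less_imp_le d1(2)) (use that False in auto)
    finally show ?thesis .
  qed auto
  obtain d2 where d2: "d2 > 0" "\<And>t. \<bar>t\<bar> < d2 \<Longrightarrow> (f has_real_derivative f1 t) (at t)"
    using f by (auto simp: eventually_nhds_metric dist_real_def)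
  define F where "F = (\<lambda>t. f t - (f 0 + f1 0 * t + c / 2 * t^2))"
  have dF: "(F has_real_derivative (f1 t - f1 0 - c * t)) (at t)" if "\<bar>t\<bar> < d2" for t
    unfolding F_def by (auto intro!: derivative_eq_intros d2(2)[OF that])
  have bd: "\<bar>F t\<bar> \<le> e * t^2" if t: "\<bar>t\<bar> < d1" "\<bar>t\<bar> < d2" for t
  proof -
    have "norm (F t - F 0) \<le> (e * \<bar>t\<bar>) * norm (t - 0)"
    proof (rule field_differentiable_bound[where S = "{-\<bar>t\<bar>..\<bar>t\<bar>}" and f' = "\<lambda>t. f1 t - f1 0 - c * t"])
      fix z assume z: "z \<in> {-\<bar>t\<bar>..\<bar>t\<bar>}"
      then show "(F has_real_derivative f1 z - f1 0 - c * z) (at z within {-\<bar>t\<bar>..\<bar>t\<bar>})"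
        by (intro DERIV_subset[OF dF subset_UNIV]) (use t in auto)
      have "\<bar>f1 z - f1 0 - c * z\<bar> \<le> e * \<bar>z\<bar>" by (rule f1e) (use z t in auto)
      also have "\<dots> \<le> e * \<bar>t\<bar>" using z \<open>e > 0\<close> by (intro mult_left_mono) auto
      finally show "norm (f1 z - f1 0 - c * z) \<le> e * \<bar>t\<bar>" by simp
    qed auto
    moreover have "F 0 = 0" by (simp add: F_def)
    moreover have "e * \<bar>t\<bar> * norm (t - 0) = e * t^2" by (simp add: power2_eq_square)
    ultimately show ?thesis by (simp add: power2_eq_square mult.assoc)
  qed
  have "norm (f t - (f 0 + f1 0 * t + c / 2 * t^2)) \<le> e * norm (t^2)" if "dist t 0 < min d1 d2" for t
    using bd[of t] that by (simp add: F_def dist_real_def)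
  then show "eventually (\<lambda>t. norm (f t - (f 0 + f1 0 * t + c / 2 * t^2)) \<le> e * norm (t^2)) (at 0)"
    unfolding eventually_at using d1(1) d2(1)
    by (intro exI[of _ "min d1 d2"] conjI ballI impI) simp_all
qed

text \<open>The derivative of order \<open>length vs\<close> as a multilinear form on constant
  vectors. The recursion shifts the family \<open>A\<close> instead of differentiating functions,
  which keeps the definition algebraic; this is why the inductions below generalize over
  \<open>A\<close>.\<close>

primrec dd :: "(real^'n) list \<Rightarrow> ('n list \<Rightarrow> real^'n \<Rightarrow> real) \<Rightarrow> real^'n \<Rightarrow> real" where
  "dd [] A x = A [] x"
| "dd (v # vs) A x = (\<Sum>i\<in>UNIV. v $ i * dd vs (\<lambda>L. A (i # L)) x)"

lemma dd_cong:
  assumes "\<And>L. A L x = B L x"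
  shows "dd vs A x = dd vs B x"
  using assms
proof (induction vs arbitrary: A B)
  case (Cons v vs)
  have "dd vs (\<lambda>L. A (i # L)) x = dd vs (\<lambda>L. B (i # L)) x" for i
    by (rule Cons.IH) (rule Cons.prems)
  then show ?case by (simp only: dd.simps)
qed simp

lemma dd_lincomb:
  "dd vs (\<lambda>L y. \<Sum>k\<in>K. c k * A k L y) x = (\<Sum>k\<in>K. c k * dd vs (A k) x)"
proof (induction vs arbitrary: A)
  case (Cons v vs)
  show ?case
    by (simp add: Cons sum_distrib_left mult.left_commute sum.swap[of _ K])
qed simp

lemma dd_scale: "dd vs (\<lambda>L y. c * A L y) x = c * dd vs A x"
  using dd_lincomb[where K = "{()}" and c = "\<lambda>_. c" and A = "\<lambda>_. A"] by simp

lemma jet2_dd: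
  assumes "\<And>L. jet2 (\<lambda>t. A L (x + t *\<^sub>R \<xi>)) (A L x) (B L x) (C L x)"
  shows "jet2 (\<lambda>t. dd vs A (x + t *\<^sub>R \<xi>)) (dd vs A x) (dd vs B x) (dd vs C x)"
  using assms
proof (induction vs arbitrary: A B C)
  case (Cons v vs)
  show ?case
    by (simp, intro jet2_sum jet2_cmult Cons.IH) (rule Cons.prems)
qed simp

lemma dd_swap:
  assumes "\<And>ks i j L. A (ks @ i # j # L) x = A (ks @ j # i # L) x"
  shows "dd (us @ v # w # vs) A x = dd (us @ w # v # vs) A x"
  using assms
proof (induction us arbitrary: A)
  case Nil
  have *: "dd vs (\<lambda>L. A (i # j # L)) x = dd vs (\<lambda>L. A (j # i # L)) x" for i j
    by (rule dd_cong) (use Nil[of "[]"] in simp)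
  show ?case
    by (simp add: sum_distrib_left, subst sum.swap, intro sum.cong refl)
      (simp add: * mult.left_commute)
next
  case (Cons u us)
  have "dd (us @ v # w # vs) (\<lambda>L. A (i # L)) x = dd (us @ w # v # vs) (\<lambda>L. A (i # L)) x" for i
    by (rule Cons.IH) (use Cons.prems[of "i # _"] in simp)
  then show ?case by simp
qed

lemma dd_scaleR: "dd (us @ (c *\<^sub>R v) # vs) A x = c * dd (us @ v # vs) A x"
proof (induction us arbitrary: A)
  case Nil
  then show ?case by (simp add: sum_distrib_left mult_ac)
next
  case (Cons u us)
  then show ?case by (simp add: sum_distrib_left mult.left_commute)
qed

lemma smooth_family_has_derivative:
  assumes D: "smooth_family \<Omega> T D" and x: "x \<in> \<Omega>"
  shows "(D ks has_derivative (\<lambda>h. \<Sum>i\<in>UNIV. h $ i * D (i # ks) x)) (at x)"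
proof (rule has_derivative_partials[where d = "\<lambda>i. D (i # ks)"])
  show "open \<Omega>" "x \<in> \<Omega>" using D x by (auto simp: smooth_family_def)
  show "has_partial (D ks) i (D (i # ks) y) y" if "y \<in> \<Omega>" for i y
    using D that by (auto simp: smooth_family_def)
  show "continuous_on \<Omega> (D (i # ks))" for i
    using D by (auto simp: smooth_family_def intro: continuous_on_subset)
qed

text \<open>The indices \<open>ks\<close> in front are outer derivatives. The two inner functions
  already agree on the open set \<open>\<Omega>\<close>, so their derivatives along any coordinate
  line agree too.\<close>

lemma smooth_family_swap:
  assumes D: "smooth_family \<Omega> T D" and x: "x \<in> \<Omega>"
  shows "D (ks @ i # j # L) x = D (ks @ j # i # L) x"
  using x
proof (induction ks arbitrary: x)
  case Nil
  show ?case
    by (simp, rule mixed_partials_commute[OF _ Nil, of "D L" j "D (j # L)" i "D (i # L)"])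
      (use D in \<open>auto simp: smooth_family_def intro: continuous_on_subset\<close>)
next
  case (Cons k ks)
  have op: "open \<Omega>" using D by (simp add: smooth_family_def)
  let ?g = "\<lambda>y. D (ks @ i # j # L) y" and ?h = "\<lambda>y. D (ks @ j # i # L) y"
  have 1: "((\<lambda>t. ?g (x + t *\<^sub>R axis k 1)) has_real_derivative D (k # ks @ i # j # L) x) (at 0)"
    and 2: "((\<lambda>t. ?h (x + t *\<^sub>R axis k 1)) has_real_derivative D (k # ks @ j # i # L) x) (at 0)"
    using D Cons.prems by (auto simp: smooth_family_def has_partial_def)
  have "((\<lambda>t. x + t *\<^sub>R axis k 1) \<longlongrightarrow> x + 0 *\<^sub>R axis k 1) (nhds (0::real))"
    by (intro tendsto_intros filterlim_ident)
  then have "eventually (\<lambda>t. x + t *\<^sub>R axis k 1 \<in> \<Omega>) (nhds (0::real))"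
    using op Cons.prems by (auto intro!: topological_tendstoD)
  then have ev: "eventually (\<lambda>t. ?g (x + t *\<^sub>R axis k 1) = ?h (x + t *\<^sub>R axis k 1)) (nhds (0::real))"
    by eventually_elim (rule Cons.IH)
  have "((\<lambda>t. ?g (x + t *\<^sub>R axis k 1)) has_real_derivative D (k # ks @ j # i # L) x) (at 0)"
    using 2 DERIV_cong_ev[OF refl ev refl] by blast
  with 1 show ?case using DERIV_unique by fastforce
qed

lemma jet2_line:
  assumes D: "smooth_family \<Omega> T D" and x: "x \<in> \<Omega>"
  shows "jet2 (\<lambda>t. D L (x + t *\<^sub>R \<xi>)) (D L x) (\<Sum>k\<in>UNIV. \<xi> $ k * D (k # L) x)
     (1 / 2 * (\<Sum>k\<in>UNIV. \<xi> $ k * (\<Sum>j\<in>UNIV. \<xi> $ j * D (k # j # L) x)))"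
proof -
  have op: "open \<Omega>" using D by (simp add: smooth_family_def)
  have der: "((\<lambda>t. D L (x + t *\<^sub>R \<xi>)) has_real_derivative (\<Sum>k\<in>UNIV. \<xi> $ k * D (k # L) (x + s *\<^sub>R \<xi>))) (at s)"
    if "x + s *\<^sub>R \<xi> \<in> \<Omega>" for s L
  proof -
    have "((\<lambda>t. D L (x + t *\<^sub>R \<xi>)) has_derivative (\<lambda>h. \<Sum>i\<in>UNIV. (h *\<^sub>R \<xi>) $ i * D (i # L) (x + s *\<^sub>R \<xi>))) (at s)"
      by (rule has_derivative_compose[where f = "\<lambda>t. x + t *\<^sub>R \<xi>" and g = "D L"])
        (auto intro!: derivative_eq_intros smooth_family_has_derivative[OF D that])
    then show ?thesis
      by (rule has_derivative_imp_has_field_derivative) (simp add: sum_distrib_left mult_ac)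
  qed
  have "((\<lambda>t. x + t *\<^sub>R \<xi>) \<longlongrightarrow> x + 0 *\<^sub>R \<xi>) (nhds (0::real))"
    by (intro tendsto_intros filterlim_ident)
  then have ev: "eventually (\<lambda>t. x + t *\<^sub>R \<xi> \<in> \<Omega>) (nhds (0::real))"
    using op x by (auto intro!: topological_tendstoD)
  have "((\<lambda>t. \<Sum>j\<in>UNIV. \<xi> $ j * D (j # L) (x + t *\<^sub>R \<xi>)) has_real_derivative
      (\<Sum>j\<in>UNIV. \<xi> $ j * (\<Sum>k\<in>UNIV. \<xi> $ k * D (k # j # L) (x + 0 *\<^sub>R \<xi>)))) (at 0)"
    using x by (intro DERIV_sum DERIV_cmult der) auto
  from jet2_Taylor[OF eventually_mono[OF ev der] this]
  have "jet2 (\<lambda>t. D L (x + t *\<^sub>R \<xi>)) (D L x) (\<Sum>k\<in>UNIV. \<xi> $ k * D (k # L) x)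
     ((\<Sum>j\<in>UNIV. \<xi> $ j * (\<Sum>k\<in>UNIV. \<xi> $ k * D (k # j # L) x)) / 2)" by simp
  moreover have "(\<Sum>j\<in>UNIV. \<xi> $ j * (\<Sum>k\<in>UNIV. \<xi> $ k * D (k # j # L) x)) =
      (\<Sum>k\<in>UNIV. \<xi> $ k * (\<Sum>j\<in>UNIV. \<xi> $ j * D (k # j # L) x))"
    by (simp only: sum_distrib_left, subst sum.swap, intro sum.cong refl) (simp only: mult.left_commute)
  ultimately show ?thesis by simp
qed

lemma jet2_dd_line:
  assumes D: "smooth_family \<Omega> T D" and x: "x \<in> \<Omega>"
  shows "jet2 (\<lambda>t. dd vs D (x + t *\<^sub>R \<xi>)) (dd vs D x) (dd (\<xi> # vs) D x) (1 / 2 * dd (\<xi> # \<xi> # vs) D x)"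
proof -
  have "jet2 (\<lambda>t. dd vs D (x + t *\<^sub>R \<xi>)) (dd vs D x) (dd vs (\<lambda>L x. \<Sum>k\<in>UNIV. \<xi> $ k * D (k # L) x) x)
     (dd vs (\<lambda>L x. 1 / 2 * (\<Sum>k\<in>UNIV. \<xi> $ k * (\<Sum>j\<in>UNIV. \<xi> $ j * D (k # j # L) x))) x)"
    by (rule jet2_dd) (rule jet2_line[OF D x])
  then show ?thesis by (simp only: dd.simps dd_lincomb dd_scale)
qed

subsection \<open>Symmetric matrices and concave symmetric functions\<close>

text \<open>Criticality at a maximum, in the form needed for Rayleigh quotients; the chosen
  \<open>t\<close> makes the linear term dominate whatever the size of
  \<open>\<beta>\<close>.\<close>

lemma quadratic_nonpos_imp_linear_zero:
  fixes \<alpha> \<beta> :: real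
  assumes "\<And>t. 2 * t * \<alpha> + t^2 * \<beta> \<le> 0"
  shows "\<alpha> = 0"
proof (rule ccontr)
  assume "\<alpha> \<noteq> 0"
  define t where "t = \<alpha> / (\<bar>\<beta>\<bar> + 1)"
  have t: "t * (\<bar>\<beta>\<bar> + 1) = \<alpha>" "t \<noteq> 0" using \<open>\<alpha> \<noteq> 0\<close> by (auto simp: t_def add_nonneg_eq_0_iff)
  have "2 * t * \<alpha> + t^2 * \<beta> = t^2 * (2 * \<bar>\<beta>\<bar> + 2 + \<beta>)"
    unfolding t(1)[symmetric] by (simp add: algebra_simps power2_eq_square)
  moreover have "t^2 * (2 * \<bar>\<beta>\<bar> + 2 + \<beta>) > 0" using t(2) by (intro mult_pos_pos) auto
  ultimately show False using assms[of t] by linarith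
qed

text \<open>A maximizer \<open>v\<close> of the Rayleigh quotient on the unit sphere of
  \<open>W\<close> is an eigenvector: the residual \<open>y = A *v v - l *\<^sub>R v\<close> lies in
  \<open>W\<close>, and moving \<open>v\<close> along it forces \<open>y \<bullet> y = 0\<close> at
  first order.\<close>

lemma selfadjoint_eigenvector_in_subspace:
  fixes A :: "real^'n^'n"
  assumes sym: "\<And>x y. x \<bullet> (A *v y) = (A *v x) \<bullet> y"
    and W: "subspace W" "\<And>x. x \<in> W \<Longrightarrow> A *v x \<in> W" and ne: "w \<in> W" "w \<noteq> 0"
  shows "\<exists>v l. v \<in> W \<and> norm v = 1 \<and> A *v v = l *\<^sub>R v"
proof -
  let ?K = "W \<inter> sphere 0 1"
  have "compact ?K" using closed_subspace[OF W(1)] by (auto intro: closed_Int_compact)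
  moreover have "w /\<^sub>R norm w \<in> ?K" using ne W(1) by (auto simp: subspace_scale)
  moreover have "continuous_on ?K (\<lambda>x. x \<bullet> (A *v x))"
    by (intro continuous_intros linear_continuous_on) (auto simp: linear_conv_bounded_linear[symmetric])
  ultimately obtain v where v: "v \<in> ?K" "\<And>y. y \<in> ?K \<Longrightarrow> y \<bullet> (A *v y) \<le> v \<bullet> (A *v v)"
    using continuous_attains_sup[of ?K "\<lambda>x. x \<bullet> (A *v x)"] by blast
  define l where "l = v \<bullet> (A *v v)"
  have vv: "v \<bullet> v = 1" using v(1) by (simp add: norm_eq_1)
  have le: "z \<bullet> (A *v z) \<le> l * (z \<bullet> z)" if "z \<in> W" for z
  proof (cases "z = 0")
    case False
    have "(z /\<^sub>R norm z) \<bullet> (A *v (z /\<^sub>R norm z)) \<le> l"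
      unfolding l_def by (rule v(2)) (use that False W(1) in \<open>auto simp: subspace_scale\<close>)
    then have "(z \<bullet> (A *v z)) / (norm z)^2 \<le> l"
      by (simp add: matrix_vector_mult_scaleR power2_eq_square field_simps)
    then show ?thesis using False by (simp add: field_simps power2_norm_eq_inner)
  qed auto
  define y where "y = A *v v - l *\<^sub>R v"
  have "y \<in> W" unfolding y_def using v(1) W by (auto intro: subspace_diff subspace_scale)
  have "y \<bullet> y = 0"
  proof (rule quadratic_nonpos_imp_linear_zero[where \<beta> = "y \<bullet> (A *v y) - l * (y \<bullet> y)"])
    fix t
    have "v + t *\<^sub>R y \<in> W" using v(1) W(1) \<open>y \<in> W\<close> by (auto intro: subspace_add subspace_scale)
    from le[OF this] have "l + 2 * t * (y \<bullet> (A *v v)) + t^2 * (y \<bullet> (A *v y)) \<le> l * (1 + 2 * t * (y \<bullet> v) + t^2 * (y \<bullet> y))"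
      using sym[of v y] vv
      by (simp add: matrix_vector_mult_scaleR matrix_vector_right_distrib inner_add_left inner_add_right
          l_def inner_commute power2_eq_square algebra_simps)
    moreover have "y \<bullet> (A *v v) = y \<bullet> y + l * (y \<bullet> v)" by (simp add: y_def inner_diff_right inner_diff_left)
    ultimately show "2 * t * (y \<bullet> y) + t^2 * (y \<bullet> (A *v y) - l * (y \<bullet> y)) \<le> 0"
      by (simp add: algebra_simps)
  qed
  then have "A *v v = l *\<^sub>R v" by (simp add: y_def)
  then show ?thesis using v(1) by auto
qed

lemma symmetric_matrix_selfadjoint:
  fixes A :: "real^'n^'n"
  assumes "transpose A = A"
  shows "x \<bullet> (A *v y) = (A *v x) \<bullet> y"
  using dot_lmul_matrix[of x A y] assms by (metis vector_transpose_matrix)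

lemma symmetric_matrix_eigenbasis:
  fixes A :: "real^'n^'n"
  assumes A: "transpose A = A"
  shows "\<exists>e l. (\<forall>i j. e i \<bullet> e j = (if i = j then 1 else 0)) \<and> (\<forall>i::'n. A *v e i = l i *\<^sub>R (e i :: real^'n))"
proof -
  have sym: "x \<bullet> (A *v y) = (A *v x) \<bullet> y" for x y
    using A by (rule symmetric_matrix_selfadjoint)
  have "\<exists>B. finite B \<and> card B = k \<and> pairwise orthogonal B \<and> (\<forall>b\<in>B. norm b = 1 \<and> (\<exists>l. A *v b = l *\<^sub>R b))"
    if "k \<le> CARD('n)" for k
    using that
  proof (induction k)
    case 0
    then show ?case by (intro exI[of _ "{}"]) auto
  next
    case (Suc k)
    then obtain B where B: "finite B" "card B = k" "pairwise orthogonal B" "\<And>b. b \<in> B \<Longrightarrow> norm b = 1"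
      "\<And>b. b \<in> B \<Longrightarrow> \<exists>l. A *v b = l *\<^sub>R b" by auto
    have "dim (span B) < DIM(real^'n)"
      using dim_le_card'[OF B(1)] B(2) Suc.prems by (simp add: dim_span)
    then have "span B \<noteq> UNIV" by (metis dim_UNIV order_less_irrefl)
    then obtain w where w: "w \<noteq> 0" "\<And>x. x \<in> span B \<Longrightarrow> orthogonal w x"
      using orthogonal_to_subspace_exists_gen[of B UNIV] by (metis span_UNIV subset_UNIV psubsetI)
    \<comment> \<open>The orthogonal complement of the eigenvectors found so far; self-adjointness
      makes it invariant, and \<open>w\<close> shows that it is not trivial.\<close>
    define W where "W = {x. \<forall>b\<in>B. b \<bullet> x = 0}"
    have "\<exists>v l. v \<in> W \<and> norm v = 1 \<and> A *v v = l *\<^sub>R v"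
    proof (rule selfadjoint_eigenvector_in_subspace[OF sym])
      show "subspace W" by (auto simp: subspace_def W_def inner_add_right)
      show "A *v x \<in> W" if "x \<in> W" for x
        unfolding W_def
      proof (intro CollectI ballI)
        fix b assume "b \<in> B"
        then obtain l where "A *v b = l *\<^sub>R b" using B(5) by blast
        then show "b \<bullet> (A *v x) = 0" using sym[of b x] that \<open>b \<in> B\<close> by (simp add: W_def)
      qed
      show "w \<in> W" using w(2) by (auto simp: W_def orthogonal_def span_base inner_commute)
    qed fact
    then obtain v l where v: "v \<in> W" "norm v = 1" "A *v v = l *\<^sub>R v" by blast
    have "v \<notin> B"
    proof
      assume "v \<in> B"
      then have "v \<bullet> v = 0" using v(1) by (auto simp: W_def)
      then show False using v(2) by auto
    qed
    have "orthogonal v b \<and> orthogonal b v" if "b \<in> B" for b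
      using v(1) that by (simp add: W_def orthogonal_def inner_commute)
    then have "pairwise orthogonal (insert v B)"
      using B(3) by (simp add: pairwise_insert)
    with \<open>v \<notin> B\<close> show ?case using B v
      by (intro exI[of _ "insert v B"]) auto
  qed
  then obtain B where B: "finite B" "card B = CARD('n)" "pairwise orthogonal B"
    "\<forall>b\<in>B. norm b = 1 \<and> (\<exists>l. A *v b = l *\<^sub>R b)" by blast
  then obtain e where e: "bij_betw e (UNIV::'n set) B"
    using finite_same_card_bij[of "UNIV::'n set" B] by auto
  have eB: "e i \<in> B" for i using e by (auto simp: bij_betw_def)
  then have "\<forall>i. \<exists>l. A *v e i = l *\<^sub>R e i" using B(4) by blast
  then obtain l where "\<And>i. A *v e i = l i *\<^sub>R e i" unfolding choice_iff by blast
  moreover have "e i \<bullet> e j = (if i = j then 1 else 0)" for i j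
  proof (cases "i = j")
    case True
    then show ?thesis using B(4) eB[of i] by (simp add: norm_eq_1)
  next
    case False
    then have "e i \<noteq> e j" using e by (auto simp: bij_betw_def inj_on_def)
    then show ?thesis using B(3) eB[of i] eB[of j] False by (simp add: pairwise_def orthogonal_def)
  qed
  ultimately show ?thesis by blast
qed

lemma orthonormal_columns:
  fixes e :: "'n \<Rightarrow> real^'n"
  assumes "\<And>i j. e i \<bullet> e j = (if i = j then 1 else 0)"
  shows "orthogonal_matrix (\<chi> i j. e j $ i)"
    and "(\<Sum>k\<in>UNIV. e k $ i * e k $ j) = (if i = j then 1 else 0)"
proof -
  let ?P = "\<chi> i j. e j $ i :: real^'n^'n"
  have "transpose ?P ** ?P = mat 1"
    using assms by (simp add: vec_eq_iff matrix_matrix_mult_def transpose_def mat_def inner_vec_def)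
  then show o: "orthogonal_matrix ?P" by (simp add: orthogonal_matrix)
  then have "?P ** transpose ?P = mat 1" by (simp add: orthogonal_matrix_def)
  then have "(?P ** transpose ?P) $ i $ j = mat 1 $ i $ j" by simp
  then show "(\<Sum>k\<in>UNIV. e k $ i * e k $ j) = (if i = j then 1 else 0)"
    by (simp add: matrix_matrix_mult_def transpose_def mat_def)
qed

lemma orthonormal_expansion:
  fixes e :: "'n \<Rightarrow> real^'n"
  assumes "\<And>i j. e i \<bullet> e j = (if i = j then 1 else 0)"
  shows "x = (\<Sum>k\<in>UNIV. (e k \<bullet> x) *\<^sub>R e k)"
proof (rule vec_eq_iff[THEN iffD2, rule_format])
  fix i
  have "(\<Sum>k\<in>UNIV. (e k \<bullet> x) *\<^sub>R e k) $ i = (\<Sum>k\<in>UNIV. \<Sum>j\<in>UNIV. x $ j * (e k $ i * e k $ j))"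
    by (simp add: inner_vec_def sum_distrib_left sum_distrib_right mult_ac)
  also have "\<dots> = (\<Sum>j\<in>UNIV. x $ j * (\<Sum>k\<in>UNIV. e k $ i * e k $ j))"
    by (subst sum.swap) (simp add: sum_distrib_left)
  also have "\<dots> = x $ i" by (simp add: orthonormal_columns(2)[OF assms] if_distrib cong: if_cong)
  finally show "x $ i = (\<Sum>k\<in>UNIV. (e k \<bullet> x) *\<^sub>R e k) $ i" by simp
qed

lemma eigenbasis_quadratic_form:
  fixes e :: "'n \<Rightarrow> real^'n"
  assumes e: "\<And>i j. e i \<bullet> e j = (if i = j then 1 else 0)" and A: "\<And>i. A *v e i = l i *\<^sub>R e i"
  shows "x \<bullet> (A *v y) = (\<Sum>k\<in>UNIV. l k * (e k \<bullet> x) * (e k \<bullet> y))"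
proof -
  have "A *v y = A *v (\<Sum>k\<in>UNIV. (e k \<bullet> y) *\<^sub>R e k)" using orthonormal_expansion[OF e, of y] by simp
  also have "\<dots> = (\<Sum>k\<in>UNIV. (e k \<bullet> y) *\<^sub>R (l k *\<^sub>R e k))"
    by (simp add: linear_sum[OF matrix_vector_mul_linear] matrix_vector_mult_scaleR A)
  finally show ?thesis
    by (simp add: inner_sum_right inner_commute mult_ac)
qed

text \<open>\<open>T\<close> is \<open>N\<close> to the power -1/2. An eigenvalue of
  \<open>N\<close> differs from 1 by at most \<open>n^2 * d\<close>, since the \<open>n^2\<close>
  entries of the deviation are weighted by components of a unit vector; an entry of
  \<open>T - I\<close> adds up \<open>n\<close> such differences, whence \<open>n^3 * d\<close>. The
  smallness hypothesis keeps eigenvalues above 1/2, where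
  \<open>\<bar>1 / sqrt \<nu> - 1\<bar> \<le> \<bar>\<nu> - 1\<bar>\<close>.\<close>

lemma inverse_sqrt_near_identity:
  fixes N :: "real^'n^'n"
  assumes sym: "transpose N = N" and near: "\<And>i j. \<bar>N $ i $ j - (if i = j then 1 else 0)\<bar> \<le> d"
    and small: "real CARD('n)^2 * d \<le> 1 / 2"
  shows "\<exists>T::real^'n^'n. (\<forall>i j. (\<Sum>k\<in>UNIV. \<Sum>l\<in>UNIV. T $ k $ i * N $ k $ l * T $ l $ j) = (if i = j then 1 else 0)) \<and>
      (\<forall>i j. \<bar>T $ i $ j - (if i = j then 1 else 0)\<bar> \<le> real CARD('n)^3 * d)"
proof -
  obtain e \<nu> where e: "\<And>i j. e i \<bullet> e j = (if i = j then 1 else 0)" and N: "\<And>i::'n. N *v e i = \<nu> i *\<^sub>R (e i::real^'n)"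
    using symmetric_matrix_eigenbasis[OF sym] by blast
  have comp: "\<bar>e k $ i\<bar> \<le> 1" for k i
    using component_le_norm_cart[of "e k" i] e[of k k] by (simp add: norm_eq_sqrt_inner)
  have comp2: "\<bar>e k $ i\<bar> * \<bar>e k $ j\<bar> \<le> 1" for k i j
    using comp by (intro mult_le_one) auto
  have eig: "\<bar>\<nu> k - 1\<bar> \<le> real CARD('n)^2 * d" for k
  proof -
    have "\<nu> k - 1 = e k \<bullet> (N *v e k) - e k \<bullet> e k" using N e[of k k] by simp
    also have "\<dots> = (\<Sum>i\<in>UNIV. \<Sum>j\<in>UNIV. e k $ i * e k $ j * (N $ i $ j - (if i = j then 1 else 0)))"
    proof -
      have "(\<Sum>j\<in>UNIV. e k $ i * e k $ j * (N $ i $ j - (if i = j then 1 else 0)))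
          = e k $ i * (N *v e k) $ i - e k $ i * e k $ i" for i
      proof -
        have "e k $ i * e k $ j * (N $ i $ j - (if i = j then 1 else 0))
            = e k $ i * (N $ i $ j * e k $ j) - (if i = j then e k $ i * e k $ i else 0)" for j
          by (simp add: algebra_simps)
        then show ?thesis
          by (simp add: sum_subtractf matrix_vector_mult_def sum_distrib_left)
      qed
      then show ?thesis by (simp add: inner_vec_def sum_subtractf)
    qed
    also have "\<bar>\<dots>\<bar> \<le> (\<Sum>i\<in>(UNIV::'n set). \<Sum>j\<in>(UNIV::'n set). d)"
    proof (intro order_trans[OF sum_abs] sum_mono order_trans[OF sum_abs])
      fix i j
      have "\<bar>e k $ i * e k $ j\<bar> * \<bar>N $ i $ j - (if i = j then 1 else 0)\<bar> \<le> 1 * d"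
        by (intro mult_mono near) (use comp2 in \<open>auto simp: abs_mult\<close>)
      then show "\<bar>e k $ i * e k $ j * (N $ i $ j - (if i = j then 1 else 0))\<bar> \<le> d" by (simp add: abs_mult)
    qed
    finally show ?thesis by (simp add: power2_eq_square)
  qed
  have pos: "\<nu> k \<ge> 1 / 2" for k using eig[of k] small by linarith
  have inv: "\<bar>1 / sqrt (\<nu> k) - 1\<bar> \<le> \<bar>\<nu> k - 1\<bar>" for k
  proof -
    define s where "s = sqrt (\<nu> k)"
    have s: "s > 0" "s^2 = \<nu> k" using pos[of k] by (auto simp: s_def)
    have "s \<ge> 1/2" unfolding s_def by (rule real_le_rsqrt) (use pos[of k] in \<open>simp add: power_divide\<close>)
    then have "s * (1 + s) \<ge> 1" using s pos[of k] by (simp add: power2_eq_square algebra_simps)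
    then have "\<bar>1 - s\<bar> * 1 \<le> \<bar>1 - s\<bar> * (s * (1 + s))" by (intro mult_left_mono) auto
    also have "\<dots> = s * \<bar>1 - s^2\<bar>"
    proof -
      have "1 - s^2 = (1 - s) * (1 + s)" by (simp add: power2_eq_square algebra_simps)
      then show ?thesis using s by (simp add: abs_mult)
    qed
    finally have "\<bar>1 - s\<bar> / s \<le> \<bar>1 - s^2\<bar>" using s by (simp add: field_simps)
    moreover have "1 / s - 1 = (1 - s) / s" using s by (simp add: field_simps)
    ultimately show ?thesis using s unfolding s_def[symmetric] by (simp add: abs_minus_commute)
  qed
  define T where "T = (\<chi> i j. \<Sum>k\<in>UNIV. (1 / sqrt (\<nu> k)) * (e k $ i * e k $ j))"
  have Tcol: "(\<chi> k. T $ k $ i) = (\<Sum>k\<in>UNIV. ((1 / sqrt (\<nu> k)) * e k $ i) *\<^sub>R e k)" for i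
    by (simp add: T_def vec_eq_iff mult_ac)
  have eT: "e k \<bullet> (\<chi> k. T $ k $ i) = (1 / sqrt (\<nu> k)) * e k $ i" for k i
    unfolding Tcol by (simp add: inner_sum_right e if_distrib cong: if_cong)
  have "(\<Sum>k\<in>UNIV. \<Sum>l\<in>UNIV. T $ k $ i * N $ k $ l * T $ l $ j) = (if i = j then 1 else 0)" for i j
  proof -
    have "(\<Sum>k\<in>UNIV. \<Sum>l\<in>UNIV. T $ k $ i * N $ k $ l * T $ l $ j)
        = (\<chi> k. T $ k $ i) \<bullet> (N *v (\<chi> k. T $ k $ j))"
      by (simp add: inner_vec_def matrix_vector_mult_def sum_distrib_left mult_ac)
    also have "\<dots> = (\<Sum>k\<in>UNIV. \<nu> k * ((1 / sqrt (\<nu> k)) * e k $ i) * ((1 / sqrt (\<nu> k)) * e k $ j))"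
      unfolding eigenbasis_quadratic_form[OF e N] eT ..
    also have "\<dots> = (\<Sum>k\<in>UNIV. e k $ i * e k $ j)"
    proof (intro sum.cong refl)
      fix k
      have "sqrt (\<nu> k) * sqrt (\<nu> k) = \<nu> k" "\<nu> k \<noteq> 0" using pos[of k] by auto
      then show "\<nu> k * ((1 / sqrt (\<nu> k)) * e k $ i) * ((1 / sqrt (\<nu> k)) * e k $ j) = e k $ i * e k $ j"
        by (simp add: divide_simps)
    qed
    also have "\<dots> = (if i = j then 1 else 0)" by (rule orthonormal_columns(2)[OF e])
    finally show ?thesis .
  qed
  moreover have "\<bar>T $ i $ j - (if i = j then 1 else 0)\<bar> \<le> real CARD('n)^3 * d" for i j
  proof -
    have "T $ i $ j - (if i = j then 1 else 0) = (\<Sum>k\<in>UNIV. (1 / sqrt (\<nu> k) - 1) * (e k $ i * e k $ j))"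
      unfolding orthonormal_columns(2)[OF e, symmetric] T_def
      by (simp add: left_diff_distrib sum_subtractf)
    also have "\<bar>\<dots>\<bar> \<le> (\<Sum>k\<in>(UNIV::'n set). real CARD('n)^2 * d)"
    proof (intro order_trans[OF sum_abs] sum_mono)
      fix k
      have "\<bar>1 / sqrt (\<nu> k) - 1\<bar> * \<bar>e k $ i * e k $ j\<bar> \<le> (real CARD('n)^2 * d) * 1"
        by (intro mult_mono order_trans[OF inv eig])
          (use comp2 order_trans[OF abs_ge_zero eig] in \<open>auto simp: abs_mult\<close>)
      then show "\<bar>(1 / sqrt (\<nu> k) - 1) * (e k $ i * e k $ j)\<bar> \<le> real CARD('n)^2 * d" by (simp add: abs_mult)
    qed
    finally show ?thesis by (simp add: eval_nat_numeral mult_ac)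
  qed
  ultimately show ?thesis by blast
qed

section \<open>Oppositely ordered families and doubly stochastic weights\<close>

lemma finite_attains_min:
  fixes g :: "'a \<Rightarrow> real"
  assumes "finite S" "S \<noteq> {}"
  shows "\<exists>m\<in>S. \<forall>x\<in>S. g m \<le> g x"
proof -
  have "Min (g ` S) \<in> g ` S" using assms by (intro Min_in) auto
  then obtain m where m: "m \<in> S" "g m = Min (g ` S)" by auto
  then have "\<forall>x\<in>S. g m \<le> g x" using assms(1) by simp
  then show ?thesis using m(1) by blast
qed

text \<open>\<open>M\<close> is the dual certificate that lets the rearrangement inequality pass from permutations to doubly
  stochastic matrices without Birkhoff's theorem.\<close>

lemma antitone_potential:
  fixes f \<mu> :: "'a \<Rightarrow> real"
  assumes "finite I" "\<And>i j. i \<in> I \<Longrightarrow> j \<in> I \<Longrightarrow> (f i - f j) * (\<mu> i - \<mu> j) \<le> 0"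
  shows "\<exists>M. \<forall>i\<in>I. \<forall>j\<in>I. M i - M j \<le> (f i - f j) * \<mu> j"
  using assms
proof (induction "card I" arbitrary: I)
  case 0
  then show ?case by auto
next
  case (Suc k)
  have ne: "I \<noteq> {}" "finite I" using Suc by auto
  \<comment> \<open>Minimizing the difference breaks ties correctly: as \<open>f\<close> and
    \<open>\<mu>\<close> are oppositely ordered, \<open>m\<close> has both the largest
    \<open>f\<close> and the smallest \<open>\<mu>\<close>.\<close>
  obtain m where "m \<in> I" and m': "\<forall>i\<in>I. \<mu> m - f m \<le> \<mu> i - f i"
    using finite_attains_min[OF ne(2,1), of "\<lambda>i. \<mu> i - f i"] by blast
  then have m: "m \<in> I" "\<And>i. i \<in> I \<Longrightarrow> f i - \<mu> i \<le> f m - \<mu> m"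
    by force+
  have fm: "f i \<le> f m \<and> \<mu> m \<le> \<mu> i" if "i \<in> I" for i
    using m(2)[OF that] Suc.prems(2)[OF that m(1)] unfolding mult_le_0_iff by linarith
  let ?J = "I - {m}"
  have "k = card ?J" using Suc.hyps(2) m(1) ne by simp
  then obtain M where M: "\<And>i j. i \<in> ?J \<Longrightarrow> j \<in> ?J \<Longrightarrow> M i - M j \<le> (f i - f j) * \<mu> j"
    using Suc.hyps(1)[of ?J] Suc.prems ne by fastforce
  show ?case
  proof (cases "?J = {}")
    case True
    then have "I = {m}" using m(1) by blast
    then show ?thesis by auto
  next
    case False
    obtain q where q: "q \<in> ?J" "\<And>i. i \<in> ?J \<Longrightarrow> M q + (f m - f q) * \<mu> q \<le> M i + (f m - f i) * \<mu> i"
      using finite_attains_min[OF _ False, of "\<lambda>i. M i + (f m - f i) * \<mu> i"] ne by blast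
    \<comment> \<open>\<open>M\<close> acts as a concave function of \<open>f\<close> with slopes
      \<open>\<mu>\<close>. Its value at the new rightmost point is the lowest of the tangent lines
      at the old points.\<close>
    define c where "c = M q + (f m - f q) * \<mu> q"
    have lower: "M i - c \<le> (f i - f m) * \<mu> m" if "i \<in> ?J" for i
    proof -
      have "(f m - f i) * \<mu> m \<le> (f m - f i) * \<mu> q" using fm that q(1) by (intro mult_left_mono) auto
      then show ?thesis using M[OF that q(1)] by (simp add: c_def algebra_simps)
    qed
    show ?thesis
    proof (intro exI[of _ "M(m := c)"] ballI)
      fix i j assume "i \<in> I" "j \<in> I"
      then show "(M(m := c)) i - (M(m := c)) j \<le> (f i - f j) * \<mu> j"
        using M[of i j] lower[of i] q(2)[of j] by (auto simp: c_def)
    qed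
  qed
qed

text \<open>Weight the inequalities for the potential \<open>M\<close> by \<open>S\<close>: unit row
  and column sums make the \<open>M\<close> terms cancel and reduce the terms
  \<open>f j * \<mu> j\<close> to their plain sum.\<close>

lemma doubly_stochastic_antitone:
  fixes f \<mu> :: "'n::finite \<Rightarrow> real" and S :: "'n \<Rightarrow> 'n \<Rightarrow> real"
  assumes "\<And>i j. (f i - f j) * (\<mu> i - \<mu> j) \<le> 0"
    and S: "\<And>i j. S i j \<ge> 0" "\<And>i. (\<Sum>j\<in>UNIV. S i j) = 1" "\<And>j. (\<Sum>i\<in>UNIV. S i j) = 1"
  shows "(\<Sum>i\<in>UNIV. f i * \<mu> i) \<le> (\<Sum>i\<in>UNIV. \<Sum>j\<in>UNIV. S i j * f i * \<mu> j)"
proof -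
  obtain M where M: "\<And>i j. M i - M j \<le> (f i - f j) * \<mu> j"
    using antitone_potential[of UNIV f \<mu>] assms(1) by auto
  have "(\<Sum>i\<in>UNIV. \<Sum>j\<in>UNIV. S i j * M i) = (\<Sum>i\<in>UNIV. M i)"
    by (simp flip: sum_distrib_right add: S)
  moreover have "(\<Sum>i\<in>UNIV. \<Sum>j\<in>UNIV. S i j * M j) = (\<Sum>i\<in>UNIV. M i)"
    by (subst sum.swap) (simp flip: sum_distrib_right add: S)
  moreover have "(\<Sum>i\<in>UNIV. \<Sum>j\<in>UNIV. S i j * (f j * \<mu> j)) = (\<Sum>j\<in>UNIV. f j * \<mu> j)"
    by (subst sum.swap) (simp flip: sum_distrib_right add: S)
  moreover have "(\<Sum>i\<in>UNIV. \<Sum>j\<in>UNIV. S i j * (M i - M j)) \<le> (\<Sum>i\<in>UNIV. \<Sum>j\<in>UNIV. S i j * ((f i - f j) * \<mu> j))"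
    by (intro sum_mono mult_left_mono M S)
  ultimately show ?thesis
    by (simp add: algebra_simps sum.distrib sum_subtractf)
qed

text \<open>Any permutation minimizing \<open>\<Sum> f i * l (p i)\<close> works: exchanging two of
  its values changes the sum by minus the stated product, and cannot lower it.\<close>

lemma antitone_rearrangement:
  fixes f l :: "'n::finite \<Rightarrow> real"
  shows "\<exists>p. p permutes UNIV \<and> (\<forall>i j. (f i - f j) * (l (p i) - l (p j)) \<le> 0)"
proof -
  let ?Q = "{p. p permutes (UNIV::'n set)}" and ?F = "\<lambda>p. \<Sum>i\<in>UNIV. f i * l (p i)"
  have "finite ?Q" by (rule finite_permutations) simp
  moreover have "?Q \<noteq> {}" using permutes_id by blast
  ultimately obtain p where p: "p \<in> ?Q" "\<And>q. q \<in> ?Q \<Longrightarrow> ?F p \<le> ?F q"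
    using finite_attains_min[of ?Q ?F] by blast
  have "(f i - f j) * (l (p i) - l (p j)) \<le> 0" for i j
  proof (cases "i = j")
    case False
    let ?q = "p \<circ> Transposition.transpose i j"
    have "?q \<in> ?Q" using p(1) by (auto intro: permutes_compose permutes_swap_id)
    then have "?F p \<le> ?F ?q" by (rule p(2))
    moreover have split: "sum g UNIV = g i + (g j + sum g (UNIV - {i} - {j}))" for g :: "'n \<Rightarrow> real"
      using False by (simp add: sum.remove[of UNIV i] sum.remove[of "UNIV - {i}" j])
    moreover have "(\<Sum>k\<in>UNIV - {i} - {j}. f k * l (?q k)) = (\<Sum>k\<in>UNIV - {i} - {j}. f k * l (p k))"
      by (intro sum.cong refl) (auto simp: Transposition.transpose_def)
    ultimately show ?thesis
      unfolding split[of "\<lambda>k. f k * l (p k)"] split[of "\<lambda>k. f k * l (?q k)"] by (simp add: algebra_simps)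
  qed simp
  then show ?thesis using p(1) by auto
qed

section \<open>Supporting planes of the curvature function\<close>

lemma Kplus_open: "open (Kplus :: (real^'n) set)"
proof -
  have "Kplus = (\<Inter>i\<in>UNIV. {x :: real^'n. 0 < x $ i})" by (auto simp: Kplus_def)
  also have "open \<dots>" by (intro open_INT ballI open_Collect_less continuous_intros) auto
  finally show ?thesis .
qed

lemma Kplus_permute: "p permutes UNIV \<Longrightarrow> l \<in> Kplus \<Longrightarrow> (\<chi> i. l $ p i) \<in> Kplus"
  by (simp add: Kplus_def)

lemma derivative_ge_chord_slope:
  fixes \<phi> :: "real \<Rightarrow> real"
  assumes "(\<phi> has_real_derivative D) (at 0)" "\<And>t. 0 < t \<Longrightarrow> t \<le> 1 \<Longrightarrow> \<phi> 0 + t * c \<le> \<phi> t"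
  shows "c \<le> D"
proof (rule ccontr)
  assume "\<not> c \<le> D"
  have "((\<lambda>t. \<phi> t - c * t) has_real_derivative D - c) (at 0)"
    by (auto intro!: derivative_eq_intros assms(1))
  then obtain d where d: "d > 0" "\<And>h. 0 < h \<Longrightarrow> h < d \<Longrightarrow> \<phi> h - c * h < \<phi> 0"
    using DERIV_neg_dec_right[of "\<lambda>t. \<phi> t - c * t" "D - c" 0] \<open>\<not> c \<le> D\<close> by auto
  define h where "h = min (d / 2) 1"
  have h: "0 < h" "h < d" "h \<le> 1" using d(1) by (auto simp: h_def)
  show False using d(2)[OF h(1,2)] assms(2)[OF h(1,3)] by (simp add: mult.commute)
qed

text \<open>\<open>g\<close> is the gradient of \<open>f\<close> at \<open>\<kappa>\<close>.
  Concavity puts \<open>f\<close> below its tangent plane, and Euler's relation for degree one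
  removes the constant term, so that the bound is linear in \<open>l\<close>.\<close>

lemma structure_supergradient:
  fixes f :: "real^'n \<Rightarrow> real"
  assumes f: "structure_conditions f" and k: "\<kappa> \<in> Kplus"
  obtains g :: "'n \<Rightarrow> real" where "\<And>i. g i > 0" "(\<Sum>i\<in>UNIV. g i * \<kappa> $ i) = f \<kappa>"
    "\<And>l. l \<in> Kplus \<Longrightarrow> f l \<le> (\<Sum>i\<in>UNIV. g i * l $ i)"
proof -
  obtain D where D: "smooth_family Kplus Kplus D" "\<And>x. x \<in> Kplus \<Longrightarrow> D [] x = f x"
    using f by (auto simp: structure_conditions_def smooth_on_def)
  define g where "g = (\<lambda>i. D [i] \<kappa>)"
  have ev: "eventually (\<lambda>t. D [] (\<kappa> + t *\<^sub>R \<xi>) = f (\<kappa> + t *\<^sub>R \<xi>)) (nhds (0::real))" for \<xi>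
  proof -
    have "((\<lambda>t. \<kappa> + t *\<^sub>R \<xi>) \<longlongrightarrow> \<kappa> + 0 *\<^sub>R \<xi>) (nhds (0::real))"
      by (intro tendsto_intros filterlim_ident)
    then have "eventually (\<lambda>t. \<kappa> + t *\<^sub>R \<xi> \<in> Kplus) (nhds (0::real))"
      using Kplus_open k by (auto intro!: topological_tendstoD)
    then show ?thesis by eventually_elim (rule D(2))
  qed
  have der: "((\<lambda>t. f (\<kappa> + t *\<^sub>R \<xi>)) has_real_derivative (\<Sum>i\<in>UNIV. \<xi> $ i * g i)) (at 0)" for \<xi>
  proof -
    have "((\<lambda>t. D [] (\<kappa> + t *\<^sub>R \<xi>)) has_derivative (\<lambda>h. \<Sum>i\<in>UNIV. (h *\<^sub>R \<xi>) $ i * D [i] \<kappa>)) (at 0)"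
      using smooth_family_has_derivative[OF D(1) k, of "[]"]
      by (intro has_derivative_compose[where f = "\<lambda>t. \<kappa> + t *\<^sub>R \<xi>" and g = "D []"]) (auto intro!: derivative_eq_intros)
    then have "((\<lambda>t. D [] (\<kappa> + t *\<^sub>R \<xi>)) has_real_derivative (\<Sum>i\<in>UNIV. \<xi> $ i * g i)) (at 0)"
      by (rule has_derivative_imp_has_field_derivative) (simp add: sum_distrib_left mult_ac g_def)
    then show ?thesis using DERIV_cong_ev[OF refl ev refl] by blast
  qed
  show thesis
  proof
    show "g i > 0" for i
    proof -
      obtain d where d: "d > 0" "has_partial f i d \<kappa>"
        using f k unfolding structure_conditions_def by blast
      have "(\<Sum>j\<in>UNIV. axis i 1 $ j * g j) = g i"
        by (simp add: axis_def if_distrib[of "\<lambda>x. x * _"] cong: if_cong)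
      then have "g i = d" using DERIV_unique[OF der[of "axis i 1"] d(2)[unfolded has_partial_def]] by simp
      then show ?thesis using d by simp
    qed
    have hom: "f (t *\<^sub>R l) = t * f l" if "l \<in> Kplus" "t > 0" for t l
      using f that by (auto simp: structure_conditions_def)
    have "((\<lambda>t. (1 + t) * f \<kappa>) has_real_derivative f \<kappa>) (at 0)"
      by (auto intro!: derivative_eq_intros)
    moreover have "eventually (\<lambda>t. (1 + t) * f \<kappa> = f (\<kappa> + t *\<^sub>R \<kappa>)) (nhds (0::real))"
    proof -
      have "eventually (\<lambda>t. t > -1) (nhds (0::real))"
        using eventually_nhds_in_open[of "{-1<..}" "0::real"] by simp
      then show ?thesis
      proof eventually_elim
        case (elim t)
        have "\<kappa> + t *\<^sub>R \<kappa> = (1 + t) *\<^sub>R \<kappa>" by (simp add: scaleR_add_left)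
        then show ?case using hom[OF k, of "1 + t"] elim by simp
      qed
    qed
    ultimately have "((\<lambda>t. f (\<kappa> + t *\<^sub>R \<kappa>)) has_real_derivative f \<kappa>) (at 0)"
      using DERIV_cong_ev[OF refl _ refl, of "\<lambda>t. (1 + t) * f \<kappa>" "\<lambda>t. f (\<kappa> + t *\<^sub>R \<kappa>)" 0] by simp
    then show euler: "(\<Sum>i\<in>UNIV. g i * \<kappa> $ i) = f \<kappa>"
      using DERIV_unique[OF der[of \<kappa>]] by (simp add: mult.commute)
    show "f l \<le> (\<Sum>i\<in>UNIV. g i * l $ i)" if l: "l \<in> Kplus" for l
    proof -
      have "f l - f \<kappa> \<le> (\<Sum>i\<in>UNIV. (l - \<kappa>) $ i * g i)"
      proof (rule derivative_ge_chord_slope[OF der])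
        fix t :: real assume "0 < t" "t \<le> 1"
        then have "t * f l + (1 - t) * f \<kappa> \<le> f (t *\<^sub>R l + (1 - t) *\<^sub>R \<kappa>)"
          using f l k concave_onD[of Kplus f t \<kappa> l] by (simp add: structure_conditions_def add.commute)
        then show "f (\<kappa> + 0 *\<^sub>R (l - \<kappa>)) + t * (f l - f \<kappa>) \<le> f (\<kappa> + t *\<^sub>R (l - \<kappa>))"
          by (simp add: algebra_simps)
      qed
      then show ?thesis using euler by (simp add: algebra_simps sum_subtractf)
    qed
  qed
qed

text \<open>A form of Schur concavity: the permutation of \<open>l\<close> oppositely ordered to \<open>g\<close> minimizes the right-hand side.\<close>

lemma symmetric_supergradient_doubly_stochastic:
  fixes f :: "real^'n \<Rightarrow> real" and S :: "'n \<Rightarrow> 'n \<Rightarrow> real"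
  assumes sym: "symmetric_fun f" and g: "\<And>l. l \<in> Kplus \<Longrightarrow> f l \<le> (\<Sum>i\<in>UNIV. g i * l $ i)"
    and l: "l \<in> Kplus"
    and S: "\<And>i j. S i j \<ge> 0" "\<And>i. (\<Sum>j\<in>UNIV. S i j) = 1" "\<And>j. (\<Sum>i\<in>UNIV. S i j) = 1"
  shows "f l \<le> (\<Sum>i\<in>UNIV. \<Sum>j\<in>UNIV. S i j * g i * l $ j)"
proof -
  obtain p where p: "p permutes UNIV" "\<And>i j. (g i - g j) * (l $ p i - l $ p j) \<le> 0"
    using antitone_rearrangement[of g "\<lambda>i. l $ i"] by auto
  have bij: "bij_betw p UNIV UNIV" using p(1) by (rule permutes_imp_bij)
  have re: "(\<Sum>j\<in>UNIV. h (p j)) = (\<Sum>j\<in>UNIV. h j)" for h :: "'n \<Rightarrow> real"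
    using sum.reindex_bij_betw[OF bij, of h] .
  have "f l = f (\<chi> i. l $ p i)" using sym p(1) l by (simp add: symmetric_fun_def)
  also have "\<dots> \<le> (\<Sum>i\<in>UNIV. g i * l $ p i)" using g[OF Kplus_permute[OF p(1) l]] by simp
  also have "\<dots> \<le> (\<Sum>i\<in>UNIV. \<Sum>j\<in>UNIV. S i (p j) * g i * l $ p j)"
    by (rule doubly_stochastic_antitone[OF p(2)]) (simp_all add: S re[of "\<lambda>j. S _ j"])
  also have "\<dots> = (\<Sum>i\<in>UNIV. \<Sum>j\<in>UNIV. S i j * g i * l $ j)"
    by (intro sum.cong refl re[of "\<lambda>j. S _ j * g _ * l $ j"])
  finally show ?thesis .
qed

subsection \<open>The shape operator as a pair of quadratic forms\<close>

definition Dgrad :: "('n list \<Rightarrow> real^'n \<Rightarrow> real) \<Rightarrow> real^'n \<Rightarrow> real^'n" where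
  "Dgrad D x = (\<chi> i. D [i] x)"

definition gform :: "('n list \<Rightarrow> real^'n \<Rightarrow> real) \<Rightarrow> real^'n \<Rightarrow> real^'n \<Rightarrow> real^'n \<Rightarrow> real" where
  "gform D x v v' = v \<bullet> v' + dd [v] D x * dd [v'] D x"

text \<open>The Hessian of \<open>(u\<^sup>2 + \<bar>x\<bar>\<^sup>2) / 2\<close>. In terms of this form the hyperbolic principal curvatures are
  the eigenvalues of \<open>phess / wfun\<close> relative to \<open>gform\<close>.\<close>

definition phess :: "('n list \<Rightarrow> real^'n \<Rightarrow> real) \<Rightarrow> real^'n \<Rightarrow> real^'n \<Rightarrow> real^'n \<Rightarrow> real" where
  "phess D x v v' = D [] x * dd [v, v'] D x + gform D x v v'"

declare dd.simps [simp del]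

lemma dd_1: "dd [v] D x = v \<bullet> Dgrad D x"
  by (simp add: dd.simps inner_vec_def Dgrad_def)

lemma dd_2: "dd [v, v'] D x = v \<bullet> (hessM D x *v v')"
  by (simp add: dd.simps inner_vec_def hessM_def matrix_vector_mult_def mult.commute)

lemma dd_linear:
  "dd [v + w] D x = dd [v] D x + dd [w] D x"
  "dd [c *\<^sub>R v] D x = c * dd [v] D x"
  "dd [v + w, v'] D x = dd [v, v'] D x + dd [w, v'] D x"
  "dd [v, v' + w'] D x = dd [v, v'] D x + dd [v, w'] D x"
  "dd [c *\<^sub>R v, v'] D x = c * dd [v, v'] D x"
  "dd [v, c *\<^sub>R v'] D x = c * dd [v, v'] D x"
  by (simp_all add: dd_1 dd_2 inner_add_left inner_add_right matrix_vector_right_distrib matrix_vector_mult_scaleR)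

lemma dd_sum:
  "dd [\<Sum>i\<in>I. v i] D x = (\<Sum>i\<in>I. dd [v i] D x)"
  "dd [\<Sum>i\<in>I. v i, v'] D x = (\<Sum>i\<in>I. dd [v i, v'] D x)"
  "dd [v', \<Sum>i\<in>I. v i] D x = (\<Sum>i\<in>I. dd [v', v i] D x)"
  by (simp_all add: dd_1 dd_2 inner_sum_left inner_sum_right linear_sum[OF matrix_vector_mul_linear])

lemma gform_commute: "gform D x v v' = gform D x v' v"
  by (simp add: gform_def inner_commute mult.commute)

lemma gform_linear:
  "gform D x (v + w) v' = gform D x v v' + gform D x w v'"
  "gform D x v (v' + w') = gform D x v v' + gform D x v w'"
  "gform D x (c *\<^sub>R v) v' = c * gform D x v v'"
  "gform D x v (c *\<^sub>R v') = c * gform D x v v'"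
  by (simp_all add: gform_def dd_linear inner_add_left inner_add_right algebra_simps)

lemma gform_sum:
  "gform D x (\<Sum>i\<in>I. v i) v' = (\<Sum>i\<in>I. gform D x (v i) v')"
  "gform D x v' (\<Sum>i\<in>I. v i) = (\<Sum>i\<in>I. gform D x v' (v i))"
  by (simp_all add: gform_def dd_sum inner_sum_left inner_sum_right sum.distrib sum_distrib_left sum_distrib_right)

lemma phess_linear:
  "phess D x (v + w) v' = phess D x v v' + phess D x w v'"
  "phess D x v (v' + w') = phess D x v v' + phess D x v w'"
  "phess D x (c *\<^sub>R v) v' = c * phess D x v v'"
  "phess D x v (c *\<^sub>R v') = c * phess D x v v'"
  by (simp_all add: phess_def dd_linear gform_linear algebra_simps)

lemma phess_sum:
  "phess D x (\<Sum>i\<in>I. v i) v' = (\<Sum>i\<in>I. phess D x (v i) v')"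
  "phess D x v' (\<Sum>i\<in>I. v i) = (\<Sum>i\<in>I. phess D x v' (v i))"
  by (simp_all add: phess_def dd_sum gform_sum sum.distrib sum_distrib_left)

lemma gradsq_Dgrad: "gradsq D x = Dgrad D x \<bullet> Dgrad D x"
  by (simp add: gradsq_def Dgrad_def inner_vec_def power2_eq_square)

lemma wfun_sq: "(wfun D x)^2 = 1 + Dgrad D x \<bullet> Dgrad D x"
  by (simp add: wfun_def gradsq_Dgrad)

lemma wfun_ge_1: "wfun D x \<ge> 1"
  unfolding wfun_def gradsq_Dgrad by simp

section \<open>The inverse square root of the induced metric\<close>

lemma gammaM_mult:
  "gammaM D x *v q = q - ((Dgrad D x \<bullet> q) / (wfun D x * (1 + wfun D x))) *\<^sub>R Dgrad D x"
proof (rule vec_eq_iff[THEN iffD2, rule_format])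
  fix i
  have "(gammaM D x *v q) $ i = (\<Sum>j\<in>UNIV. (if i = j then q $ j else 0)
      - D [i] x * (D [j] x * q $ j) / (wfun D x * (1 + wfun D x)))"
    unfolding gammaM_def matrix_vector_mult_def by (auto simp: left_diff_distrib intro!: sum.cong)
  also have "\<dots> = q $ i - D [i] x * (\<Sum>j\<in>UNIV. D [j] x * q $ j) / (wfun D x * (1 + wfun D x))"
    by (simp add: sum_subtractf sum_distrib_left sum_divide_distrib)
  finally show "(gammaM D x *v q) $ i
      = (q - ((Dgrad D x \<bullet> q) / (wfun D x * (1 + wfun D x))) *\<^sub>R Dgrad D x) $ i"
    by (simp add: Dgrad_def inner_vec_def)
qed

lemma gammaM_selfadjoint: "p \<bullet> (gammaM D x *v q) = (gammaM D x *v p) \<bullet> q"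
  by (simp add: gammaM_mult inner_diff_left inner_diff_right inner_commute)

lemma gammaM_Dgrad: "Dgrad D x \<bullet> (gammaM D x *v q) = (Dgrad D x \<bullet> q) / wfun D x"
proof -
  define w where "w = wfun D x"
  have w: "w \<ge> 1" "Dgrad D x \<bullet> Dgrad D x = w^2 - 1" using wfun_ge_1 wfun_sq[of D x] by (auto simp: w_def)
  have "1 - (w^2 - 1) / (w * (1 + w)) = 1 / w"
  proof -
    have "w \<noteq> 0" "1 + w \<noteq> 0" using w(1) by auto
    then have "(w - 1) * (1 + w) / (w * (1 + w)) = 1 - 1 / w" by (simp add: diff_divide_distrib)
    moreover have "w^2 - 1 = (w - 1) * (1 + w)" by (simp add: power2_eq_square algebra_simps)
    ultimately show ?thesis by (simp only:)
  qed
  then have "(Dgrad D x \<bullet> q) * (1 - (w^2 - 1) / (w * (1 + w))) = (Dgrad D x \<bullet> q) / w" by simp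
  then show ?thesis
    unfolding gammaM_mult w_def[symmetric] by (simp add: inner_diff_right w(2) right_diff_distrib diff_divide_distrib)
qed

text \<open>The right-hand side is the inverse of \<open>I + Du \<otimes> Du\<close> applied to
  \<open>q\<close>, because \<open>w^2 = 1 + \<bar>Du\<bar>^2\<close>. Hence \<open>gammaM\<close>
  turns Euclidean orthonormal bases into \<open>gform\<close>-orthonormal frames.\<close>

lemma gammaM_gammaM:
  "gammaM D x *v (gammaM D x *v q) = q - ((Dgrad D x \<bullet> q) / (wfun D x)^2) *\<^sub>R Dgrad D x"
proof -
  define w where "w = wfun D x"
  have w: "w \<ge> 1" using wfun_ge_1 by (auto simp: w_def)
  define c where "c = 1 / (w * (1 + w))"
  have c: "c + c / w = 1 / w^2" 
  proof -
    have nz: "w \<noteq> 0" "1 + w \<noteq> 0" using w by auto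
    have "c + c / w = c * ((1 + w) / w)" using nz(1) by (simp add: field_simps)
    then show ?thesis using nz by (simp add: c_def power2_eq_square)
  qed
  have "gammaM D x *v (gammaM D x *v q) = q - ((Dgrad D x \<bullet> q) * (c + c / w)) *\<^sub>R Dgrad D x"
    unfolding gammaM_mult[of D x "gammaM D x *v q"] gammaM_Dgrad
    unfolding gammaM_mult w_def[symmetric] by (simp add: c_def algebra_simps)
  then show ?thesis unfolding c by (simp add: w_def)
qed

lemma gform_gammaM: "gform D x (gammaM D x *v p) (gammaM D x *v q) = p \<bullet> q"
proof -
  have "(gammaM D x *v p) \<bullet> (gammaM D x *v q) = p \<bullet> q - (Dgrad D x \<bullet> p) * (Dgrad D x \<bullet> q) / (wfun D x)^2"
    by (simp add: gammaM_selfadjoint[symmetric] gammaM_gammaM inner_diff_right inner_commute)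
  then show ?thesis
    by (simp add: gform_def dd_1 inner_commute[of _ "Dgrad D x"] gammaM_Dgrad power2_eq_square)
qed

lemma gammaM_surj: "\<exists>q. gammaM D x *v q = v"
proof -
  define w where "w = wfun D x"
  have w: "w \<ge> 1" "Dgrad D x \<bullet> Dgrad D x = w^2 - 1" using wfun_ge_1 wfun_sq[of D x] by (auto simp: w_def)
  define s where "s = Dgrad D x \<bullet> v"
  \<comment> \<open>The inverse of \<open>gammaM\<close> is
    \<open>I + Du \<otimes> Du / (1 + w)\<close>; this is its rank one coefficient on
    \<open>v\<close>.\<close>
  define r where "r = s / (1 + w)"
  have nz: "w \<noteq> 0" "1 + w \<noteq> 0" using w(1) by auto
  then have rs: "r * (1 + w) = s" by (simp add: r_def)
  have "Dgrad D x \<bullet> (v + r *\<^sub>R Dgrad D x) = s + r * (w^2 - 1)"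
    by (simp add: inner_add_right w(2) s_def)
  also have "\<dots> = r * (w * (1 + w))"
    unfolding rs[symmetric] by (simp add: algebra_simps power2_eq_square)
  finally have "(Dgrad D x \<bullet> (v + r *\<^sub>R Dgrad D x)) / (w * (1 + w)) = r" using nz by simp
  then have "gammaM D x *v (v + r *\<^sub>R Dgrad D x) = v"
    unfolding gammaM_mult w_def[symmetric] by simp
  then show ?thesis by blast
qed

text \<open>Since \<open>gform\<close> pulled back by \<open>gammaM\<close> is the Euclidean inner
  product, the term \<open>nu_last\<close> times the identity is also a conjugate by
  \<open>gammaM\<close>, with the same factor \<open>1 / w\<close> as the Hessian term; the two add
  up to \<open>phess\<close>.\<close>

lemma hyp_shape_form:
  "p \<bullet> (hyp_shape D x *v q) = phess D x (gammaM D x *v p) (gammaM D x *v q) / wfun D x"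
proof -
  have "hyp_shape D x *v q = (D [] x / wfun D x) *\<^sub>R (gammaM D x *v (hessM D x *v (gammaM D x *v q)))
      + (1 / wfun D x) *\<^sub>R q"
    unfolding hyp_shape_def eucl_shape_def nu_last_def
    by (simp add: matrix_vector_mult_add_rdistrib scaleR_matrix_vector_assoc[symmetric] matrix_vector_mul_assoc[symmetric])
  then show ?thesis
    by (simp add: inner_add_right gammaM_selfadjoint phess_def dd_2 gform_gammaM add_divide_distrib)
qed

text \<open>Symmetry of the second derivatives is a hypothesis so that boundary points are covered,
  where it comes from continuity.\<close>

lemma hyp_shape_symmetric:
  assumes "\<And>i j. D [i, j] x = D [j, i] x"
  shows "transpose (hyp_shape D x) = hyp_shape D x"
proof -
  have "dd [v, v'] D x = dd [v', v] D x" for v v'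
  proof -
    have "(\<Sum>i\<in>UNIV. \<Sum>j\<in>UNIV. v $ i * (v' $ j * D [i, j] x)) = (\<Sum>i\<in>UNIV. \<Sum>j\<in>UNIV. v' $ i * (v $ j * D [i, j] x))"
      by (subst sum.swap, intro sum.cong refl) (simp add: assms mult.left_commute)
    then show ?thesis by (simp add: dd.simps sum_distrib_left)
  qed
  then have "p \<bullet> (hyp_shape D x *v q) = q \<bullet> (hyp_shape D x *v p)" for p q
    by (simp add: hyp_shape_form phess_def gform_commute)
  from this[of "axis _ 1" "axis _ 1"] show ?thesis
    by (simp add: vec_eq_iff transpose_def inner_axis' matrix_vector_mult_basis column_def)
qed

lemma principal_curvatures_eigenbasis:
  fixes e :: "'n \<Rightarrow> real^'n"
  assumes e: "\<And>i j. e i \<bullet> e j = (if i = j then 1 else 0)"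
    and l: "\<And>i. hyp_shape D x *v e i = l i *\<^sub>R e i"
  shows "principal_curvatures D x (\<chi> i. l i)"
  unfolding principal_curvatures_def
proof (intro exI[of _ "\<chi> i j. e j $ i"] conjI orthonormal_columns(1)[OF e])
  have "hyp_shape D x $ i $ j = axis i 1 \<bullet> (hyp_shape D x *v axis j 1)" for i j
    by (simp add: inner_axis' matrix_vector_mult_basis column_def)
  then have "hyp_shape D x $ i $ j = (\<Sum>k\<in>UNIV. l k * e k $ i * e k $ j)" for i j
    by (simp add: eigenbasis_quadratic_form[OF e l] inner_axis)
  then show "hyp_shape D x = (\<chi> i j. e j $ i) ** (\<chi> i j. if i = j then (\<chi> i. l i) $ i else 0) ** transpose (\<chi> i j. e j $ i)"
    by (simp add: vec_eq_iff matrix_matrix_mult_def transpose_def if_distrib mult.commute cong: if_cong)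
qed

lemma kappa_max_eigenbasis:
  fixes e :: "'n \<Rightarrow> real^'n"
  assumes e: "\<And>i j. e i \<bullet> e j = (if i = j then 1 else 0)"
    and l: "\<And>i. hyp_shape D x *v e i = l i *\<^sub>R e i"
  shows "kappa_max D x = Max (range l)"
    and "v \<bullet> (hyp_shape D x *v v) \<le> kappa_max D x * (v \<bullet> v)"
proof -
  have "{c. \<exists>v. v \<noteq> 0 \<and> hyp_shape D x *v v = c *\<^sub>R v} = range l"
  proof (intro equalityI subsetI)
    fix c assume "c \<in> range l"
    then obtain i where "c = l i" by blast
    moreover have "e i \<noteq> 0" using e[of i i] by auto
    ultimately show "c \<in> {c. \<exists>v. v \<noteq> 0 \<and> hyp_shape D x *v v = c *\<^sub>R v}" using l by blast
  next
    fix c assume "c \<in> {c. \<exists>v. v \<noteq> 0 \<and> hyp_shape D x *v v = c *\<^sub>R v}"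
    then obtain v where v: "v \<noteq> 0" "hyp_shape D x *v v = c *\<^sub>R v" by blast
    obtain i where i: "e i \<bullet> v \<noteq> 0"
      using v(1) orthonormal_expansion[OF e, of v] by (metis (no_types, lifting) scale_zero_left sum.neutral)
    have "c * (e i \<bullet> v) = e i \<bullet> (hyp_shape D x *v v)" using v(2) by simp
    also have "\<dots> = l i * (e i \<bullet> v)"
      unfolding eigenbasis_quadratic_form[OF e l] by (simp add: e if_distrib[of "\<lambda>a. a * _"] if_distrib[of "\<lambda>a. _ * a"] cong: if_cong)
    finally show "c \<in> range l" using i by auto
  qed
  then show max: "kappa_max D x = Max (range l)" by (simp add: kappa_max_def)
  have "v \<bullet> (hyp_shape D x *v v) = (\<Sum>k\<in>UNIV. l k * (e k \<bullet> v)^2)"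
    by (simp add: eigenbasis_quadratic_form[OF e l] power2_eq_square mult.assoc)
  also have "\<dots> \<le> (\<Sum>k\<in>UNIV. kappa_max D x * (e k \<bullet> v)^2)"
    by (intro sum_mono mult_right_mono) (auto simp: max)
  also have "\<dots> = kappa_max D x * (v \<bullet> v)"
    using eigenbasis_quadratic_form[OF e, of "mat 1" "\<lambda>_. 1" v v]
    by (simp add: sum_distrib_left power2_eq_square)
  finally show "v \<bullet> (hyp_shape D x *v v) \<le> kappa_max D x * (v \<bullet> v)" .
qed

text \<open>\<open>F\<close> is the image under \<open>gammaM\<close> of an orthonormal basis
  \<open>q\<close>, and the squared inner products of two orthonormal bases form a doubly stochastic
  matrix. The weights \<open>g\<close> are not tied to \<open>x\<close>: taken from one point, they
  give an inequality at every other point.\<close>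

lemma curvature_frame_inequality:
  fixes f :: "real^'n \<Rightarrow> real"
  assumes f: "symmetric_fun f" and g: "\<And>l. l \<in> Kplus \<Longrightarrow> f l \<le> (\<Sum>i\<in>UNIV. g i * l $ i)"
    and sym: "\<And>i j. D [i, j] x = D [j, i] x"
    and pc: "\<And>\<kappa>. principal_curvatures D x \<kappa> \<Longrightarrow> \<kappa> \<in> Kplus \<and> f \<kappa> = \<sigma>"
    and F: "\<And>i j. gform D x (F i) (F j) = (if i = j then 1 else 0)"
  shows "\<sigma> * wfun D x \<le> (\<Sum>i\<in>UNIV. g i * phess D x (F i) (F i))"
proof -
  obtain e l where e: "\<And>i j. e i \<bullet> e j = (if i = j then 1 else 0)"
    and l: "\<And>i::'n. hyp_shape D x *v e i = l i *\<^sub>R (e i :: real^'n)"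
    using symmetric_matrix_eigenbasis[OF hyp_shape_symmetric[of D x, OF sym]] by blast
  have "\<forall>i. \<exists>q. gammaM D x *v q = F i" using gammaM_surj by blast
  then obtain q where q: "\<And>i. gammaM D x *v q i = F i" unfolding choice_iff by blast
  have qq: "q i \<bullet> q j = (if i = j then 1 else 0)" for i j
    using F[of i j] gform_gammaM[of D x "q i" "q j"] by (simp add: q)
  have parseval: "(\<Sum>k\<in>UNIV. (r k \<bullet> v)^2) = v \<bullet> v" if "\<And>i j. r i \<bullet> r j = (if i = j then 1 else 0)"
    for r :: "'n \<Rightarrow> real^'n" and v
    using eigenbasis_quadratic_form[OF that, of "mat 1" "\<lambda>_. 1" v v] by (simp add: power2_eq_square)
  have k: "(\<chi> i. l i) \<in> Kplus" "f (\<chi> i. l i) = \<sigma>"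
    using pc[OF principal_curvatures_eigenbasis[OF e l]] by auto
  have "f (\<chi> i. l i) \<le> (\<Sum>i\<in>UNIV. \<Sum>j\<in>UNIV. (e j \<bullet> q i)^2 * g i * (\<chi> i. l i) $ j)"
  proof (rule symmetric_supergradient_doubly_stochastic[OF f g k(1)])
    show "(\<Sum>j\<in>UNIV. (e j \<bullet> q i)^2) = 1" for i by (simp add: parseval[OF e] qq)
    show "(\<Sum>i\<in>UNIV. (e j \<bullet> q i)^2) = 1" for j
      using parseval[OF qq, of "e j"] by (simp add: e inner_commute)
  qed auto
  then have "\<sigma> \<le> (\<Sum>i\<in>UNIV. g i * (q i \<bullet> (hyp_shape D x *v q i)))"
    by (simp add: k(2) eigenbasis_quadratic_form[OF e l] sum_distrib_left power2_eq_square mult_ac)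
  also have "\<dots> = (\<Sum>i\<in>UNIV. g i * phess D x (F i) (F i)) / wfun D x"
    by (simp add: hyp_shape_form q sum_divide_distrib)
  finally show ?thesis
    using wfun_ge_1[of D x] by (simp add: pos_le_divide_eq)
qed

subsection \<open>Tests along principal directions\<close>

lemma eventually_line_in_open:
  fixes x \<xi> :: "real^'n"
  assumes "open S" "x \<in> S"
  shows "eventually (\<lambda>t. x + t *\<^sub>R \<xi> \<in> S) (at (0::real))"
proof -
  have "((\<lambda>t. x + t *\<^sub>R \<xi>) \<longlongrightarrow> x + 0 *\<^sub>R \<xi>) (at (0::real))"
    by (intro tendsto_intros)
  then show ?thesis using assms by (auto intro!: topological_tendstoD)
qed

context
  fixes \<Omega> T :: "(real^'n) set" and D x
  assumes D: "smooth_family \<Omega> T D" and x: "x \<in> \<Omega>"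
begin

lemma jet2_dd1:
  "jet2 (\<lambda>t. dd [v + t *\<^sub>R z] D (x + t *\<^sub>R \<xi>)) (dd [v] D x) (dd [\<xi>, v] D x + dd [z] D x)
     (dd [\<xi>, \<xi>, v] D x / 2 + dd [\<xi>, z] D x)"
proof -
  have "jet2 (\<lambda>t. dd [v] D (x + t *\<^sub>R \<xi>) + t * dd [z] D (x + t *\<^sub>R \<xi>)) (dd [v] D x) (dd [\<xi>, v] D x + dd [z] D x)
     (dd [\<xi>, \<xi>, v] D x / 2 + dd [\<xi>, z] D x)"
    by (rule jet2_cong[OF jet2_add[OF jet2_dd_line[OF D x] jet2_mult[OF jet2_ident jet2_dd_line[OF D x]]]]) auto
  then show ?thesis by (simp add: dd_linear)
qed

lemma jet2_dd2:
  "jet2 (\<lambda>t. dd [v + t *\<^sub>R z, v' + t *\<^sub>R z'] D (x + t *\<^sub>R \<xi>)) (dd [v, v'] D x)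
     (dd [\<xi>, v, v'] D x + dd [z, v'] D x + dd [v, z'] D x)
     (dd [\<xi>, \<xi>, v, v'] D x / 2 + dd [\<xi>, z, v'] D x + dd [\<xi>, v, z'] D x + dd [z, z'] D x)"
proof -

  have "jet2 (\<lambda>t. (dd [v, v'] D (x + t *\<^sub>R \<xi>) + t * dd [z, v'] D (x + t *\<^sub>R \<xi>))
        + t * (dd [v, z'] D (x + t *\<^sub>R \<xi>) + t * dd [z, z'] D (x + t *\<^sub>R \<xi>)))
     (dd [v, v'] D x)
     (dd [\<xi>, v, v'] D x + dd [z, v'] D x + dd [v, z'] D x)
     (dd [\<xi>, \<xi>, v, v'] D x / 2 + dd [\<xi>, z, v'] D x + dd [\<xi>, v, z'] D x + dd [z, z'] D x)"
    by (rule jet2_cong[OF jet2_add[OF jet2_add[OF jet2_dd_line[OF D x] jet2_mult[OF jet2_ident jet2_dd_line[OF D x]]]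
          jet2_mult[OF jet2_ident jet2_add[OF jet2_dd_line[OF D x] jet2_mult[OF jet2_ident jet2_dd_line[OF D x]]]]]]) auto
  then show ?thesis by (simp add: dd_linear algebra_simps)
qed

lemma jet2_inner: "jet2 (\<lambda>t. (v + t *\<^sub>R z) \<bullet> (v' + t *\<^sub>R z')) (v \<bullet> v') (v \<bullet> z' + z \<bullet> v') (z \<bullet> z')"
  by (simp add: jet2_def inner_add_left inner_add_right algebra_simps power2_eq_square)

lemma jet2_gform:
  "jet2 (\<lambda>t. gform D (x + t *\<^sub>R \<xi>) (v + t *\<^sub>R z) (v' + t *\<^sub>R z')) (gform D x v v')
     (v \<bullet> z' + z \<bullet> v' + (dd [v] D x * (dd [\<xi>, v'] D x + dd [z'] D x) + (dd [\<xi>, v] D x + dd [z] D x) * dd [v'] D x))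
     (z \<bullet> z' + (dd [v] D x * (dd [\<xi>, \<xi>, v'] D x / 2 + dd [\<xi>, z'] D x)
        + (dd [\<xi>, v] D x + dd [z] D x) * (dd [\<xi>, v'] D x + dd [z'] D x)
        + (dd [\<xi>, \<xi>, v] D x / 2 + dd [\<xi>, z] D x) * dd [v'] D x))"
  unfolding gform_def by (rule jet2_cong[OF jet2_add[OF jet2_inner jet2_mult[OF jet2_dd1 jet2_dd1]]]) auto

lemma jet2_phess:
  assumes "jet2 (\<lambda>t. gform D (x + t *\<^sub>R \<xi>) (v + t *\<^sub>R z) (v' + t *\<^sub>R z')) g0 g1 g2"
  shows "jet2 (\<lambda>t. phess D (x + t *\<^sub>R \<xi>) (v + t *\<^sub>R z) (v' + t *\<^sub>R z'))
     (D [] x * dd [v, v'] D x + g0)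
     (D [] x * (dd [\<xi>, v, v'] D x + dd [z, v'] D x + dd [v, z'] D x) + dd [\<xi>] D x * dd [v, v'] D x + g1)
     (D [] x * (dd [\<xi>, \<xi>, v, v'] D x / 2 + dd [\<xi>, z, v'] D x + dd [\<xi>, v, z'] D x + dd [z, z'] D x)
       + dd [\<xi>] D x * (dd [\<xi>, v, v'] D x + dd [z, v'] D x + dd [v, z'] D x)
       + dd [\<xi>, \<xi>] D x / 2 * dd [v, v'] D x + g2)"
proof -
  have "jet2 (\<lambda>t. D [] (x + t *\<^sub>R \<xi>)) (D [] x) (dd [\<xi>] D x) (dd [\<xi>, \<xi>] D x / 2)"
    using jet2_dd_line[OF D x, of "[]" \<xi>] by (simp add: dd.simps(1))
  from jet2_add[OF jet2_mult[OF this jet2_dd2] assms] show ?thesis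
    unfolding phess_def by (rule jet2_cong) auto
qed

lemma dd_commute:
  "dd (v # w # vs) D x = dd (w # v # vs) D x" "dd (u # v # w # vs) D x = dd (u # w # v # vs) D x"
  "dd (u' # u # v # w # vs) D x = dd (u' # u # w # v # vs) D x"
proof -
  have sw: "dd (us @ v # w # vs) D x = dd (us @ w # v # vs) D x" for us
    by (rule dd_swap) (rule smooth_family_swap[OF D x])
  from sw[of "[]"] sw[of "[u]"] sw[of "[u', u]"] show
  "dd (v # w # vs) D x = dd (w # v # vs) D x" "dd (u # v # w # vs) D x = dd (u # w # v # vs) D x"
  "dd (u' # u # v # w # vs) D x = dd (u' # u # w # v # vs) D x" by simp_all
qed

end

section \<open>Frames adapted to one point\<close>

lemma perturbed_identity_quadratic:
  fixes \<Delta> :: "'n::finite \<Rightarrow> real"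
  shows "(\<Sum>l\<in>UNIV. \<Sum>j\<in>UNIV. ((if l = i then 1 else 0) + \<Delta> l) * ((if j = i then 1 else 0) + \<Delta> j) * B l j)
    = B i i + (\<Sum>l\<in>UNIV. \<Delta> l * (B i l + B l i)) + (\<Sum>l\<in>UNIV. \<Sum>j\<in>UNIV. \<Delta> l * \<Delta> j * B l j)"
proof -
  have "((if l = i then 1 else 0) + \<Delta> l) * ((if j = i then 1 else 0) + \<Delta> j) * B l j
      = (if l = i then (if j = i then B i i else 0) else 0) + (if l = i then \<Delta> j * B i j else 0)
        + (if j = i then \<Delta> l * B l i else 0) + \<Delta> l * \<Delta> j * B l j" for l j
    by (auto simp: algebra_simps)
  moreover have "(\<Sum>l\<in>UNIV. \<Sum>j\<in>UNIV. if l = i then \<Delta> j * B i j else 0) = (\<Sum>j\<in>UNIV. \<Delta> j * B i j)"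
    by (subst sum.swap) simp
  moreover have "(\<Sum>l\<in>UNIV. \<Sum>j\<in>UNIV. if l = i then (if j = i then B i i else 0) else 0) = B i i"
    by (subst sum.swap) simp
  ultimately show ?thesis
    by (simp add: sum.distrib distrib_left)
qed

text \<open>\<open>E\<close> is a principal frame at \<open>x0\<close> and \<open>k i\<close> is
  \<open>w\<close> times the \<open>i\<close>-th hyperbolic principal curvature. The assumption
  \<open>complete\<close> says that the sum of \<open>E j \<otimes> E j\<close> is the inverse of
  the metric at \<open>x0\<close>; it recovers Euclidean quantities at nearby points from
  derivatives in frame directions.\<close>

locale adapted_frame =
  fixes \<Omega> T :: "(real^'n) set" and D x0 and E :: "'n \<Rightarrow> real^'n" and k :: "'n \<Rightarrow> real"
  assumes smooth: "smooth_family \<Omega> T D" and x0: "x0 \<in> \<Omega>"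
    and orth: "\<And>i j. gform D x0 (E i) (E j) = (if i = j then 1 else 0)"
    and diag: "\<And>i j. phess D x0 (E i) (E j) = (if i = j then k i else 0)"
    and complete: "\<And>q. q = (\<Sum>j\<in>UNIV. (q \<bullet> E j) *\<^sub>R E j)
        + ((Dgrad D x0 \<bullet> q) / (wfun D x0)^2) *\<^sub>R Dgrad D x0"
    and u_pos: "D [] x0 > 0"
begin

abbreviation "b \<equiv> D [] x0"
abbreviation "w \<equiv> wfun D x0"
abbreviation "p i \<equiv> dd [E i] D x0"
abbreviation "t3 i j l \<equiv> dd [E i, E j, E l] D x0"
text \<open>The eigenvalue of the Hessian of \<open>u\<close> relative to the induced metric,
  because \<open>phess\<close> is \<open>b\<close> times that Hessian plus
  \<open>gform\<close>.\<close>

definition "h i = (k i - 1) / b"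

lemma w_pos: "w > 0"
  using wfun_ge_1[of D x0] by simp

lemma dd_frame: "dd [E i, E j] D x0 = (if i = j then h i else 0)"
  using diag[of i j] orth[of i j] u_pos by (auto simp: phess_def h_def field_simps split: if_splits)

lemma k_eq: "k i = b * h i + 1"
  using u_pos by (simp add: h_def)

lemma inner_frame: "E i \<bullet> E j = (if i = j then 1 else 0) - p i * p j"
  using orth[of i j] by (simp add: gform_def)

lemma Dgrad_inner: "Dgrad D x0 \<bullet> q = w^2 * (\<Sum>j\<in>UNIV. p j * (q \<bullet> E j))"
proof -
  let ?z = "Dgrad D x0"
  define Y where "Y = ?z \<bullet> q"
  define s where "s = (\<Sum>j\<in>UNIV. (?z \<bullet> E j) * (E j \<bullet> q))"
  define W where "W = w^2"
  have W: "W \<noteq> 0" "?z \<bullet> ?z = W - 1" using w_pos wfun_sq[of D x0] by (auto simp: W_def)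
  \<comment> \<open>Expanding the gradient by \<open>complete\<close> reproduces the gradient on the
    right; solving this linear equation for \<open>Y\<close> yields the factor
    \<open>w^2\<close>.\<close>
  have "Y = s + (W - 1) / W * Y"
    using arg_cong[OF complete[of ?z], of "\<lambda>v. v \<bullet> q"]
    by (simp add: inner_add_left inner_sum_left Y_def s_def W(2) W_def[symmetric])
  then have "W * Y = W * (s + (W - 1) / W * Y)" by simp
  also have "\<dots> = W * s + (W - 1) * Y" using W(1) by (simp add: distrib_left)
  finally have "Y = W * s" by (simp add: algebra_simps)
  then show ?thesis by (simp add: Y_def s_def W_def dd_1 inner_commute)
qed

text \<open>The derivatives are taken at \<open>x\<close>, the frame at \<open>x0\<close>. The sum
  of squares misses the part of \<open>Du(x)\<close> along \<open>Du(x0)\<close> in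
  \<open>complete\<close>, which the last term restores.\<close>

lemma gradsq_frame: "gradsq D x = (\<Sum>j\<in>UNIV. (dd [E j] D x)^2) + w^2 * (\<Sum>j\<in>UNIV. p j * dd [E j] D x)^2"
proof -
  let ?q = "Dgrad D x"
  have "?q \<bullet> ?q = (\<Sum>j\<in>UNIV. (?q \<bullet> E j)^2) + (Dgrad D x0 \<bullet> ?q)^2 / w^2"
    using arg_cong[OF complete[of ?q], of "\<lambda>v. ?q \<bullet> v"]
    by (simp add: inner_add_right inner_sum_right inner_commute[of ?q "Dgrad D x0"] power2_eq_square)
  also have "(Dgrad D x0 \<bullet> ?q)^2 / w^2 = w^2 * (\<Sum>j\<in>UNIV. p j * (?q \<bullet> E j))^2"
    unfolding Dgrad_inner using w_pos by (simp add: power_mult_distrib power2_eq_square)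
  finally show ?thesis by (simp add: gradsq_Dgrad dd_1 inner_commute)
qed

lemma sum_p_sq: "w^2 * (\<Sum>j\<in>UNIV. (p j)^2) = w^2 - 1"
  using Dgrad_inner[of "Dgrad D x0"] wfun_sq[of D x0] by (simp add: dd_1 inner_commute power2_eq_square)

text \<open>Expand \<open>1 + gradsq\<close> in the frame and take the root; the terms with
  \<open>(p i * h i)^2\<close> cancel between the two parts of the second order coefficient of the
  root.\<close>

lemma jet2_wfun:
  "jet2 (\<lambda>t. wfun D (x0 + t *\<^sub>R E i)) w (w * p i * h i)
     (((h i)^2 / w + w * (\<Sum>j\<in>UNIV. p j * t3 i i j)) / 2)"
proof -
  let ?A = "\<Sum>j\<in>UNIV. p j * t3 i i j" and ?q = "\<Sum>j\<in>UNIV. (p j)^2"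
  have U: "jet2 (\<lambda>t. dd [E j] D (x0 + t *\<^sub>R E i)) (p j) (if i = j then h i else 0) (t3 i i j / 2)" for j
    by (rule jet2_cong[OF jet2_dd_line[OF smooth x0]]) (simp_all add: dd_frame)
  have 1: "jet2 (\<lambda>t. \<Sum>j\<in>UNIV. (dd [E j] D (x0 + t *\<^sub>R E i))^2) ?q (2 * p i * h i) (?A + (h i)^2)"
    by (rule jet2_cong[OF jet2_sum[OF jet2_power2[OF U]]])
      (simp_all add: sum.distrib sum_distrib_left[symmetric] if_distrib[of "\<lambda>x. _ * x"] if_distrib[of "\<lambda>x. x^2"] cong: if_cong)
  have 2: "jet2 (\<lambda>t. \<Sum>j\<in>UNIV. p j * dd [E j] D (x0 + t *\<^sub>R E i)) ?q (p i * h i) (?A / 2)"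
    by (rule jet2_cong[OF jet2_sum[OF jet2_cmult[OF U]]])
      (simp_all add: if_distrib power2_eq_square sum_divide_distrib cong: if_cong)
  have q: "w^2 * ?q = w^2 - 1" by (rule sum_p_sq)
  have "jet2 (\<lambda>t. 1 + gradsq D (x0 + t *\<^sub>R E i)) (w^2) (2 * w^2 * (p i * h i))
      (w^2 * ?A + (h i)^2 + w^2 * (p i * h i)^2)"
    unfolding gradsq_frame
  proof (rule jet2_cong[OF jet2_add[OF jet2_const jet2_add[OF 1 jet2_cmult[OF jet2_power2[OF 2]]]]], goal_cases)
    case 1
    have "w^2 * ?q^2 = (w^2 * ?q) * ?q" by (simp add: power2_eq_square)
    also have "\<dots> = (w^2 - 1) * ?q" by (simp only: q)
    also have "\<dots> = w^2 * ?q - ?q" by (simp add: left_diff_distrib)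
    finally show ?case using q by linarith
  next
    case 2
    have "w^2 * (2 * ?q * (p i * h i)) = 2 * (w^2 * ?q) * (p i * h i)" by simp
    then show ?case unfolding q by (simp add: algebra_simps)
  next
    case 3
    have "w^2 * (2 * ?q * (?A / 2) + (p i * h i)^2) = (w^2 * ?q) * ?A + w^2 * (p i * h i)^2"
      by (simp add: algebra_simps)
    then show ?case unfolding q by (simp add: algebra_simps)
  qed
  then have "jet2 (\<lambda>t. sqrt (1 + gradsq D (x0 + t *\<^sub>R E i))) w (2 * w^2 * (p i * h i) / (2 * w))
      ((w^2 * ?A + (h i)^2 + w^2 * (p i * h i)^2) / (2 * w) - (2 * w^2 * (p i * h i))^2 / (8 * w^3))"
    using w_pos by (rule jet2_sqrt)
  then show ?thesis
    unfolding wfun_def[symmetric]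
  proof (rule jet2_cong, goal_cases)
    case 2
    then show ?case using w_pos by (simp add: power2_eq_square)
  next
    case 3
    have "(2 * w^2 * (p i * h i))^2 / (8 * w^3) = w * (p i * h i)^2 / 2"
      using w_pos by (simp add: eval_nat_numeral)
    moreover have "(w^2 * ?A + (h i)^2 + w^2 * (p i * h i)^2) / (2 * w) = (w * ?A + (h i)^2 / w + w * (p i * h i)^2) / 2"
      using w_pos by (simp add: power2_eq_square add_divide_distrib)
    ultimately show ?case by (simp add: algebra_simps)
  qed simp
qed

text \<open>The frames \<open>E i + t *\<^sub>R \<zeta> i\<close> are orthonormal only up to \<open>O(t\<^sup>2)\<close>. Multiplying by the inverse square
  root of their Gram matrix makes them orthonormal, and since the tested expression is stationary in the
  frame at \<open>t = 0\<close>, this changes it by \<open>O(t\<^sup>3)\<close> only.\<close>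

lemma frame_test:
  fixes g :: "'n \<Rightarrow> real" and \<xi> :: "real^'n" and \<zeta> :: "'n \<Rightarrow> real^'n"
  assumes ineq: "\<And>x F. x \<in> \<Omega> \<Longrightarrow> (\<And>i j. gform D x (F i) (F j) = (if i = j then 1 else 0)) \<Longrightarrow>
      \<sigma> * wfun D x \<le> (\<Sum>i\<in>UNIV. g i * phess D x (F i) (F i))"
    and eq: "(\<Sum>i\<in>UNIV. g i * k i) = \<sigma> * w"
    and tangent: "\<And>i j. E i \<bullet> \<zeta> j + \<zeta> i \<bullet> E j + (p i * (dd [\<xi>, E j] D x0 + dd [\<zeta> j] D x0)
        + (dd [\<xi>, E i] D x0 + dd [\<zeta> i] D x0) * p j) = 0"
  shows "\<exists>R\<in>o[at 0](\<lambda>t. t^2). eventually (\<lambda>t. R t \<le>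
     (\<Sum>i\<in>UNIV. g i * (phess D (x0 + t *\<^sub>R \<xi>) (E i + t *\<^sub>R \<zeta> i) (E i + t *\<^sub>R \<zeta> i)
         - k i * gform D (x0 + t *\<^sub>R \<xi>) (E i + t *\<^sub>R \<zeta> i) (E i + t *\<^sub>R \<zeta> i)))
       - \<sigma> * (wfun D (x0 + t *\<^sub>R \<xi>) - w)) (at 0)"
proof -
  define F where "F t i = E i + t *\<^sub>R \<zeta> i" for t i
  define X where "X t = x0 + t *\<^sub>R \<xi>" for t
  define G where "G t i j = gform D (X t) (F t i) (F t j)" for t i j
  define B where "B t i j l = phess D (X t) (F t j) (F t l) - k i * gform D (X t) (F t j) (F t l)" for t i j l
  \<comment> \<open>The total deviation of the Gram matrix from the identity; \<open>tangent\<close>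
    makes it \<open>O(t^2)\<close>.\<close>
  define d where "d t = (\<Sum>i\<in>UNIV. \<Sum>j\<in>UNIV. \<bar>G t i j - (if i = j then 1 else 0)\<bar>)" for t
  define n where "n = real CARD('n)"
  have n: "n \<ge> 0" by (simp add: n_def)
  have G2: "(\<lambda>t. G t i j - (if i = j then 1 else 0)) \<in> O[at 0](\<lambda>t. t^2)" for i j
    unfolding G_def X_def F_def
    by (rule jet2_bigo(3)[OF jet2_diff[OF jet2_gform[OF smooth x0] jet2_const]])
      (use tangent in \<open>simp_all add: orth\<close>)
  have dO: "d \<in> O[at 0](\<lambda>t. t^2)"
    unfolding d_def using G2 by (intro big_sum_in_bigo) simp
  have BO: "(\<lambda>t. B t i j l) \<in> O[at 0](\<lambda>t. 1)" for i j l
    unfolding B_def X_def F_def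
    by (rule jet2_bigo(1)[OF jet2_diff[OF jet2_phess[OF smooth x0 jet2_gform[OF smooth x0]] jet2_cmult[OF jet2_gform[OF smooth x0]]]])
  \<comment> \<open>At \<open>t = 0\<close> the form \<open>phess - k i * gform\<close> annihilates
    \<open>E i\<close>, so its entries in row or column \<open>i\<close> have no constant term. This
    is the stationarity that makes the frame correction harmless.\<close>
  have B1: "(\<lambda>t. B t i j l) \<in> O[at 0](\<lambda>t. t)" if "i = j \<or> i = l" for i j l
    unfolding B_def X_def F_def
    by (rule jet2_bigo(2)[OF jet2_diff[OF jet2_phess[OF smooth x0 jet2_gform[OF smooth x0]] jet2_cmult[OF jet2_gform[OF smooth x0]]]])
      (use that in \<open>auto simp: orth dd_frame k_eq\<close>)
  \<comment> \<open>Contributions linear in the correction are \<open>O(t^2)\<close> times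
    \<open>O(t)\<close>, quadratic ones \<open>O(t^4)\<close> times \<open>O(1)\<close>; both are
    \<open>o(t^2)\<close>.\<close>
  define R where "R t = - (\<Sum>i\<in>UNIV. \<bar>g i\<bar> * ((\<Sum>l\<in>UNIV. n^3 * d t * (\<bar>B t i i l\<bar> + \<bar>B t i l i\<bar>))
      + (\<Sum>l\<in>UNIV. \<Sum>j\<in>UNIV. (n^3 * d t) * (n^3 * d t) * \<bar>B t i l j\<bar>)))" for t
  have nd: "(\<lambda>t. n^3 * d t) \<in> O[at 0](\<lambda>t. t^2)" using dO by (cases "n = 0") auto
  have R1: "(\<lambda>t. n^3 * d t * (\<bar>B t i i l\<bar> + \<bar>B t i l i\<bar>)) \<in> o[at 0](\<lambda>t. t^2)" for i l
  proof -
    have "(\<lambda>t. \<bar>B t i i l\<bar> + \<bar>B t i l i\<bar>) \<in> O[at 0](\<lambda>t. t)"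
      by (intro sum_in_bigo) (simp_all add: B1)
    from landau_o.big_mult[OF nd this]
    have "(\<lambda>t. n^3 * d t * (\<bar>B t i i l\<bar> + \<bar>B t i l i\<bar>)) \<in> O[at 0](\<lambda>t. t^3)"
      by (simp add: eval_nat_numeral mult_ac)
    then show ?thesis by (rule landau_o.big_small_trans) (rule powers_smallo)
  qed
  have R2: "(\<lambda>t. (n^3 * d t) * (n^3 * d t) * \<bar>B t i l j\<bar>) \<in> o[at 0](\<lambda>t. t^2)" for i l j
  proof -
    have "(\<lambda>t. \<bar>B t i l j\<bar>) \<in> O[at 0](\<lambda>t. 1)" by (simp add: BO)
    from landau_o.big_mult[OF landau_o.big_mult[OF nd nd] this]
    have "(\<lambda>t. (n^3 * d t) * (n^3 * d t) * \<bar>B t i l j\<bar>) \<in> O[at 0](\<lambda>t. t^4)"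
      by (simp add: eval_nat_numeral mult_ac)
    then show ?thesis by (rule landau_o.big_small_trans) (rule powers_smallo)
  qed
  have Ro: "R \<in> o[at 0](\<lambda>t. t^2)"
  proof -
    have "(\<lambda>t. \<Sum>l\<in>UNIV. n^3 * d t * (\<bar>B t i i l\<bar> + \<bar>B t i l i\<bar>)) \<in> o[at 0](\<lambda>t. t^2)"
      "(\<lambda>t. \<Sum>l\<in>UNIV. \<Sum>j\<in>UNIV. (n^3 * d t) * (n^3 * d t) * \<bar>B t i l j\<bar>) \<in> o[at 0](\<lambda>t. t^2)" for i
      by (intro big_sum_in_smallo R1 R2)+
    note sum_in_smallo(1)[OF this]
    then have "(\<lambda>t. \<bar>g i\<bar> * ((\<Sum>l\<in>UNIV. n^3 * d t * (\<bar>B t i i l\<bar> + \<bar>B t i l i\<bar>))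
      + (\<Sum>l\<in>UNIV. \<Sum>j\<in>UNIV. (n^3 * d t) * (n^3 * d t) * \<bar>B t i l j\<bar>))) \<in> o[at 0](\<lambda>t. t^2)" for i
      by (cases "g i = 0") auto
    then show ?thesis unfolding R_def by (simp add: big_sum_in_smallo)
  qed
  have "open \<Omega>" using smooth by (simp add: smooth_family_def)
  then have ev1: "eventually (\<lambda>t. X t \<in> \<Omega>) (at 0)"
    unfolding X_def using x0 by (rule eventually_line_in_open)
  have "(\<lambda>t::real. t^2) \<in> o[at 0](\<lambda>t. 1)"
    by (rule smalloI_tendsto) (auto intro!: tendsto_eq_intros)
  from landau_o.big_small_trans[OF dO this] have "(d \<longlongrightarrow> 0) (at 0)"
    by (auto dest: smalloD_tendsto)
  then have "((\<lambda>t. n^2 * d t) \<longlongrightarrow> n^2 * 0) (at 0)" by (intro tendsto_intros)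
  then have ev2: "eventually (\<lambda>t. n^2 * d t < 1 / 2) (at 0)"
    by (intro order_tendstoD(2)[of _ "n^2 * 0"]) auto
  have "eventually (\<lambda>t. R t \<le> (\<Sum>i\<in>UNIV. g i * B t i i i) - \<sigma> * (wfun D (X t) - w)) (at 0)"
    using ev1 ev2
  proof eventually_elim
    case (elim t)
    have "\<bar>G t i j - (if i = j then 1 else 0)\<bar> \<le> d t" for i j
    proof -
      have "\<bar>G t i j - (if i = j then 1 else 0)\<bar> \<le> (\<Sum>j\<in>UNIV. \<bar>G t i j - (if i = j then 1 else 0)\<bar>)"
        by (rule member_le_sum) auto
      also have "\<dots> \<le> d t" unfolding d_def
        by (rule member_le_sum[of i UNIV "\<lambda>i. \<Sum>j\<in>UNIV. \<bar>G t i j - (if i = j then 1 else 0)\<bar>"]) (auto intro: sum_nonneg)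
      finally show ?thesis .
    qed
    then obtain S :: "real^'n^'n"
      where S: "\<And>i j. (\<Sum>m\<in>UNIV. \<Sum>l\<in>UNIV. S $ m $ i * G t m l * S $ l $ j) = (if i = j then 1 else 0)"
        "\<And>i j. \<bar>S $ i $ j - (if i = j then 1 else 0)\<bar> \<le> n^3 * d t"
      using inverse_sqrt_near_identity[of "\<chi> i j. G t i j" "d t"] elim(2)
      by (auto simp: n_def transpose_def vec_eq_iff G_def gform_commute)
    \<comment> \<open>The exactly orthonormal frame, to which \<open>ineq\<close> applies; the rest
      compares it with \<open>F\<close>.\<close>
    define F' where "F' i = (\<Sum>l\<in>UNIV. S $ l $ i *\<^sub>R F t l)" for i
    have gF': "gform D (X t) (F' i) (F' j) = (if i = j then 1 else 0)" for i j
      unfolding S(1)[symmetric] F'_def G_def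
      by (subst sum.swap) (simp add: gform_sum gform_linear sum_distrib_left mult_ac)
    define \<Delta> where "\<Delta> i l = S $ l $ i - (if l = i then 1 else 0)" for i l
    have \<Delta>: "\<bar>\<Delta> i l\<bar> \<le> n^3 * d t" for i l using S(2)[of l i] by (simp add: \<Delta>_def)
    have B': "phess D (X t) (F' i) (F' i) - k i = B t i i i + (\<Sum>l\<in>UNIV. \<Delta> i l * (B t i i l + B t i l i))
        + (\<Sum>l\<in>UNIV. \<Sum>j\<in>UNIV. \<Delta> i l * \<Delta> i j * B t i l j)" for i
    proof -
      have "phess D (X t) (F' i) (F' i) - k i * gform D (X t) (F' i) (F' i)
          = (\<Sum>l\<in>UNIV. \<Sum>j\<in>UNIV. S $ l $ i * S $ j $ i * B t i l j)"
      proof -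
        have "phess D (X t) (F' i) (F' i) = (\<Sum>l\<in>UNIV. \<Sum>j\<in>UNIV. S $ l $ i * S $ j $ i * phess D (X t) (F t l) (F t j))"
          unfolding F'_def by (subst sum.swap) (simp add: phess_sum phess_linear sum_distrib_left mult_ac)
        moreover have "gform D (X t) (F' i) (F' i) = (\<Sum>l\<in>UNIV. \<Sum>j\<in>UNIV. S $ l $ i * S $ j $ i * gform D (X t) (F t l) (F t j))"
          unfolding F'_def by (subst sum.swap) (simp add: gform_sum gform_linear sum_distrib_left mult_ac)
        ultimately show ?thesis
          by (simp add: B_def sum_distrib_left right_diff_distrib sum_subtractf mult_ac)
      qed
      also have "\<dots> = (\<Sum>l\<in>UNIV. \<Sum>j\<in>UNIV. ((if l = i then 1 else 0) + \<Delta> i l) * ((if j = i then 1 else 0) + \<Delta> i j) * B t i l j)"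
        by (simp add: \<Delta>_def)
      finally show ?thesis unfolding perturbed_identity_quadratic gF' by simp
    qed
    have summand: "g i * (phess D (X t) (F' i) (F' i) - k i) \<le> g i * B t i i i
        + \<bar>g i\<bar> * ((\<Sum>l\<in>UNIV. n^3 * d t * (\<bar>B t i i l\<bar> + \<bar>B t i l i\<bar>))
        + (\<Sum>l\<in>UNIV. \<Sum>j\<in>UNIV. (n^3 * d t) * (n^3 * d t) * \<bar>B t i l j\<bar>))" for i
    proof -
      have a: "\<bar>\<Sum>l\<in>UNIV. \<Delta> i l * (B t i i l + B t i l i)\<bar> \<le> (\<Sum>l\<in>UNIV. n^3 * d t * (\<bar>B t i i l\<bar> + \<bar>B t i l i\<bar>))"
        by (intro order_trans[OF sum_abs] sum_mono, subst abs_mult, intro mult_mono \<Delta> abs_triangle_ineq)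
          (auto intro: order_trans[OF abs_ge_zero \<Delta>])
      have b: "\<bar>\<Sum>l\<in>UNIV. \<Sum>j\<in>UNIV. \<Delta> i l * \<Delta> i j * B t i l j\<bar> \<le> (\<Sum>l\<in>UNIV. \<Sum>j\<in>UNIV. (n^3 * d t) * (n^3 * d t) * \<bar>B t i l j\<bar>)"
        by (intro order_trans[OF sum_abs] sum_mono, unfold abs_mult, intro mult_mono \<Delta>)
          (auto intro: order_trans[OF abs_ge_zero \<Delta>])
      have "g i * (phess D (X t) (F' i) (F' i) - k i) = g i * B t i i i
         + g i * ((\<Sum>l\<in>UNIV. \<Delta> i l * (B t i i l + B t i l i)) + (\<Sum>l\<in>UNIV. \<Sum>j\<in>UNIV. \<Delta> i l * \<Delta> i j * B t i l j))"
        unfolding B' by (simp add: algebra_simps)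
      moreover have "g i * ((\<Sum>l\<in>UNIV. \<Delta> i l * (B t i i l + B t i l i)) + (\<Sum>l\<in>UNIV. \<Sum>j\<in>UNIV. \<Delta> i l * \<Delta> i j * B t i l j))
         \<le> \<bar>g i\<bar> * \<bar>(\<Sum>l\<in>UNIV. \<Delta> i l * (B t i i l + B t i l i)) + (\<Sum>l\<in>UNIV. \<Sum>j\<in>UNIV. \<Delta> i l * \<Delta> i j * B t i l j)\<bar>"
        by (simp flip: abs_mult)
      moreover have "\<dots> \<le> \<bar>g i\<bar> * ((\<Sum>l\<in>UNIV. n^3 * d t * (\<bar>B t i i l\<bar> + \<bar>B t i l i\<bar>))
        + (\<Sum>l\<in>UNIV. \<Sum>j\<in>UNIV. (n^3 * d t) * (n^3 * d t) * \<bar>B t i l j\<bar>))"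
        by (intro mult_left_mono order_trans[OF abs_triangle_ineq] add_mono a b) auto
      ultimately show ?thesis by linarith
    qed
    have "\<sigma> * wfun D (X t) - \<sigma> * w \<le> (\<Sum>i\<in>UNIV. g i * (phess D (X t) (F' i) (F' i) - k i))"
      using ineq[OF elim(1) gF'] eq by (simp add: right_diff_distrib sum_subtractf)
    also have "\<dots> \<le> (\<Sum>i\<in>UNIV. g i * B t i i i) - R t"
      using sum_mono[of UNIV, OF summand] unfolding R_def by (simp add: sum.distrib)
    finally show ?case by (simp add: algebra_simps)
  qed
  then show ?thesis using Ro unfolding B_def X_def F_def by blast
qed

end

subsection \<open>The algebraic inequality at the maximum point\<close>

text \<open>Dictionary: \<open>c i = k i - 1\<close>, \<open>s = \<sigma> * w\<close>,
  \<open>N = M * a * w\<close>, and \<open>T\<close>, \<open>U\<close>, \<open>A\<close> are third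
  derivatives of \<open>u\<close> scaled by \<open>b^2\<close>. The hypotheses on them are the first
  order conditions at the maximum and the differentiated equation; \<open>ineq\<close> is the
  combined second order test, free of fourth derivatives.\<close>

lemma maximum_point_algebra:
  fixes g c p X T U A :: "'n::finite \<Rightarrow> real" and m :: 'n
  assumes g: "\<And>i. g i > 0" and c: "\<And>i. c i > -1" "\<And>i. c i \<le> c m"
    and w: "w \<ge> 1" and a: "a > 0" "a * w \<le> 1 / 2" and s: "(\<Sum>i\<in>UNIV. g i * (1 + c i)) = s"
    and q: "w^2 * (\<Sum>i\<in>UNIV. (p i)^2) = w^2 - 1"
    and N: "N = (1 + c m) * (a * w) / (1 - a * w)"
    and U: "\<And>i. U i = - (c m + N * c i) * p i + (if i = m then 2 * (c m)^2 * p m else 0)"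
    and Tm: "T m = U m"
    and ST: "(\<Sum>i\<in>UNIV. g i * T i) = p m * (s * c m - (\<Sum>i\<in>UNIV. g i * c i) + 2 * g m * (c m)^2)"
    and SA: "(\<Sum>i\<in>UNIV. g i * A i) = (\<Sum>j\<in>UNIV. (p j)^2 * (s * c j - (\<Sum>i\<in>UNIV. g i * c i) + 2 * g j * (c j)^2))"
    and Am: "A m = (\<Sum>j\<in>UNIV. p j * U j)"
    and X: "\<And>i. X i = p i + c i * p i / (1 - a * w)"
    and ineq: "0 \<le> - (N / w) * (\<Sum>i\<in>UNIV. g i * ((c i)^2 / w + w * A i)) - s / w * ((c m)^2 / w + w * A m)
      + 2 * (\<Sum>i\<in>UNIV - {m}. g i * (c m * ((p m)^2 + p m * T i + 2 * (p m)^2 * c i) - 2 * p m * T i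
          - (p m)^2 * c i - p i * U i + 2 * X i * U i + (X i)^2 * c m + p m * T i
          - c i * ((X i)^2 + p i * U i + 2 * X i * p i * c m)))"
  shows "1 + c m \<le> 12 * w^2"
proof -
  \<comment> \<open>With \<open>N = (1 + c m) * \<mu>\<close> and \<open>\<rho> = 1 + \<mu>\<close>,
    the recurring factor \<open>N + (1 + c m)\<close> becomes \<open>(1 + c m) * \<rho>\<close>, and
    \<open>a * w \<le> 1 / 2\<close> confines \<open>\<rho>\<close> to the interval from 1 to
    2.\<close>
  define \<rho> where "\<rho> = 1 / (1 - a * w)"
  define \<mu> where "\<mu> = a * w * \<rho>"
  have \<rho>: "1 \<le> \<rho>" "\<rho> \<le> 2" using a w by (auto simp: \<rho>_def field_simps)
  have \<mu>\<rho>: "\<rho> = 1 + \<mu>" using a(2) by (simp add: \<mu>_def \<rho>_def field_simps)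
  have \<mu>: "0 \<le> \<mu>" "\<mu> \<le> 1" using \<mu>\<rho> \<rho> by auto
  have N': "N = (1 + c m) * \<mu>" by (simp add: N \<mu>_def \<rho>_def)
  have km: "1 + c m > 0" using c(1)[of m] by simp
  have Npos: "N \<ge> 0" using N' km \<mu> by simp
  define v where "v = 1 / w^2"
  have v: "0 < v" "v \<le> 1" using w by (auto simp: v_def)
  let ?O = "UNIV - {m}"
  have rem: "(\<Sum>i\<in>?O. F i) = (\<Sum>i\<in>UNIV. F i) - F m" for F :: "'n \<Rightarrow> real"
    by (simp add: sum.remove[of UNIV m])
  define G0 C G2 H1 H2 Q0 Q1 where "G0 = (\<Sum>i\<in>UNIV. g i)" and "C = (\<Sum>i\<in>UNIV. g i * c i)"
    and "G2 = (\<Sum>i\<in>UNIV. g i * (c i)^2)" and "H1 = (\<Sum>i\<in>UNIV. g i * ((p i)^2 * c i))"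
    and "H2 = (\<Sum>i\<in>UNIV. g i * ((p i)^2 * (c i)^2))" and "Q0 = (\<Sum>i\<in>UNIV. (p i)^2)"
    and "Q1 = (\<Sum>i\<in>UNIV. (p i)^2 * c i)"
  have sC: "G0 = s - C" using s by (simp add: G0_def C_def distrib_left sum.distrib)
  have Q0: "Q0 = 1 - v" using q w by (simp add: Q0_def v_def field_simps)
  have SA': "(\<Sum>i\<in>UNIV. g i * A i) = s * Q1 - C * Q0 + 2 * H2"
    unfolding SA C_def[symmetric] Q1_def Q0_def H2_def
    by (simp add: sum_distrib_left sum.distrib sum_subtractf algebra_simps)
  have Am': "A m = - c m * Q0 - N * Q1 + 2 * (c m)^2 * (p m)^2"
  proof -
    have "p j * U j = - c m * (p j)^2 - N * ((p j)^2 * c j) + (if j = m then 2 * (c m)^2 * (p m)^2 else 0)" for j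
      by (auto simp: U power2_eq_square algebra_simps)
    then show ?thesis by (simp add: Am sum.distrib sum_subtractf Q0_def Q1_def sum_distrib_left)
  qed
  define r where "r i = c i * p i * \<rho>" for i
  have summand: "c m * ((p m)^2 + p m * T i + 2 * (p m)^2 * c i) - 2 * p m * T i
          - (p m)^2 * c i - p i * U i + 2 * X i * U i + (X i)^2 * c m + p m * T i
          - c i * ((X i)^2 + p i * U i + 2 * X i * p i * c m)
     = (c m - 1) * p m * T i + (p m)^2 * c m + (p m)^2 * (2 * c m - 1) * c i + N * ((p i)^2 * (c i)^2)
        - (N + (1 + c m)) * ((p i)^2 * c i) - (2 * (1 + c m) - (c m - c i)) * (r i)^2" if "i \<in> ?O" for i
  proof -
    have Ui: "U i = - (c m + N * c i) * p i" using that by (simp add: U)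
    have Xi: "X i = p i + r i" by (simp add: X r_def \<rho>_def)
    \<comment> \<open>The correction \<open>r i\<close> in \<open>X i\<close> is tuned so that the
      cross term is itself a multiple of \<open>(r i)^2\<close>. What remains is minus a square
      whose coefficient exceeds \<open>1 + c m\<close>, since
      \<open>c m - c i < 1 + c m\<close>.\<close>
    have Nr: "(N + (1 + c m)) * (p i * c i) = (1 + c m) * r i"
      by (simp add: N' r_def \<mu>\<rho> algebra_simps)
    have "c m * ((p m)^2 + p m * T i + 2 * (p m)^2 * c i) - 2 * p m * T i
          - (p m)^2 * c i - p i * U i + 2 * X i * U i + (X i)^2 * c m + p m * T i
          - c i * ((X i)^2 + p i * U i + 2 * X i * p i * c m)
     = (c m - 1) * p m * T i + (p m)^2 * c m + (p m)^2 * (2 * c m - 1) * c i + N * ((p i)^2 * (c i)^2)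
        - (N + (1 + c m)) * ((p i)^2 * c i) - 2 * r i * ((N + (1 + c m)) * (p i * c i)) + (c m - c i) * (r i)^2"
      unfolding Ui Xi by (simp add: power2_eq_square algebra_simps)
    then show ?thesis unfolding Nr by (simp add: power2_eq_square algebra_simps)
  qed
  have "(\<Sum>i\<in>?O. g i * (c m * ((p m)^2 + p m * T i + 2 * (p m)^2 * c i) - 2 * p m * T i
          - (p m)^2 * c i - p i * U i + 2 * X i * U i + (X i)^2 * c m + p m * T i
          - c i * ((X i)^2 + p i * U i + 2 * X i * p i * c m)))
     = (\<Sum>i\<in>?O. (c m - 1) * p m * (g i * T i) + (p m)^2 * c m * g i + (p m)^2 * (2 * c m - 1) * (g i * c i)
        + N * (g i * ((p i)^2 * (c i)^2)) - (N + (1 + c m)) * (g i * ((p i)^2 * c i)))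
        - (\<Sum>i\<in>?O. g i * ((2 * (1 + c m) - (c m - c i)) * (r i)^2))"
    unfolding sum_subtractf[symmetric] by (rule sum.cong[OF refl], subst summand) (simp_all add: algebra_simps)
  also have "\<dots> = (c m - 1) * p m * ((\<Sum>i\<in>UNIV. g i * T i) - g m * T m) + (p m)^2 * c m * (G0 - g m)
        + (p m)^2 * (2 * c m - 1) * (C - g m * c m)
        + N * (H2 - g m * ((p m)^2 * (c m)^2)) - (N + (1 + c m)) * (H1 - g m * ((p m)^2 * c m))
        - (\<Sum>i\<in>?O. g i * ((2 * (1 + c m) - (c m - c i)) * (r i)^2))"
    unfolding sum.distrib sum_subtractf sum_distrib_left[symmetric] rem G0_def C_def H2_def H1_def by simp
  finally have SO: "(\<Sum>i\<in>?O. g i * (c m * ((p m)^2 + p m * T i + 2 * (p m)^2 * c i) - 2 * p m * T i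
          - (p m)^2 * c i - p i * U i + 2 * X i * U i + (X i)^2 * c m + p m * T i
          - c i * ((X i)^2 + p i * U i + 2 * X i * p i * c m))) = \<dots>" .
  have first: "- (N / w) * (\<Sum>i\<in>UNIV. g i * ((c i)^2 / w + w * A i)) = - N * (v * G2 + (\<Sum>i\<in>UNIV. g i * A i))"
  proof -
    have "(\<Sum>i\<in>UNIV. g i * ((c i)^2 / w + w * A i)) = G2 / w + w * (\<Sum>i\<in>UNIV. g i * A i)"
      by (simp add: G2_def distrib_left sum.distrib sum_distrib_left sum_divide_distrib mult.left_commute)
    then show ?thesis using w by (simp add: v_def power2_eq_square field_simps)
  qed
  have second: "s / w * ((c m)^2 / w + w * A m) = s * (v * (c m)^2 + A m)"
    using w by (simp add: v_def power2_eq_square field_simps)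
  have Tm': "T m = p m * (2 * (c m)^2 - c m - N * c m)" by (simp add: Tm U algebra_simps)
  \<comment> \<open>All third derivatives are eliminated here. The decisive term is
    \<open>- v * s * c m * (1 + c m)\<close>.\<close>
  have main: "0 \<le> - v * N * (G2 + C) - v * s * c m * (1 + c m) + N * C + s * c m
      - 2 * (N + (1 + c m)) * H1 - 2 * (\<Sum>i\<in>?O. g i * ((2 * (1 + c m) - (c m - c i)) * (r i)^2))"
    using ineq unfolding SO first second unfolding SA' Am' ST C_def[symmetric] Tm' sC Q0
    by (simp add: power2_eq_square algebra_simps)
  show ?thesis
  proof (cases "c m \<ge> 0")
    case False
    then show ?thesis using one_le_power[OF w, of 2] by simp
  next
    case True
    have "g i * (1 + c i) > 0" for i using g[of i] c(1)[of i] by (intro mult_pos_pos) linarith+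
    then have spos: "s > 0" unfolding s[symmetric] by (intro sum_pos) auto
    have "G0 \<ge> 0" unfolding G0_def by (intro sum_nonneg less_imp_le g)
    then have Cs: "C \<le> s" using sC by simp
    have "G2 + C + s = (\<Sum>i\<in>UNIV. g i * (1 + c i)^2)"
      unfolding s[symmetric] G2_def C_def sum.distrib[symmetric]
      by (rule sum.cong) (simp_all add: algebra_simps power2_eq_square)
    also have "\<dots> \<ge> 0" using g by (intro sum_nonneg mult_nonneg_nonneg) (auto intro: less_imp_le)
    finally have G2C: "G2 + C \<ge> - s" by simp
    have p1: "(p i)^2 \<le> 1" for i
    proof -
      have "(p i)^2 \<le> Q0" unfolding Q0_def by (rule member_le_sum) auto
      then show ?thesis using Q0 v by simp
    qed
    have R: "(\<Sum>i\<in>?O. g i * ((2 * (1 + c m) - (c m - c i)) * (r i)^2)) \<ge> (1 + c m) * (\<Sum>i\<in>?O. g i * (r i)^2)"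
      unfolding sum_distrib_left
    proof (rule sum_mono)
      fix i
      have "(1 + c m) * (r i)^2 \<le> (2 * (1 + c m) - (c m - c i)) * (r i)^2"
        using c(1)[of i] by (intro mult_right_mono) auto
      then have "g i * ((1 + c m) * (r i)^2) \<le> g i * ((2 * (1 + c m) - (c m - c i)) * (r i)^2)"
        using g[of i] by (intro mult_left_mono) auto
      then show "(1 + c m) * (g i * (r i)^2) \<le> g i * ((2 * (1 + c m) - (c m - c i)) * (r i)^2)"
        by (simp add: mult.left_commute)
    qed
    \<comment> \<open>For \<open>c i\<close> near -1 the term linear in \<open>c i\<close> alone
      would only be bounded by a multiple of \<open>g i\<close>. The square gained by turning the
      frame compensates it, leaving a bound proportional to \<open>g i * (1 + c i)\<close>, and
      these add up to \<open>s\<close>. The 4 bounds \<open>\<rho>^2\<close>; the index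
      \<open>m\<close> needs no square because \<open>c m \<ge> 0\<close>.\<close>
    have bound: "g i * (\<rho> * ((p i)^2 * c i) + (if i = m then 0 else (r i)^2)) \<ge> - (4 * (g i * (1 + c i)))" for i
    proof -
      have "- (4 * (1 + c i)) \<le> \<rho> * ((p i)^2 * c i) + (if i = m then 0 else (r i)^2)"
      proof (cases "c i \<ge> 0")
        case True
        then have "0 \<le> \<rho> * ((p i)^2 * c i)" using \<rho> by simp
        then show ?thesis using c(1)[of i] by (simp add: add_nonneg_nonneg order_trans[of _ 0])
      next
        case False
        then have "i \<noteq> m" using \<open>c m \<ge> 0\<close> by auto
        have *: "\<rho> * c i + (\<rho> * c i)^2 \<ge> - (\<rho>^2 * (1 + c i))"
        proof -
          have "1 + c i + (c i)^2 \<ge> 0" using sum_power2_ge_zero[of "1 + c i" "c i"] c(1)[of i] by simp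
          then have "1 + c i + (c i)^2 \<le> \<rho> * (1 + c i + (c i)^2)"
            using mult_right_mono[OF \<rho>(1)] by fastforce
          moreover have "0 \<le> (1 + c i)^2" by simp
          ultimately have "0 \<le> \<rho> * (1 + c i + (c i)^2) + c i" by (simp add: power2_eq_square algebra_simps)
          then have "0 \<le> \<rho> * (\<rho> * (1 + c i + (c i)^2) + c i)" using \<rho> by simp
          then show ?thesis by (simp add: power2_eq_square algebra_simps)
        qed
        have "\<rho>^2 \<le> 2^2" using \<rho> by (intro power_mono) auto
        then have "\<rho>^2 * (1 + c i) \<le> 4 * (1 + c i)" using c(1)[of i] by (intro mult_right_mono) auto
        with * have "- (4 * (1 + c i)) \<le> \<rho> * c i + (\<rho> * c i)^2" by linarith
        moreover have "- (4 * (1 + c i)) \<le> (p i)^2 * (- (4 * (1 + c i)))"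
          using mult_right_mono[OF p1[of i], of "4 * (1 + c i)"] c(1)[of i] by simp
        ultimately have "- (4 * (1 + c i)) \<le> (p i)^2 * (\<rho> * c i + (\<rho> * c i)^2)"
          by (meson mult_left_mono order_trans zero_le_power2)
        then show ?thesis using \<open>i \<noteq> m\<close> by (simp add: r_def power_mult_distrib algebra_simps)
      qed
      from mult_left_mono[OF this less_imp_le[OF g[of i]]] show ?thesis
        by (simp only: mult_minus_right mult.left_commute[of 4])
    qed
    have "- (4 * s) \<le> \<rho> * H1 + (\<Sum>i\<in>?O. g i * (r i)^2)"
    proof -
      have "- (4 * s) = (\<Sum>i\<in>UNIV. - (4 * (g i * (1 + c i))))"
        unfolding s[symmetric] by (simp add: sum_negf sum_distrib_left)
      also have "\<dots> \<le> (\<Sum>i\<in>UNIV. g i * (\<rho> * ((p i)^2 * c i) + (if i = m then 0 else (r i)^2)))"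
        by (rule sum_mono) (rule bound)
      also have "\<dots> = \<rho> * H1 + (\<Sum>i\<in>UNIV. if i = m then 0 else g i * (r i)^2)"
        unfolding H1_def sum_distrib_left sum.distrib[symmetric] by (intro sum.cong refl) (auto simp: algebra_simps)
      also have "(\<Sum>i\<in>UNIV. if i = m then 0 else g i * (r i)^2) = (\<Sum>i\<in>?O. g i * (r i)^2)"
        by (intro sum.mono_neutral_cong_right) auto
      finally show ?thesis .
    qed
    then have HR: "(1 + c m) * (- (4 * s)) \<le> (N + (1 + c m)) * H1 + (1 + c m) * (\<Sum>i\<in>?O. g i * (r i)^2)"
      using mult_left_mono[of "- (4 * s)" _ "1 + c m"] km by (fastforce simp: N' \<mu>\<rho> algebra_simps)
    have "- v * N * (G2 + C) \<le> v * N * s"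
      using mult_left_mono[OF G2C, of "v * N"] v Npos by simp
    also have "\<dots> \<le> N * s" using v Npos spos mult_right_mono[of v 1 "N * s"] by (simp add: mult_ac)
    finally have 1: "- v * N * (G2 + C) \<le> N * s" .
    have 2: "N * C \<le> N * s" using Cs Npos by (rule mult_left_mono)
    have 3: "N * s \<le> (1 + c m) * s" unfolding N' using \<mu> km spos by (intro mult_right_mono mult_left_le) auto
    have 4: "s * c m \<le> (1 + c m) * s" using spos by (simp add: algebra_simps)
    \<comment> \<open>The 11 is made of 1 each from the \<open>G2 + C\<close> term, from
      \<open>N * C\<close> and from \<open>s * c m\<close>, and of 8, twice the 4 in
      \<open>HR\<close>.\<close>
    have "v * s * c m * (1 + c m) \<le> 11 * ((1 + c m) * s)"
      using main R HR 1 2 3 4 by (simp add: algebra_simps)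
    then have "(v * c m) * ((1 + c m) * s) \<le> 11 * ((1 + c m) * s)" by (simp add: mult_ac)
    then have "v * c m \<le> 11" using km spos by (simp only: mult_le_cancel_right_pos[OF mult_pos_pos])
    then have "c m \<le> 11 * w^2" using w by (simp add: v_def field_simps)
    then show ?thesis using one_le_power[OF w, of 2] by simp
  qed
qed

section \<open>The maximum point tests in the adapted frame\<close>

lemma dd_3_scaleR:
  "dd [u, c *\<^sub>R v, v'] D x = c * dd [u, v, v'] D x"
  "dd [u, v, c *\<^sub>R v'] D x = c * dd [u, v, v'] D x"
  using dd_scaleR[of "[u]" c v "[v']" D x] dd_scaleR[of "[u, v]" c v' "[]" D x] by simp_all

lemma dd_zero [simp]:
  "dd [0] D x = 0" "dd [0, v] D x = 0" "dd [v, 0] D x = 0" "dd [v, 0, w] D x = 0" "dd [v, w, 0] D x = 0"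
  using dd_3_scaleR(1)[of v 0 v w D x] dd_3_scaleR(2)[of v w 0 v D x] by (simp_all add: dd_1 dd_2)

context adapted_frame
begin

abbreviation "W i \<equiv> (h i)^2 / w + w * (\<Sum>j\<in>UNIV. p j * t3 i i j)"

text \<open>By \<open>km\<close> the inequality \<open>psi\<close> is an equality at
  \<open>t = 0\<close> for the vector \<open>E m\<close>, so the difference has a minimum there. The
  velocity \<open>z\<close> of the test vector stays free.\<close>

lemma psi_test:
  assumes psi: "\<And>x v. x \<in> \<Omega> \<Longrightarrow> phess D x v v \<le> M * (1 - a * wfun D x) * gform D x v v"
    and km: "k m = M * (1 - a * w)"
    and G: "jet2 (\<lambda>t. gform D (x0 + t *\<^sub>R E i) (E m + t *\<^sub>R z) (E m + t *\<^sub>R z)) 1 g1 g2"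
  shows "k m * g1 - M * a * w * p i * h i - (b * (t3 i m m + dd [z, E m] D x0 + dd [E m, z] D x0) + p i * h m + g1) = 0"
    and "0 \<le> k m * g2 - M * a * w * p i * h i * g1 - M * a * W i / 2
       - (b * (dd [E i, E i, E m, E m] D x0 / 2 + dd [E i, z, E m] D x0 + dd [E i, E m, z] D x0 + dd [z, z] D x0)
         + p i * (t3 i m m + dd [z, E m] D x0 + dd [E m, z] D x0) + h i / 2 * h m + g2)"
proof -
  have S: "jet2 (\<lambda>t. M * (1 - a * wfun D (x0 + t *\<^sub>R E i))) (k m) (- (M * a * w * p i * h i)) (- (M * a * W i / 2))"
    by (rule jet2_cong[OF jet2_cmult[OF jet2_diff[OF jet2_const jet2_cmult[OF jet2_wfun]]]]) (simp_all add: km)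
  have "open \<Omega>" using smooth by (simp add: smooth_family_def)
  then have "eventually (\<lambda>t. x0 + t *\<^sub>R E i \<in> \<Omega>) (at 0)"
    using x0 by (rule eventually_line_in_open)
  then have ev: "eventually (\<lambda>t. 0 \<le> M * (1 - a * wfun D (x0 + t *\<^sub>R E i)) * gform D (x0 + t *\<^sub>R E i) (E m + t *\<^sub>R z) (E m + t *\<^sub>R z)
     - phess D (x0 + t *\<^sub>R E i) (E m + t *\<^sub>R z) (E m + t *\<^sub>R z)) (at 0)"
    by eventually_elim (use psi in simp)
  have J: "jet2 (\<lambda>t. M * (1 - a * wfun D (x0 + t *\<^sub>R E i)) * gform D (x0 + t *\<^sub>R E i) (E m + t *\<^sub>R z) (E m + t *\<^sub>R z)
     - phess D (x0 + t *\<^sub>R E i) (E m + t *\<^sub>R z) (E m + t *\<^sub>R z)) 0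
     (k m * g1 - M * a * w * p i * h i - (b * (t3 i m m + dd [z, E m] D x0 + dd [E m, z] D x0) + p i * h m + g1))
     (k m * g2 - M * a * w * p i * h i * g1 - M * a * W i / 2
       - (b * (dd [E i, E i, E m, E m] D x0 / 2 + dd [E i, z, E m] D x0 + dd [E i, E m, z] D x0 + dd [z, z] D x0)
         + p i * (t3 i m m + dd [z, E m] D x0 + dd [E m, z] D x0) + h i / 2 * h m + g2))"
    by (rule jet2_cong[OF jet2_diff[OF jet2_mult[OF S G] jet2_phess[OF smooth x0 G]]])
      (simp_all add: dd_frame k_eq algebra_simps)
  have z: "(\<lambda>t::real. 0::real) \<in> o[at 0](\<lambda>t. t^2)" by simp
  show "k m * g1 - M * a * w * p i * h i - (b * (t3 i m m + dd [z, E m] D x0 + dd [E m, z] D x0) + p i * h m + g1) = 0"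
    "0 \<le> k m * g2 - M * a * w * p i * h i * g1 - M * a * W i / 2
       - (b * (dd [E i, E i, E m, E m] D x0 / 2 + dd [E i, z, E m] D x0 + dd [E i, E m, z] D x0 + dd [z, z] D x0)
         + p i * (t3 i m m + dd [z, E m] D x0 + dd [E m, z] D x0) + h i / 2 * h m + g2)"
    using jet2_nonneg[OF J z ev] by auto
qed

text \<open>With the test vector held fixed, the first order condition determines the third
  derivatives with two indices \<open>m\<close>.\<close>

lemma psi_test_straight:
  assumes psi: "\<And>x v. x \<in> \<Omega> \<Longrightarrow> phess D x v v \<le> M * (1 - a * wfun D x) * gform D x v v"
    and km: "k m = M * (1 - a * w)"
  shows "b * t3 i m m = - (M * a * w * p i * h i) - p i * h m + (if i = m then 2 * (k m - 1) * p m * h m else 0)"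
  using psi_test(1)[OF psi km jet2_cong[OF jet2_gform[OF smooth x0, where v = "E m" and z = 0 and \<xi> = "E i" and v' = "E m" and z' = 0] _ refl refl]]
  by (auto simp: orth dd_frame algebra_simps)

text \<open>Tilting \<open>E m\<close> towards \<open>E i\<close> keeps its
  \<open>gform\<close>-length to first order, as \<open>i \<noteq> m\<close>. The slope
  \<open>y\<close> is later set to \<open>p m / b\<close>, the value of hyperbolic parallel
  transport along \<open>E i\<close> up to rescaling.\<close>

lemma psi_test_slanted:
  assumes psi: "\<And>x v. x \<in> \<Omega> \<Longrightarrow> phess D x v v \<le> M * (1 - a * wfun D x) * gform D x v v"
    and km: "k m = M * (1 - a * w)" and i: "i \<noteq> m"
  shows "0 \<le> (k m - 1) * (y^2 + p m * t3 i i m + 2 * y * p m * h i) - M * a * W i / 2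
       - b * (dd [E i, E i, E m, E m] D x0 / 2 + 2 * y * t3 i i m + y^2 * h i) - p i * t3 i m m - h i * h m / 2"
proof -
  have G: "jet2 (\<lambda>t. gform D (x0 + t *\<^sub>R E i) (E m + t *\<^sub>R (y *\<^sub>R E i)) (E m + t *\<^sub>R (y *\<^sub>R E i))) 1 0
     (y^2 + p m * t3 i i m + 2 * y * p m * h i)"
    by (rule jet2_cong[OF jet2_gform[OF smooth x0]])
      (use i in \<open>simp_all add: orth dd_frame dd_linear inner_frame power2_eq_square algebra_simps\<close>)
  show ?thesis
    using psi_test(2)[OF psi km G] i
    by (simp add: dd_frame dd_linear dd_3_scaleR dd_commute(2)[OF smooth x0, of "E i" "E m" "E i"] power2_eq_square algebra_simps)
qed

lemma jet2_frame_term: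
  assumes G: "jet2 (\<lambda>t. gform D (x0 + t *\<^sub>R E l) (E i + t *\<^sub>R z) (E i + t *\<^sub>R z)) 1 0 g2"
  shows "jet2 (\<lambda>t. phess D (x0 + t *\<^sub>R E l) (E i + t *\<^sub>R z) (E i + t *\<^sub>R z)
         - k i * gform D (x0 + t *\<^sub>R E l) (E i + t *\<^sub>R z) (E i + t *\<^sub>R z)) 0
     (b * (t3 l i i + dd [z, E i] D x0 + dd [E i, z] D x0) + p l * h i)
     (b * (dd [E l, E l, E i, E i] D x0 / 2 + dd [E l, z, E i] D x0 + dd [E l, E i, z] D x0 + dd [z, z] D x0)
       + p l * (t3 l i i + dd [z, E i] D x0 + dd [E i, z] D x0) + h l / 2 * h i + (1 - k i) * g2)"
  by (rule jet2_cong[OF jet2_diff[OF jet2_phess[OF smooth x0 G] jet2_cmult[OF G]]])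
    (simp_all add: dd_frame k_eq algebra_simps)

text \<open>The second order coefficient stays anonymous because it never contributes: either only
  first order terms are read off, or the form is multiplied by a factor vanishing at
  \<open>t = 0\<close>.\<close>

lemma jet2_gform_tangent:
  assumes "2 * gform D x0 z (E i) + 2 * p i * dd [E l, E i] D x0 = 0"
  shows "\<exists>g2. jet2 (\<lambda>t. gform D (x0 + t *\<^sub>R E l) (E i + t *\<^sub>R z) (E i + t *\<^sub>R z)) 1 0 g2"
proof -
  have "2 * (z \<bullet> E i) + 2 * (dd [z] D x0 * p i) + 2 * (p i * dd [E l, E i] D x0) = 0"
    using assms by (simp add: gform_def algebra_simps)
  note zE = this
  show ?thesis
    by (rule exI, rule jet2_cong[OF jet2_gform[OF smooth x0] _ _ refl])
      (use zE in \<open>simp_all add: orth inner_commute[of _ z] algebra_simps\<close>)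
qed

context
  fixes g :: "'n \<Rightarrow> real" and \<sigma> :: real
  assumes ineq: "\<And>x F. x \<in> \<Omega> \<Longrightarrow> (\<And>i j. gform D x (F i) (F j) = (if i = j then 1 else 0)) \<Longrightarrow>
      \<sigma> * wfun D x \<le> (\<Sum>i\<in>UNIV. g i * phess D x (F i) (F i))"
    and eq: "(\<Sum>i\<in>UNIV. g i * k i) = \<sigma> * w"
begin

lemma frame_test':
  assumes tangent: "\<And>i j. gform D x0 (\<zeta> i) (E j) + gform D x0 (\<zeta> j) (E i)
      + p i * dd [\<xi>, E j] D x0 + p j * dd [\<xi>, E i] D x0 = 0"
  shows "\<exists>R\<in>o[at 0](\<lambda>t. t^2). eventually (\<lambda>t. R t \<le>
     (\<Sum>i\<in>UNIV. g i * (phess D (x0 + t *\<^sub>R \<xi>) (E i + t *\<^sub>R \<zeta> i) (E i + t *\<^sub>R \<zeta> i)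
         - k i * gform D (x0 + t *\<^sub>R \<xi>) (E i + t *\<^sub>R \<zeta> i) (E i + t *\<^sub>R \<zeta> i)))
       - \<sigma> * (wfun D (x0 + t *\<^sub>R \<xi>) - w)) (at 0)"
proof (rule frame_test[OF ineq eq])
  fix i j
  show "E i \<bullet> \<zeta> j + \<zeta> i \<bullet> E j + (p i * (dd [\<xi>, E j] D x0 + dd [\<zeta> j] D x0) + (dd [\<xi>, E i] D x0 + dd [\<zeta> i] D x0) * p j) = 0"
    using tangent[of i j] by (simp add: gform_def inner_commute[of "E i"] algebra_simps)
qed

text \<open>The equation differentiated along \<open>E i\<close>. The frame inequality is an
  equality at \<open>x0\<close>, and \<open>t\<close> of both signs is allowed, so its first order
  term vanishes.\<close>

lemma equation_derivative:
  "(\<Sum>j\<in>UNIV. g j * (b * t3 i j j + p i * h j)) - 2 * g i * b * (h i)^2 * p i = \<sigma> * w * p i * h i"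
proof -
  \<comment> \<open>The gradient of \<open>u\<close> with respect to the induced metric. Moving
    \<open>E i\<close> by \<open>- h i *\<^sub>R Z\<close> compensates the first order change of the
    metric along \<open>E i\<close> and leaves the other frame vectors fixed.\<close>
  define Z where "Z = (\<Sum>l\<in>UNIV. p l *\<^sub>R E l)"
  define \<zeta> where "\<zeta> j = (if j = i then - h i *\<^sub>R Z else 0)" for j
  have ZE: "gform D x0 Z (E j) = p j" for j
    by (simp add: Z_def gform_sum gform_linear orth if_distrib cong: if_cong)
  have ZH: "dd [Z, E j] D x0 = p j * h j" "dd [E j, Z] D x0 = p j * h j" for j
    by (simp_all add: Z_def dd_sum dd_linear dd_frame if_distrib cong: if_cong)
  have z0: "gform D x0 0 v = 0" for v by (simp add: gform_def)
  have zE: "gform D x0 (\<zeta> j) (E l) = (if j = i then - h i * p l else 0)" for j l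
    by (auto simp: \<zeta>_def ZE z0 gform_linear simp del: scaleR_minus_left)
  have zH: "dd [\<zeta> j, E j] D x0 = (if j = i then - h i * (p i * h i) else 0)"
    "dd [E j, \<zeta> j] D x0 = (if j = i then - h i * (p i * h i) else 0)" for j
    by (auto simp: \<zeta>_def ZH dd_linear simp del: scaleR_minus_left)
  have "\<exists>R\<in>o[at 0](\<lambda>t. t^2). eventually (\<lambda>t. R t \<le>
     (\<Sum>j\<in>UNIV. g j * (phess D (x0 + t *\<^sub>R E i) (E j + t *\<^sub>R \<zeta> j) (E j + t *\<^sub>R \<zeta> j)
         - k j * gform D (x0 + t *\<^sub>R E i) (E j + t *\<^sub>R \<zeta> j) (E j + t *\<^sub>R \<zeta> j)))
       - \<sigma> * (wfun D (x0 + t *\<^sub>R E i) - w)) (at 0)"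
    by (rule frame_test') (auto simp: zE dd_frame)
  then obtain R where R: "R \<in> o[at 0](\<lambda>t. t^2)" "eventually (\<lambda>t. R t \<le>
     (\<Sum>j\<in>UNIV. g j * (phess D (x0 + t *\<^sub>R E i) (E j + t *\<^sub>R \<zeta> j) (E j + t *\<^sub>R \<zeta> j)
         - k j * gform D (x0 + t *\<^sub>R E i) (E j + t *\<^sub>R \<zeta> j) (E j + t *\<^sub>R \<zeta> j)))
       - \<sigma> * (wfun D (x0 + t *\<^sub>R E i) - w)) (at 0)" by blast
  have "\<forall>j. \<exists>g2. jet2 (\<lambda>t. gform D (x0 + t *\<^sub>R E i) (E j + t *\<^sub>R \<zeta> j) (E j + t *\<^sub>R \<zeta> j)) 1 0 g2"
    by (intro allI jet2_gform_tangent) (auto simp: zE dd_frame)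
  then obtain g2 where g2: "\<And>j. jet2 (\<lambda>t. gform D (x0 + t *\<^sub>R E i) (E j + t *\<^sub>R \<zeta> j) (E j + t *\<^sub>R \<zeta> j)) 1 0 (g2 j)"
    unfolding choice_iff by blast
  note J = jet2_diff[OF jet2_sum[where I = UNIV, OF jet2_cmult[OF jet2_frame_term[OF g2]]] jet2_cmult[OF jet2_diff[OF jet2_wfun jet2_const]]]
  have "(\<Sum>j\<in>UNIV. g j * (b * (t3 i j j + dd [\<zeta> j, E j] D x0 + dd [E j, \<zeta> j] D x0) + p i * h j)) - \<sigma> * (w * p i * h i - 0) = 0"
    using jet2_nonneg[OF jet2_cong[OF J _ refl refl] R] by simp
  moreover have "(\<Sum>j\<in>UNIV. g j * (b * (t3 i j j + dd [\<zeta> j, E j] D x0 + dd [E j, \<zeta> j] D x0) + p i * h j))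
      = (\<Sum>j\<in>UNIV. g j * (b * t3 i j j + p i * h j) + (if j = i then - (2 * g i * b * (h i)^2 * p i) else 0))"
    by (rule sum.cong) (auto simp: zH power2_eq_square algebra_simps)
  ultimately show ?thesis by (simp add: sum.distrib)
qed

text \<open>The frame test along \<open>E m\<close> is combined with \<open>psi\<close> along the same curve and for the same vector
  \<open>E m + t *\<^sub>R \<eta>\<close>: the terms with \<open>phess\<close> in the direction \<open>m\<close> then cancel. The numbers \<open>X i\<close> are the speeds
  at which the frame turns in the planes of \<open>E m\<close> and \<open>E i\<close>, a free choice.\<close>

lemma second_order_test:
  fixes X :: "'n \<Rightarrow> real"
  assumes psi: "\<And>x v. x \<in> \<Omega> \<Longrightarrow> phess D x v v \<le> M * (1 - a * wfun D x) * gform D x v v"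
    and km: "k m = M * (1 - a * w)" and g: "\<And>i. g i > 0"
  shows "0 \<le> (\<Sum>i\<in>UNIV - {m}. g i * (b * (dd [E m, E m, E i, E i] D x0 / 2 + 2 * X i * t3 m m i + (X i)^2 * h m)
       + p m * t3 m i i + h m / 2 * h i + (1 - k i) * ((X i)^2 + p i * t3 m m i + 2 * X i * p i * h m)))
     - g m * (M * a * W m / 2) - \<sigma> * (W m / 2)"
proof -
  define x where "x i = (if i = m then 0 else X i)" for i
  \<comment> \<open>The part with \<open>h m * p j\<close> compensates the change of the metric
    along \<open>E m\<close>; the part with \<open>x j\<close> is the turning of \<open>E m\<close>
    towards \<open>E j\<close>, matched by the opposite motion \<open>x j *\<^sub>R E m\<close> of
    \<open>E j\<close>.\<close>
  define \<eta> where "\<eta> = (\<Sum>j\<in>UNIV. (- (h m * p j + x j)) *\<^sub>R E j)"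
  define \<zeta> where "\<zeta> i = (if i = m then \<eta> else x i *\<^sub>R E m)" for i
  have \<eta>E: "gform D x0 \<eta> (E j) = - (h m * p j + x j)" for j
    unfolding \<eta>_def gform_sum gform_linear orth by (simp add: if_distrib cong: if_cong)
  have zE: "gform D x0 (\<zeta> i) (E j) = (if i = m then - (h m * p j + x j) else if j = m then x i else 0)" for i j
    by (simp add: \<zeta>_def \<eta>E gform_linear orth)
  have "\<exists>R\<in>o[at 0](\<lambda>t. t^2). eventually (\<lambda>t. R t \<le>
     (\<Sum>j\<in>UNIV. g j * (phess D (x0 + t *\<^sub>R E m) (E j + t *\<^sub>R \<zeta> j) (E j + t *\<^sub>R \<zeta> j)
         - k j * gform D (x0 + t *\<^sub>R E m) (E j + t *\<^sub>R \<zeta> j) (E j + t *\<^sub>R \<zeta> j)))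
       - \<sigma> * (wfun D (x0 + t *\<^sub>R E m) - w)) (at 0)"
    by (rule frame_test') (auto simp: zE dd_frame x_def)
  then obtain R where R: "R \<in> o[at 0](\<lambda>t. t^2)" "eventually (\<lambda>t. R t \<le>
     (\<Sum>j\<in>UNIV. g j * (phess D (x0 + t *\<^sub>R E m) (E j + t *\<^sub>R \<zeta> j) (E j + t *\<^sub>R \<zeta> j)
         - k j * gform D (x0 + t *\<^sub>R E m) (E j + t *\<^sub>R \<zeta> j) (E j + t *\<^sub>R \<zeta> j)))
       - \<sigma> * (wfun D (x0 + t *\<^sub>R E m) - w)) (at 0)" by blast
  have "open \<Omega>" using smooth by (simp add: smooth_family_def)
  then have "eventually (\<lambda>t. x0 + t *\<^sub>R E m \<in> \<Omega>) (at 0)"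
    using x0 by (rule eventually_line_in_open)
  with R(2) have ev: "eventually (\<lambda>t. R t \<le>
     (\<Sum>j\<in>UNIV - {m}. g j * (phess D (x0 + t *\<^sub>R E m) (E j + t *\<^sub>R \<zeta> j) (E j + t *\<^sub>R \<zeta> j)
         - k j * gform D (x0 + t *\<^sub>R E m) (E j + t *\<^sub>R \<zeta> j) (E j + t *\<^sub>R \<zeta> j)))
     + g m * ((M * (1 - a * wfun D (x0 + t *\<^sub>R E m)) - k m) * gform D (x0 + t *\<^sub>R E m) (E m + t *\<^sub>R \<zeta> m) (E m + t *\<^sub>R \<zeta> m))
       - \<sigma> * (wfun D (x0 + t *\<^sub>R E m) - w)) (at 0)"
  proof eventually_elim
    case (elim t)
    have "g m * (phess D (x0 + t *\<^sub>R E m) (E m + t *\<^sub>R \<zeta> m) (E m + t *\<^sub>R \<zeta> m)) \<le>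
       g m * (M * (1 - a * wfun D (x0 + t *\<^sub>R E m)) * gform D (x0 + t *\<^sub>R E m) (E m + t *\<^sub>R \<zeta> m) (E m + t *\<^sub>R \<zeta> m))"
      using g[of m] elim(2) by (intro mult_left_mono psi) auto
    with elim(1) show ?case
      by (simp add: sum.remove[of UNIV m] algebra_simps)
  qed
  have G: "jet2 (\<lambda>t. gform D (x0 + t *\<^sub>R E m) (E i + t *\<^sub>R \<zeta> i) (E i + t *\<^sub>R \<zeta> i)) 1 0
      ((X i)^2 + p i * t3 m m i + 2 * X i * p i * h m)" if "i \<noteq> m" for i
    by (rule jet2_cong[OF jet2_gform[OF smooth x0]])
      (use that in \<open>simp_all add: \<zeta>_def x_def orth dd_frame dd_linear inner_frame power2_eq_square algebra_simps\<close>)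
  have B: "jet2 (\<lambda>t. g i * (phess D (x0 + t *\<^sub>R E m) (E i + t *\<^sub>R \<zeta> i) (E i + t *\<^sub>R \<zeta> i)
         - k i * gform D (x0 + t *\<^sub>R E m) (E i + t *\<^sub>R \<zeta> i) (E i + t *\<^sub>R \<zeta> i))) 0
     (g i * (b * t3 m i i + p m * h i))
     (g i * (b * (dd [E m, E m, E i, E i] D x0 / 2 + 2 * X i * t3 m m i + (X i)^2 * h m)
       + p m * t3 m i i + h m / 2 * h i + (1 - k i) * ((X i)^2 + p i * t3 m m i + 2 * X i * p i * h m)))"
    if "i \<in> UNIV - {m}" for i
    by (rule jet2_cong[OF jet2_cmult[OF jet2_frame_term[OF G]]])
      (use that in \<open>simp_all add: \<zeta>_def x_def dd_frame dd_linear dd_3_scaleR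
        dd_commute(2)[OF smooth x0, of "E m" "E i" "E m"] power2_eq_square algebra_simps\<close>)
  obtain g2 where g2: "jet2 (\<lambda>t. gform D (x0 + t *\<^sub>R E m) (E m + t *\<^sub>R \<zeta> m) (E m + t *\<^sub>R \<zeta> m)) 1 0 g2"
    using jet2_gform_tangent[of "\<zeta> m" m m] by (auto simp: zE dd_frame x_def)
  have S: "jet2 (\<lambda>t. M * (1 - a * wfun D (x0 + t *\<^sub>R E m)) - k m) 0 (- (M * a * w * p m * h m)) (- (M * a * W m / 2))"
    by (rule jet2_cong[OF jet2_diff[OF jet2_cmult[OF jet2_diff[OF jet2_const jet2_cmult[OF jet2_wfun]]] jet2_const]]) (simp_all add: km)
  note J = jet2_diff[OF jet2_add[OF jet2_sum[OF B] jet2_cmult[OF jet2_mult[OF S g2]]] jet2_cmult[OF jet2_diff[OF jet2_wfun jet2_const]]]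
  show ?thesis
    using jet2_nonneg[OF jet2_cong[OF J _ refl refl] R(1) ev] by (simp add: algebra_simps)
qed

lemma interior_estimate:
  assumes psi: "\<And>x v. x \<in> \<Omega> \<Longrightarrow> phess D x v v \<le> M * (1 - a * wfun D x) * gform D x v v"
    and km: "k m = M * (1 - a * w)" and g: "\<And>i. g i > 0"
    and k: "\<And>i. k i > 0" "\<And>i. k i \<le> k m" and a: "a > 0" "a * w \<le> 1 / 2"
  shows "k m \<le> 12 * w^2"
proof -
  define c where "c i = k i - 1" for i
  have bh: "b * h i = c i" for i using k_eq[of i] by (simp add: c_def)
  have b0: "b > 0" by (rule u_pos)
  define N where "N = M * a * w"
  define T where "T i = b^2 * t3 i i m" for i
  define U where "U i = b^2 * t3 m m i" for i
  define A where "A i = b^2 * (\<Sum>j\<in>UNIV. p j * t3 i i j)" for i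
  \<comment> \<open>\<open>p i\<close> is hyperbolic parallel transport; the correction, estimated from the third derivatives, nearly
     minimizes the quadratic expression in \<open>X i\<close> and avoids dividing by \<open>k m - k i\<close>.\<close>
  define X where "X i = p i + c i * p i / (1 - a * w)" for i
  define s where "s = \<sigma> * w"
  \<comment> \<open>The Codazzi equations: third derivatives in frame directions are totally
    symmetric.\<close>
  have sym: "t3 i m m = t3 m m i" "t3 m i i = t3 i i m" "t3 i j j = t3 j j i" for i j
    using dd_commute[OF smooth x0] by metis+
  have Ueq: "U i = - (c m + N * c i) * p i + (if i = m then 2 * (c m)^2 * p m else 0)" for i
  proof -
    have "U i = b * (b * t3 i m m)" by (simp add: U_def sym power2_eq_square)
    also have "\<dots> = - (N * p i * (b * h i)) - p i * (b * h m) + (if i = m then 2 * (k m - 1) * p m * (b * h m) else 0)"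
      by (subst psi_test_straight[OF psi km]) (auto simp: N_def algebra_simps)
    finally show ?thesis unfolding bh by (simp add: c_def power2_eq_square algebra_simps)
  qed
  have ED: "(\<Sum>i\<in>UNIV. g i * (b^2 * t3 i i j)) = p j * (s * c j - (\<Sum>i\<in>UNIV. g i * c i) + 2 * g j * (c j)^2)" for j
  proof -
    have "b * ((\<Sum>i\<in>UNIV. g i * (b * t3 j i i + p j * h i)) - 2 * g j * b * (h j)^2 * p j) = b * (\<sigma> * w * p j * h j)"
      unfolding equation_derivative ..
    moreover have "b * (\<Sum>i\<in>UNIV. g i * (b * t3 j i i + p j * h i)) = (\<Sum>i\<in>UNIV. g i * (b^2 * t3 i i j)) + p j * (\<Sum>i\<in>UNIV. g i * (b * h i))"
      by (simp add: sum_distrib_left sum.distrib[symmetric] sym(3)[of j] power2_eq_square algebra_simps)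
    ultimately have "(\<Sum>i\<in>UNIV. g i * (b^2 * t3 i i j)) + p j * (\<Sum>i\<in>UNIV. g i * (b * h i)) - 2 * g j * (b * h j)^2 * p j = s * p j * (b * h j)"
      by (simp add: s_def power2_eq_square algebra_simps)
    then show ?thesis unfolding bh by (simp add: algebra_simps)
  qed
  have "1 + c m \<le> 12 * w^2"
  proof (rule maximum_point_algebra[where g = g and c = c and p = p and X = X and T = T and U = U and A = A and s = s and N = N and a = a])
    show "(\<Sum>i\<in>UNIV. g i * (1 + c i)) = s" using eq by (simp add: c_def s_def)
    show "N = (1 + c m) * (a * w) / (1 - a * w)" using a(2) by (simp add: c_def N_def km)
    show "(\<Sum>i\<in>UNIV. g i * T i) = p m * (s * c m - (\<Sum>i\<in>UNIV. g i * c i) + 2 * g m * (c m)^2)"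
      unfolding T_def by (rule ED)
    have "(\<Sum>i\<in>UNIV. g i * A i) = (\<Sum>j\<in>UNIV. p j * (\<Sum>i\<in>UNIV. g i * (b^2 * t3 i i j)))"
      unfolding A_def sum_distrib_left by (subst sum.swap) (simp add: mult_ac)
    then show "(\<Sum>i\<in>UNIV. g i * A i) = (\<Sum>j\<in>UNIV. (p j)^2 * (s * c j - (\<Sum>i\<in>UNIV. g i * c i) + 2 * g j * (c j)^2))"
      unfolding ED by (simp add: power2_eq_square mult.assoc)
    show "A m = (\<Sum>j\<in>UNIV. p j * U j)" by (simp add: A_def U_def sum_distrib_left mult_ac)
    show "0 \<le> - (N / w) * (\<Sum>i\<in>UNIV. g i * ((c i)^2 / w + w * A i)) - s / w * ((c m)^2 / w + w * A m)
      + 2 * (\<Sum>i\<in>UNIV - {m}. g i * (c m * ((p m)^2 + p m * T i + 2 * (p m)^2 * c i) - 2 * p m * T i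
          - (p m)^2 * c i - p i * U i + 2 * X i * U i + (X i)^2 * c m + p m * T i
          - c i * ((X i)^2 + p i * U i + 2 * X i * p i * c m)))"
    proof -
      let ?V = "\<lambda>i. dd [E m, E m, E i, E i] D x0"
      define L where "L i = b * (?V i / 2 + 2 * (X i / b) * t3 m m i + (X i / b)^2 * h m)
       + p m * t3 m i i + h m / 2 * h i + (1 - k i) * ((X i / b)^2 + p i * t3 m m i + 2 * (X i / b) * p i * h m)" for i
      define P where "P i = (k m - 1) * ((p m / b)^2 + p m * t3 i i m + 2 * (p m / b) * p m * h i) - M * a * W i / 2
       - b * (?V i / 2 + 2 * (p m / b) * t3 i i m + (p m / b)^2 * h i) - p i * t3 i m m - h i * h m / 2" for i
      let ?K = "\<lambda>i. c m * ((p m)^2 + p m * T i + 2 * (p m)^2 * c i) - 2 * p m * T i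
          - (p m)^2 * c i - p i * U i + 2 * X i * U i + (X i)^2 * c m + p m * T i
          - c i * ((X i)^2 + p i * U i + 2 * X i * p i * c m)"
      \<comment> \<open>After reordering, both tests contain the same fourth derivative, which
        enters \<open>L i\<close> and \<open>P i\<close> with opposite signs.\<close>
      have V: "dd [E i, E i, E m, E m] D x0 = ?V i" for i
        using dd_commute[OF smooth x0] by metis
      have Wb: "b^2 * W i = (c i)^2 / w + w * A i" for i
        by (simp add: A_def bh[symmetric] power2_eq_square algebra_simps)
      have "0 \<le> (\<Sum>i\<in>UNIV - {m}. g i * P i)"
        unfolding P_def using psi_test_slanted[OF psi km, unfolded V, of _ "p m / b"] g
        by (intro sum_nonneg mult_nonneg_nonneg less_imp_le[OF g]) auto
      with second_order_test[OF psi km g, of "\<lambda>i. X i / b", folded L_def]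
      have "0 \<le> (\<Sum>i\<in>UNIV - {m}. g i * (L i + P i)) - g m * (M * a * W m / 2) - \<sigma> * (W m / 2)"
        by (simp add: distrib_left[of "g _" "L _"] sum.distrib)
      \<comment> \<open>The factor \<open>2 * b^2\<close> clears the powers of \<open>b\<close> in
        the denominators and the halves from the expansions.\<close>
      then have "0 \<le> 2 * b^2 * ((\<Sum>i\<in>UNIV - {m}. g i * (L i + P i)) - g m * (M * a * W m / 2) - \<sigma> * (W m / 2))"
        by (intro mult_nonneg_nonneg) auto
      also have "\<dots> = (\<Sum>i\<in>UNIV - {m}. g i * (2 * b^2 * (L i + P i))) - g m * (M * a * (b^2 * W m)) - \<sigma> * (b^2 * W m)"
        by (simp add: right_diff_distrib sum_distrib_left mult_ac)
      also have "(\<Sum>i\<in>UNIV - {m}. g i * (2 * b^2 * (L i + P i)))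
         = (\<Sum>i\<in>UNIV - {m}. g i * (2 * ?K i - M * a * (b^2 * W i)))"
      proof (intro sum.cong refl arg_cong2[where f = "(*)"])
        fix i
        have 1: "2 * b^2 * (b * (?V i / 2 + 2 * (X i / b) * t3 m m i + (X i / b)^2 * h m)) =
           b^3 * ?V i + 4 * X i * U i + 2 * (X i)^2 * c m"
          using b0 by (simp add: U_def bh[symmetric] eval_nat_numeral field_simps)
        have 2: "2 * b^2 * ((1 - k i) * ((X i / b)^2 + p i * t3 m m i + 2 * (X i / b) * p i * h m))
           = - 2 * c i * ((X i)^2 + p i * U i + 2 * X i * p i * c m)"
          using b0 by (simp add: U_def c_def[of i] bh[of m, symmetric] power2_eq_square field_simps)
        have 3: "2 * b^2 * ((k m - 1) * ((p m / b)^2 + p m * t3 i i m + 2 * (p m / b) * p m * h i))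
           = 2 * c m * ((p m)^2 + p m * T i + 2 * (p m)^2 * c i)"
          using b0 by (simp add: T_def c_def[of m] bh[of i, symmetric] power2_eq_square field_simps)
        have 4: "2 * b^2 * (b * (?V i / 2 + 2 * (p m / b) * t3 i i m + (p m / b)^2 * h i))
           = b^3 * ?V i + 4 * p m * T i + 2 * (p m)^2 * c i"
          using b0 by (simp add: T_def bh[symmetric] eval_nat_numeral field_simps)
        have 5: "2 * b^2 * (p m * t3 m i i) = 2 * p m * T i" "2 * b^2 * (p i * t3 i m m) = 2 * p i * U i"
          by (simp_all add: T_def U_def sym)
        have "2 * b^2 * (L i + P i) =
            2 * b^2 * (b * (?V i / 2 + 2 * (X i / b) * t3 m m i + (X i / b)^2 * h m))
          + 2 * b^2 * (p m * t3 m i i)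
          + 2 * b^2 * ((1 - k i) * ((X i / b)^2 + p i * t3 m m i + 2 * (X i / b) * p i * h m))
          + 2 * b^2 * ((k m - 1) * ((p m / b)^2 + p m * t3 i i m + 2 * (p m / b) * p m * h i))
          - M * a * (b^2 * W i)
          - 2 * b^2 * (b * (?V i / 2 + 2 * (p m / b) * t3 i i m + (p m / b)^2 * h i))
          - 2 * b^2 * (p i * t3 i m m)"
        proof -
          have "2 * B * ((x1 + x2 + h m / 2 * h i + x3) + (x4 - M * a * Z / 2 - x5 - x6 - h i * h m / 2))
            = 2 * B * x1 + 2 * B * x2 + 2 * B * x3 + 2 * B * x4 - M * a * (B * Z) - 2 * B * x5 - 2 * B * x6"
            for B x1 x2 x3 x4 Z x5 x6 :: real by (simp add: algebra_simps)
          then show ?thesis unfolding L_def P_def .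
        qed
        then show "2 * b^2 * (L i + P i) = 2 * ?K i - M * a * (b^2 * W i)"
          unfolding 1 2 3 4 5 by simp
      qed
      also have "(\<Sum>i\<in>UNIV - {m}. g i * (2 * ?K i - M * a * (b^2 * W i))) - g m * (M * a * (b^2 * W m))
         = 2 * (\<Sum>i\<in>UNIV - {m}. g i * ?K i) - M * a * (\<Sum>i\<in>UNIV. g i * (b^2 * W i))"
        by (simp add: sum.remove[of UNIV m] right_diff_distrib sum_subtractf sum_distrib_left distrib_left mult_ac)
      finally show ?thesis
        unfolding Wb using w_pos by (simp add: N_def s_def algebra_simps)
    qed
    show "U i = - (c m + N * c i) * p i + (if i = m then 2 * (c m)^2 * p m else 0)" for i by (rule Ueq)
    show "w^2 * (\<Sum>i\<in>UNIV. (p i)^2) = w^2 - 1" by (rule sum_p_sq)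
    show "c i > -1" "c i \<le> c m" for i using k[of i] by (simp_all add: c_def)
  qed (use g a wfun_ge_1 in \<open>simp_all add: X_def T_def U_def\<close>)
  then show ?thesis by (simp add: c_def)
qed

end

end

subsection \<open>The maximum principle\<close>

text \<open>The last identity converts a bound on \<open>kappa_max / (nu_last - a)\<close> into the
  form \<open>M * (1 - a * w)\<close> required by the tests.\<close>

lemma nu_last_pos_bounds:
  assumes "a > 0" "nu_last D x \<ge> 2 * a"
  shows "nu_last D x - a \<ge> a" "a * wfun D x \<le> 1 / 2" "a \<le> 1 / 2" "wfun D x \<le> 1 / (2 * a)"
    "wfun D x * (nu_last D x - a) = 1 - a * wfun D x"
proof -
  have w: "wfun D x \<ge> 1" by (rule wfun_ge_1)
  show "nu_last D x - a \<ge> a" using assms by simp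
  show 1: "a * wfun D x \<le> 1 / 2" using assms(2) w by (simp add: nu_last_def field_simps)
  show "a \<le> 1 / 2" 
  proof -
    have "a * 1 \<le> a * wfun D x" using w assms(1) by (intro mult_left_mono) auto
    then show ?thesis using 1 by linarith
  qed
  show "wfun D x \<le> 1 / (2 * a)" using 1 assms(1) by (simp add: field_simps)
  show "wfun D x * (nu_last D x - a) = 1 - a * wfun D x" using w by (simp add: nu_last_def right_diff_distrib mult.commute)
qed

lemma continuous_on_hyp_shape:
  assumes "\<And>ks. continuous_on C (D ks)"
  shows "continuous_on C (\<lambda>x. hyp_shape D x $ i $ j)"
proof -
  have nz: "1 + gradsq D x \<noteq> 0" "wfun D x \<noteq> 0" "1 + wfun D x \<noteq> 0" for x
    using wfun_ge_1[of D x] by (auto simp: gradsq_Dgrad add_nonneg_eq_0_iff)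
  have w: "continuous_on C (wfun D)"
    unfolding wfun_def[abs_def] gradsq_def[abs_def] by (intro continuous_intros assms)
  have gm: "continuous_on C (\<lambda>x. gammaM D x $ k $ l)" for k l
    unfolding gammaM_def vec_lambda_beta by (intro continuous_intros assms w) (use nz in auto)
  have "(\<lambda>x. hyp_shape D x $ i $ j) = (\<lambda>x. D [] x * (1 / wfun D x *
      (\<Sum>k\<in>UNIV. (\<Sum>l\<in>UNIV. gammaM D x $ i $ l * D [l, k] x) * gammaM D x $ k $ j))
      + 1 / wfun D x * mat 1 $ i $ j)"
    by (simp add: fun_eq_iff hyp_shape_def eucl_shape_def nu_last_def matrix_matrix_mult_def hessM_def)
  then show ?thesis
    by (simp only:) (intro continuous_intros assms w gm; use nz in auto)
qed

theorem theorem4p1: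
  fixes f :: "real^'n \<Rightarrow> real"
    and \<sigma> a :: real
    and \<Omega> :: "(real^'n) set"
    and D :: "'n list \<Rightarrow> real^'n \<Rightarrow> real"
  assumes f_struct: "structure_conditions f"
    and sigma: "0 < \<sigma>" "\<sigma> < 1"
    and domain: "open \<Omega>" "connected \<Omega>" "bounded \<Omega>" "\<Omega> \<noteq> {}"
    and smooth: "smooth_family \<Omega> (closure \<Omega>) D"
    and in_halfspace: "\<forall>x\<in>closure \<Omega>. D [] x > 0"
    and convex: "\<forall>x\<in>closure \<Omega>. \<forall>\<kappa>. principal_curvatures D x \<kappa> \<longrightarrow> \<kappa> \<in> Kplus"
    and equation: "\<forall>x\<in>closure \<Omega>. \<forall>\<kappa>. principal_curvatures D x \<kappa> \<longrightarrow> f \<kappa> = \<sigma>"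
    and a_pos: "a > 0"
    and nu_bound: "\<forall>x\<in>closure \<Omega>. nu_last D x \<ge> 2 * a"
  shows "\<forall>x\<in>closure \<Omega>.
           kappa_max D x / (nu_last D x - a)
             \<le> max (4 * real CARD('n) / a ^ 3)
                    (SUP y\<in>frontier \<Omega>. kappa_max D y / (nu_last D y - a))"
proof -
  have cont: "continuous_on (closure \<Omega>) (D ks)" for ks
    using smooth by (simp add: smooth_family_def)
  have sub: "\<Omega> \<subseteq> closure \<Omega>" by (rule closure_subset)
  have sym: "D [i, j] x = D [j, i] x" if "x \<in> closure \<Omega>" for i j x
  proof -
    have "D [i, j] x - D [j, i] x = 0"
    \<comment> \<open>On the boundary the second derivatives are only continuous extensions, so
      their symmetry is passed on from the interior.\<close>
    proof (rule continuous_constant_on_closure[OF _ _ that])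
      show "continuous_on (closure \<Omega>) (\<lambda>x. D [i, j] x - D [j, i] x)"
        by (intro continuous_intros cont)
      show "D [i, j] y - D [j, i] y = 0" if "y \<in> \<Omega>" for y
        using smooth_family_swap[OF smooth that, of "[]" i j "[]"] by simp
    qed
    then show ?thesis by simp
  qed
  note nu = nu_last_pos_bounds[OF a_pos bspec[OF nu_bound]]
  have eig: "\<exists>e l. (\<forall>i j. e i \<bullet> e j = (if i = j then 1 else 0)) \<and> (\<forall>i::'n. hyp_shape D x *v e i = l i *\<^sub>R (e i :: real^'n))"
    if "x \<in> closure \<Omega>" for x
    by (rule symmetric_matrix_eigenbasis[OF hyp_shape_symmetric[of D x]]) (rule sym[OF that])
  have rayleigh: "v \<bullet> (hyp_shape D x *v v) \<le> kappa_max D x * (v \<bullet> v)" if "x \<in> closure \<Omega>" for x v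
    using eig[OF that] kappa_max_eigenbasis(2)[of _ D x] by blast
  have attained: "\<exists>v. norm v = 1 \<and> v \<bullet> (hyp_shape D x *v v) = kappa_max D x" if x: "x \<in> closure \<Omega>" for x
  proof -
    obtain e l where e: "\<And>i j. e i \<bullet> e j = (if i = j then 1 else 0)"
      and l: "\<And>i::'n. hyp_shape D x *v e i = l i *\<^sub>R (e i :: real^'n)" using eig[OF x] by blast
    have "kappa_max D x \<in> range l" unfolding kappa_max_eigenbasis(1)[OF e l] by (intro Max_in) auto
    then obtain m where "l m = kappa_max D x" by auto
    then show ?thesis using l[of m] e[of m m] by (intro exI[of _ "e m"]) (simp add: norm_eq_1)
  qed
  \<comment> \<open>Maximizing over pairs of a point and a unit vector uses only continuity of the
    shape operator and bypasses continuity of \<open>kappa_max\<close>.\<close>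
  define Q where "Q = (\<lambda>(x, v). v \<bullet> (hyp_shape D x *v v) / (nu_last D x - a))"
  let ?K = "closure \<Omega> \<times> sphere (0::real^'n) 1"
  have "compact ?K" using domain(3) by (intro compact_Times) auto
  moreover have "?K \<noteq> {}"
    using domain(4) sub norm_axis_1 by (auto simp: ex_in_conv[symmetric] intro!: exI[of _ "axis undefined 1"])
  moreover have "continuous_on ?K Q"
  proof -
    have 1: "continuous_on ?K (\<lambda>z. hyp_shape D (fst z) $ i $ j)" for i j
      by (rule continuous_on_compose2[OF continuous_on_hyp_shape[of "closure \<Omega>" D, OF cont] continuous_on_fst[OF continuous_on_id]]) auto
    have "continuous_on (closure \<Omega>) (nu_last D)"
      unfolding nu_last_def[abs_def] wfun_def gradsq_def
      by (intro continuous_intros cont) (auto simp: gradsq_Dgrad[unfolded gradsq_def] add_nonneg_eq_0_iff)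
    then have 2: "continuous_on ?K (\<lambda>z. nu_last D (fst z))"
      by (rule continuous_on_compose2[OF _ continuous_on_fst[OF continuous_on_id]]) auto
    have "continuous_on ?K (\<lambda>z. (\<Sum>i\<in>UNIV. snd z $ i * (\<Sum>j\<in>UNIV. hyp_shape D (fst z) $ i $ j * snd z $ j)) / (nu_last D (fst z) - a))"
      using nu(1) a_pos by (intro continuous_intros 1 2) force
    then show ?thesis
      by (simp add: Q_def case_prod_beta inner_vec_def matrix_vector_mult_def)
  qed
  ultimately obtain z where z: "z \<in> ?K" "\<forall>y\<in>?K. Q y \<le> Q z"
    using continuous_attains_sup[of ?K Q] by blast
  obtain x0 v0 where zx: "z = (x0, v0)" by (cases z)
  have x0c: "x0 \<in> closure \<Omega>" and v0: "v0 \<bullet> v0 = 1" using z(1) by (auto simp: zx norm_eq_1)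
  define M where "M = kappa_max D x0 / (nu_last D x0 - a)"
  have bound: "kappa_max D x / (nu_last D x - a) \<le> M" if x: "x \<in> closure \<Omega>" for x
  proof -
    obtain v where v: "norm v = 1" "v \<bullet> (hyp_shape D x *v v) = kappa_max D x" using attained[OF x] by blast
    have "kappa_max D x / (nu_last D x - a) \<le> Q z" using z(2) x v by (force simp: Q_def)
    also have "\<dots> \<le> M"
      unfolding M_def zx Q_def prod.case using rayleigh[OF x0c, of v0] v0 nu(1)[OF x0c] a_pos by (intro divide_right_mono) auto
    finally show ?thesis .
  qed
  have "M \<le> max (4 * real CARD('n) / a ^ 3) (SUP y\<in>frontier \<Omega>. kappa_max D y / (nu_last D y - a))"
  proof (cases "x0 \<in> frontier \<Omega>")
    case True
    \<comment> \<open>The real supremum is meaningful only for a set bounded above; the global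
      maximum \<open>M\<close> itself is a bound.\<close>
    have "bdd_above ((\<lambda>y. kappa_max D y / (nu_last D y - a)) ` frontier \<Omega>)"
      using bound by (intro bdd_aboveI2[of _ _ M]) (auto simp: frontier_def)
    then have "M \<le> (SUP y\<in>frontier \<Omega>. kappa_max D y / (nu_last D y - a))"
      unfolding M_def by (rule cSUP_upper[OF True])
    then show ?thesis by simp
  next
    case False
    then have in\<Omega>: "x0 \<in> \<Omega>" using x0c domain(1) by (auto simp: frontier_def interior_open)
    let ?w = "wfun D x0"
    have w: "?w \<ge> 1" by (rule wfun_ge_1)
    obtain e l where e: "\<And>i j. e i \<bullet> e j = (if i = j then 1 else 0)"
      and l: "\<And>i::'n. hyp_shape D x0 *v e i = l i *\<^sub>R (e i :: real^'n)" using eig[OF x0c] by blast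
    have pc: "principal_curvatures D x0 (\<chi> i. l i)" by (rule principal_curvatures_eigenbasis[OF e l])
    then have kp: "(\<chi> i. l i) \<in> Kplus" and fk: "f (\<chi> i. l i) = \<sigma>" using convex equation x0c by blast+
    obtain g where g: "\<And>i. g i > 0" "(\<Sum>i\<in>UNIV. g i * l i) = \<sigma>" "\<And>l. l \<in> Kplus \<Longrightarrow> f l \<le> (\<Sum>i\<in>UNIV. g i * l $ i)"
      using structure_supergradient[OF f_struct kp] unfolding fk vec_lambda_beta by blast
    have "kappa_max D x0 \<in> range l" unfolding kappa_max_eigenbasis(1)[OF e l] by (intro Max_in) auto
    then obtain m where m: "l m = kappa_max D x0" by auto
    have lm: "l i \<le> l m" for i unfolding m kappa_max_eigenbasis(1)[OF e l] by (intro Max_ge) auto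
    define E where "E i = gammaM D x0 *v e i" for i
    interpret adapted_frame \<Omega> "closure \<Omega>" D x0 E "\<lambda>i. ?w * l i"
    proof
      show "smooth_family \<Omega> (closure \<Omega>) D" "x0 \<in> \<Omega>" by fact+
      show "D [] x0 > 0" using in_halfspace x0c by blast
      show "gform D x0 (E i) (E j) = (if i = j then 1 else 0)" for i j
        by (simp add: E_def gform_gammaM e)
      show "phess D x0 (E i) (E j) = (if i = j then ?w * l i else 0)" for i j
      proof -
        have "phess D x0 (E i) (E j) = ?w * (e i \<bullet> (hyp_shape D x0 *v e j))"
          using w by (simp add: hyp_shape_form E_def)
        then show ?thesis by (simp add: l e)
      qed
      show "q = (\<Sum>j\<in>UNIV. (q \<bullet> E j) *\<^sub>R E j) + ((Dgrad D x0 \<bullet> q) / ?w^2) *\<^sub>R Dgrad D x0" for q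
      proof -
        have "gammaM D x0 *v (gammaM D x0 *v q) = gammaM D x0 *v (\<Sum>j\<in>UNIV. (e j \<bullet> (gammaM D x0 *v q)) *\<^sub>R e j)"
          by (rule arg_cong[OF orthonormal_expansion[OF e]])
        also have "\<dots> = (\<Sum>j\<in>UNIV. (q \<bullet> E j) *\<^sub>R E j)"
          by (simp add: E_def linear_sum[OF matrix_vector_mul_linear] matrix_vector_mult_scaleR
              gammaM_selfadjoint[of "e _"] inner_commute[of q])
        finally show ?thesis unfolding gammaM_gammaM by (simp add: algebra_simps)
      qed
    qed
    have "?w * l m \<le> 12 * ?w^2"
    proof (rule interior_estimate[of \<sigma> g M a m])
      show "\<sigma> * wfun D x \<le> (\<Sum>i\<in>UNIV. g i * phess D x (F i) (F i))"
        if "x \<in> \<Omega>" "\<And>i j. gform D x (F i) (F j) = (if i = j then 1 else 0)" for x F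
      proof (rule curvature_frame_inequality[OF _ g(3) _ _ that(2)])
        show "symmetric_fun f" using f_struct by (simp add: structure_conditions_def)
        show "D [i, j] x = D [j, i] x" for i j using sym that(1) sub by blast
        show "\<kappa> \<in> Kplus \<and> f \<kappa> = \<sigma>" if "principal_curvatures D x \<kappa>" for \<kappa>
          using convex equation that \<open>x \<in> \<Omega>\<close> sub by blast
      qed
      show "(\<Sum>i\<in>UNIV. g i * (?w * l i)) = \<sigma> * ?w"
        unfolding g(2)[symmetric] by (simp add: sum_distrib_left sum_distrib_right mult_ac)
      show "phess D x v v \<le> M * (1 - a * wfun D x) * gform D x v v" if "x \<in> \<Omega>" for x v
      proof -
        have x: "x \<in> closure \<Omega>" using that sub by blast
        obtain q where q: "gammaM D x *v q = v" using gammaM_surj by blast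
        have wx: "wfun D x \<ge> 1" by (rule wfun_ge_1)
        have "kappa_max D x \<le> M * (nu_last D x - a)"
          using bound[OF x] nu(1)[OF x] a_pos by (simp add: pos_divide_le_eq)
        then have "kappa_max D x * (q \<bullet> q) \<le> M * (nu_last D x - a) * (q \<bullet> q)"
          by (rule mult_right_mono) simp
        then have "q \<bullet> (hyp_shape D x *v q) \<le> M * (nu_last D x - a) * (q \<bullet> q)"
          using rayleigh[OF x, of q] by linarith
        then have "wfun D x * (q \<bullet> (hyp_shape D x *v q)) \<le> wfun D x * (M * (nu_last D x - a) * (q \<bullet> q))"
          using wx by (intro mult_left_mono) auto
        also have "\<dots> = M * (wfun D x * (nu_last D x - a)) * (q \<bullet> q)" by simp
        finally show ?thesis
          using wx unfolding nu(5)[OF x] by (simp add: hyp_shape_form q[symmetric] gform_gammaM)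
      qed
      have "l m = M * (nu_last D x0 - a)" using nu(1)[OF x0c] a_pos by (simp add: m M_def)
      then have "?w * l m = M * (?w * (nu_last D x0 - a))" by simp
      then show "?w * l m = M * (1 - a * ?w)" unfolding nu(5)[OF x0c] .
      show "?w * l i > 0" for i using kp w by (auto simp: Kplus_def intro!: mult_pos_pos)
      show "?w * l i \<le> ?w * l m" for i using lm w by (intro mult_left_mono) auto
      show "a * ?w \<le> 1 / 2" by (rule nu(2)[OF x0c])
    qed (use g a_pos in auto)
    then have "l m \<le> 12 * ?w" using w by (simp add: power2_eq_square)
    also have "\<dots> \<le> 12 * (1 / (2 * a))" using nu(4)[OF x0c] by (rule mult_left_mono) simp
    finally have lma: "l m \<le> 6 / a" by simp
    \<comment> \<open>The denominator \<open>nu_last D x0 - a\<close> is at least \<open>a\<close>,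
      because \<open>nu_last D x0 \<ge> 2 * a\<close>.\<close>
    have "M \<le> (6 / a) / a"
      unfolding M_def m[symmetric] using lma nu(1)[OF x0c] a_pos kp
      by (intro frac_le) auto
    also have "\<dots> = (6 * a) / a^3" using a_pos by (simp add: eval_nat_numeral)
    \<comment> \<open>Here \<open>6 * a \<le> 3\<close>, since \<open>a \<le> 1 / 2\<close>, while
      \<open>4 * n \<ge> 4\<close>.\<close>
    also have "\<dots> \<le> 4 * real CARD('n) / a^3"
    proof (rule divide_right_mono)
      have "real CARD('n) \<ge> 1" using zero_less_card_finite[where 'a='n] by linarith
      then show "6 * a \<le> 4 * real CARD('n)" using nu(3)[OF x0c] by linarith
    qed (use a_pos in simp)
    finally show ?thesis by simp
  qed
  then show ?thesis using bound order_trans by blast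
qed

end
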